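(* Let $R$ be a commutative Noetherian local ring and let $M$ be a finitely generated two-periodic $R$-module with finite Gorenstein dimension. Let $N$ be any finitely generated $R$-module such that the pair $(M,N)$ is Tor-independent over $R$, i.e. $\operatorname{Tor}_i^R(M,N)=0$ for all $i\ge 1$. Then the natural map $$M\otimes_R N \longrightarrow \operatorname{Hom}_R(M^*,N)$$ is an isomorphism.
   Context: For an $R$-module $M$, $M^*=\operatorname{Hom}_R(M,R)$. For a finitely generated module $M$ over a local ring, $\Omega^i_R M$ denotes the $i$-th syzygy of $M$ in its minimal free resolution. $M$ is two-periodic if $M\cong\Omega^2_R M$ (equivalently, there is a degree $-2$ map of complexes $s$ from the minimal free resolution $\mathbf F$ of $M$ to itself with $s:F_{i+2}\to F_i$ an isomorphism for all $i\ge 0$). The natural map is the composition of $M\otimes_R N\to M^{**}\otimes_R N$, induced by the canonical map $M\to M^{**}$, with the map $M^{**}\otimes_R N\to\operatorname{Hom}_R(M^*,N)$, $\phi\otimes n\mapsto (f\mapsto \phi(f)\,n)$. *)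

theory Defs
  imports "HOL-Algebra.Module" "HOL-Algebra.Ring_Divisibility"
begin

section \<open>Modules over a commutative ring\<close>

subsection \<open>Homomorphisms, generated submodules, quotients\<close>

text \<open>Homomorphisms are taken extensional, so that \<open>Hom(M,N)\<close> is itself a module under pointwise
  operations. The fields \<open>mult\<close> and \<open>one\<close>, which the record type \<open>module\<close> inherits from
  \<open>ring\<close>, carry no meaning for a module.\<close>

definition mod_hom ::
  "('a, 'r) ring_scheme \<Rightarrow> ('a, 'm, 'x) module_scheme \<Rightarrow> ('a, 'n, 'y) module_scheme \<Rightarrow> ('m \<Rightarrow> 'n) set"
  where "mod_hom R M N = {f \<in> carrier M \<rightarrow>\<^sub>E carrier N.
     (\<forall>x\<in>carrier M. \<forall>y\<in>carrier M. f (x \<oplus>\<^bsub>M\<^esub> y) = f x \<oplus>\<^bsub>N\<^esub> f y) \<and>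
     (\<forall>r\<in>carrier R. \<forall>x\<in>carrier M. f (r \<odot>\<^bsub>M\<^esub> x) = r \<odot>\<^bsub>N\<^esub> f x)}"

definition mod_iso ::
  "('a, 'r) ring_scheme \<Rightarrow> ('a, 'm, 'x) module_scheme \<Rightarrow> ('a, 'n, 'y) module_scheme \<Rightarrow> ('m \<Rightarrow> 'n) set"
  where "mod_iso R M N = {f \<in> mod_hom R M N. bij_betw f (carrier M) (carrier N)}"

definition mod_isomorphic ::
  "('a, 'r) ring_scheme \<Rightarrow> ('a, 'm, 'x) module_scheme \<Rightarrow> ('a, 'n, 'y) module_scheme \<Rightarrow> bool"
  where "mod_isomorphic R M N \<longleftrightarrow> mod_iso R M N \<noteq> {}"

definition hom_module ::
  "('a, 'r) ring_scheme \<Rightarrow> ('a, 'm, 'x) module_scheme \<Rightarrow> ('a, 'n, 'y) module_scheme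
    \<Rightarrow> ('a, 'm \<Rightarrow> 'n) module"
  where "hom_module R M N =
    \<lparr>carrier = mod_hom R M N, mult = undefined, one = undefined,
     zero = (\<lambda>x\<in>carrier M. \<zero>\<^bsub>N\<^esub>),
     add = (\<lambda>f g. \<lambda>x\<in>carrier M. f x \<oplus>\<^bsub>N\<^esub> g x),
     smult = (\<lambda>r f. \<lambda>x\<in>carrier M. r \<odot>\<^bsub>N\<^esub> f x)\<rparr>"

definition gen_submodule ::
  "('a, 'r) ring_scheme \<Rightarrow> ('a, 'm, 'x) module_scheme \<Rightarrow> 'm set \<Rightarrow> 'm set"
  where "gen_submodule R M A = \<Inter>{U. submodule U R M \<and> A \<subseteq> U}"

definition fin_gen_module :: "('a, 'r) ring_scheme \<Rightarrow> ('a, 'm, 'x) module_scheme \<Rightarrow> bool"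
  where "fin_gen_module R M \<longleftrightarrow>
    module R M \<and> (\<exists>A \<subseteq> carrier M. finite A \<and> gen_submodule R M A = carrier M)"

definition zero_module :: "('a, 'm, 'x) module_scheme \<Rightarrow> bool"
  where "zero_module M \<longleftrightarrow> carrier M = {\<zero>\<^bsub>M\<^esub>}"

definition quot_module :: "('a, 'm, 'x) module_scheme \<Rightarrow> 'm set \<Rightarrow> ('a, 'm set) module"
  where "quot_module M U =
    \<lparr>carrier = a_rcosets\<^bsub>M\<^esub> U, mult = undefined, one = undefined, zero = U, add = set_add M,
     smult = (\<lambda>r X. \<Union>x\<in>X. U +>\<^bsub>M\<^esub> (r \<odot>\<^bsub>M\<^esub> x))\<rparr>"

definition self_module :: "('a, 'r) ring_scheme \<Rightarrow> ('a, 'a) module"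
  where "self_module R =
    \<lparr>carrier = carrier R, mult = mult R, one = \<one>\<^bsub>R\<^esub>, zero = \<zero>\<^bsub>R\<^esub>, add = add R,
     smult = mult R\<rparr>"

text \<open>The free module on a set \<open>S\<close>; in particular \<open>R\<^sup>n\<close> is \<open>free_module R {..<n}\<close>.\<close>

definition free_module :: "('a, 'r) ring_scheme \<Rightarrow> 's set \<Rightarrow> ('a, 's \<Rightarrow> 'a) module"
  where "free_module R S =
    \<lparr>carrier = {c \<in> S \<rightarrow>\<^sub>E carrier R. finite {s \<in> S. c s \<noteq> \<zero>\<^bsub>R\<^esub>}},
     mult = undefined, one = undefined,
     zero = (\<lambda>s\<in>S. \<zero>\<^bsub>R\<^esub>),
     add = (\<lambda>c d. \<lambda>s\<in>S. c s \<oplus>\<^bsub>R\<^esub> d s),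
     smult = (\<lambda>r c. \<lambda>s\<in>S. r \<otimes>\<^bsub>R\<^esub> c s)\<rparr>"

definition free_gen :: "('a, 'r) ring_scheme \<Rightarrow> 's set \<Rightarrow> 's \<Rightarrow> 's \<Rightarrow> 'a"
  where "free_gen R S s = (\<lambda>t\<in>S. if t = s then \<one>\<^bsub>R\<^esub> else \<zero>\<^bsub>R\<^esub>)"

text \<open>The linear extension of \<open>\<beta> : S \<rightarrow> P\<close> to the free module on \<open>S\<close>.\<close>

definition lin_ext ::
  "('a, 'r) ring_scheme \<Rightarrow> ('a, 'p, 'z) module_scheme \<Rightarrow> 's set \<Rightarrow> ('s \<Rightarrow> 'p) \<Rightarrow> ('s \<Rightarrow> 'a) \<Rightarrow> 'p"
  where "lin_ext R P S \<beta> c = (\<Oplus>\<^bsub>P\<^esub>s\<in>{s \<in> S. c s \<noteq> \<zero>\<^bsub>R\<^esub>}. c s \<odot>\<^bsub>P\<^esub> \<beta> s)"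


subsection \<open>Tensor products\<close>

definition tensor_rels ::
  "('a, 'r) ring_scheme \<Rightarrow> ('a, 'm, 'x) module_scheme \<Rightarrow> ('a, 'n, 'y) module_scheme
    \<Rightarrow> ('m \<times> 'n \<Rightarrow> 'a) set"
  where "tensor_rels R M N =
    (let F = free_module R (carrier M \<times> carrier N);
         g = (\<lambda>m n. free_gen R (carrier M \<times> carrier N) (m, n))
     in {g (m \<oplus>\<^bsub>M\<^esub> m') n \<ominus>\<^bsub>F\<^esub> (g m n \<oplus>\<^bsub>F\<^esub> g m' n) | m m' n.
           m \<in> carrier M \<and> m' \<in> carrier M \<and> n \<in> carrier N} \<union>
        {g m (n \<oplus>\<^bsub>N\<^esub> n') \<ominus>\<^bsub>F\<^esub> (g m n \<oplus>\<^bsub>F\<^esub> g m n') | m n n'.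
           m \<in> carrier M \<and> n \<in> carrier N \<and> n' \<in> carrier N} \<union>
        {g (r \<odot>\<^bsub>M\<^esub> m) n \<ominus>\<^bsub>F\<^esub> r \<odot>\<^bsub>F\<^esub> g m n | r m n.
           r \<in> carrier R \<and> m \<in> carrier M \<and> n \<in> carrier N} \<union>
        {g m (r \<odot>\<^bsub>N\<^esub> n) \<ominus>\<^bsub>F\<^esub> r \<odot>\<^bsub>F\<^esub> g m n | r m n.
           r \<in> carrier R \<and> m \<in> carrier M \<and> n \<in> carrier N})"

definition tensor_kernel ::
  "('a, 'r) ring_scheme \<Rightarrow> ('a, 'm, 'x) module_scheme \<Rightarrow> ('a, 'n, 'y) module_scheme
    \<Rightarrow> ('m \<times> 'n \<Rightarrow> 'a) set"
  where "tensor_kernel R M N =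
    gen_submodule R (free_module R (carrier M \<times> carrier N)) (tensor_rels R M N)"

definition tensor ::
  "('a, 'r) ring_scheme \<Rightarrow> ('a, 'm, 'x) module_scheme \<Rightarrow> ('a, 'n, 'y) module_scheme
    \<Rightarrow> ('a, ('m \<times> 'n \<Rightarrow> 'a) set) module"
  where "tensor R M N =
    quot_module (free_module R (carrier M \<times> carrier N)) (tensor_kernel R M N)"

definition pure_tensor ::
  "('a, 'r) ring_scheme \<Rightarrow> ('a, 'm, 'x) module_scheme \<Rightarrow> ('a, 'n, 'y) module_scheme
    \<Rightarrow> 'm \<Rightarrow> 'n \<Rightarrow> ('m \<times> 'n \<Rightarrow> 'a) set"
  where "pure_tensor R M N m n =
    tensor_kernel R M N +>\<^bsub>free_module R (carrier M \<times> carrier N)\<^esub>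
      free_gen R (carrier M \<times> carrier N) (m, n)"

text \<open>The linear map \<open>M \<otimes> N \<rightarrow> P\<close> induced by a bilinear map \<open>\<beta> : M \<times> N \<rightarrow> P\<close>.
  The linear extension of \<open>\<beta>\<close> is constant on each coset, see \<open>tensor_lift_pure\<close> below.\<close>

definition tensor_lift ::
  "('a, 'r) ring_scheme \<Rightarrow> ('a, 'm, 'x) module_scheme \<Rightarrow> ('a, 'n, 'y) module_scheme
    \<Rightarrow> ('a, 'p, 'z) module_scheme \<Rightarrow> ('m \<times> 'n \<Rightarrow> 'p) \<Rightarrow> ('m \<times> 'n \<Rightarrow> 'a) set \<Rightarrow> 'p"
  where "tensor_lift R M N P \<beta> =
    (\<lambda>X\<in>carrier (tensor R M N). the_elem (lin_ext R P (carrier M \<times> carrier N) \<beta> ` X))"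

text \<open>\<open>f \<otimes> g : M \<otimes> N \<rightarrow> M' \<otimes> N'\<close>\<close>

definition tensor_map ::
  "('a, 'r) ring_scheme \<Rightarrow> ('a, 'm, 'x) module_scheme \<Rightarrow> ('a, 'n, 'y) module_scheme
    \<Rightarrow> ('a, 'm1, 'x1) module_scheme \<Rightarrow> ('a, 'n1, 'y1) module_scheme
    \<Rightarrow> ('m \<Rightarrow> 'm1) \<Rightarrow> ('n \<Rightarrow> 'n1) \<Rightarrow> ('m \<times> 'n \<Rightarrow> 'a) set \<Rightarrow> ('m1 \<times> 'n1 \<Rightarrow> 'a) set"
  where "tensor_map R M N M' N' f g =
    tensor_lift R M N (tensor R M' N') (\<lambda>(m, n). pure_tensor R M' N' (f m) (g n))"


subsection \<open>Duals and the natural map\<close>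

definition dual :: "('a, 'r) ring_scheme \<Rightarrow> ('a, 'm, 'x) module_scheme \<Rightarrow> ('a, 'm \<Rightarrow> 'a) module"
  where "dual R M = hom_module R M (self_module R)"

definition bidual_map ::
  "('a, 'r) ring_scheme \<Rightarrow> ('a, 'm, 'x) module_scheme \<Rightarrow> 'm \<Rightarrow> ('m \<Rightarrow> 'a) \<Rightarrow> 'a"
  where "bidual_map R M = (\<lambda>x\<in>carrier M. \<lambda>f\<in>carrier (dual R M). f x)"

text \<open>\<open>M\<^sup>*\<^sup>* \<otimes> N \<rightarrow> Hom(M\<^sup>*, N)\<close>, \<open>\<phi> \<otimes> n \<mapsto> (f \<mapsto> \<phi>(f) n)\<close>\<close>

definition bidual_tensor_eval ::
  "('a, 'r) ring_scheme \<Rightarrow> ('a, 'm, 'x) module_scheme \<Rightarrow> ('a, 'n, 'y) module_scheme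
    \<Rightarrow> ((('m \<Rightarrow> 'a) \<Rightarrow> 'a) \<times> 'n \<Rightarrow> 'a) set \<Rightarrow> ('m \<Rightarrow> 'a) \<Rightarrow> 'n"
  where "bidual_tensor_eval R M N =
    tensor_lift R (dual R (dual R M)) N (hom_module R (dual R M) N)
      (\<lambda>(\<phi>, n). \<lambda>f\<in>carrier (dual R M). \<phi> f \<odot>\<^bsub>N\<^esub> n)"

definition natural_map ::
  "('a, 'r) ring_scheme \<Rightarrow> ('a, 'm, 'x) module_scheme \<Rightarrow> ('a, 'n, 'y) module_scheme
    \<Rightarrow> ('m \<times> 'n \<Rightarrow> 'a) set \<Rightarrow> ('m \<Rightarrow> 'a) \<Rightarrow> 'n"
  where "natural_map R M N =
    compose (carrier (tensor R M N)) (bidual_tensor_eval R M N)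
      (tensor_map R M N (dual R (dual R M)) N (bidual_map R M) (\<lambda>n\<in>carrier N. n))"


subsection \<open>Module structures and universal property\<close>

lemma self_module_is_module: "cring R \<Longrightarrow> module R (self_module R)"
proof -
  assume R: "cring R"
  interpret cring R by fact
  have ag: "abelian_group (self_module R)"
  proof (rule abelian_groupI)
    fix x assume "x \<in> carrier (self_module R)"
    then show "\<exists>y\<in>carrier (self_module R). y \<oplus>\<^bsub>self_module R\<^esub> x = \<zero>\<^bsub>self_module R\<^esub>"
      by (intro bexI[of _ "\<ominus>\<^bsub>R\<^esub> x"]) (simp_all add: self_module_def l_neg)
  qed (simp_all add: self_module_def a_ac)
  show ?thesis
    by (rule moduleI[OF R ag]) (simp_all add: self_module_def l_distr r_distr m_assoc)
qed

lemma free_module_is_module: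
  assumes R: "cring R" shows "module R (free_module R S)"
proof -
  interpret cring R by fact
  define F where "F = free_module R S"
  have mem: "c s \<in> carrier R" if "c \<in> carrier F" "s \<in> S" for c s
    using that by (auto simp: F_def free_module_def)
  have eq: "c = d" if "c \<in> carrier F" "d \<in> carrier F" "\<And>s. s \<in> S \<Longrightarrow> c s = d s" for c d
    using that by (intro PiE_ext[of c S "\<lambda>_. carrier R" d]) (auto simp: F_def free_module_def)
  have app: "(c \<oplus>\<^bsub>F\<^esub> d) s = c s \<oplus>\<^bsub>R\<^esub> d s" "(r \<odot>\<^bsub>F\<^esub> c) s = r \<otimes>\<^bsub>R\<^esub> c s" "\<zero>\<^bsub>F\<^esub> s = \<zero>\<^bsub>R\<^esub>"
    if "s \<in> S" for c d r s
    using that by (auto simp: F_def free_module_def)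
  have cl: "f \<in> carrier F"
    if "c \<in> carrier F" "d \<in> carrier F" "f \<in> S \<rightarrow>\<^sub>E carrier R"
      "\<And>s. s \<in> S \<Longrightarrow> c s = \<zero>\<^bsub>R\<^esub> \<Longrightarrow> d s = \<zero>\<^bsub>R\<^esub> \<Longrightarrow> f s = \<zero>\<^bsub>R\<^esub>" for c d f
  proof -
    have "finite ({s \<in> S. c s \<noteq> \<zero>\<^bsub>R\<^esub>} \<union> {s \<in> S. d s \<noteq> \<zero>\<^bsub>R\<^esub>})"
      using that(1,2) by (auto simp: F_def free_module_def)
    then have "finite {s \<in> S. f s \<noteq> \<zero>\<^bsub>R\<^esub>}"
      by (rule rev_finite_subset) (use that(4) in auto)
    then show ?thesis using that(3) by (simp add: F_def free_module_def)
  qed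
  have zero: "\<zero>\<^bsub>F\<^esub> \<in> carrier F" by (auto simp: F_def free_module_def)
  have add: "c \<oplus>\<^bsub>F\<^esub> d \<in> carrier F" if "c \<in> carrier F" "d \<in> carrier F" for c d
  proof (rule cl[OF that])
    show "c \<oplus>\<^bsub>F\<^esub> d \<in> S \<rightarrow>\<^sub>E carrier R"
      using mem[OF that(1)] mem[OF that(2)] by (auto simp: F_def free_module_def)
  qed (simp add: app)
  have smult: "r \<odot>\<^bsub>F\<^esub> c \<in> carrier F" if "r \<in> carrier R" "c \<in> carrier F" for r c
  proof (rule cl[OF that(2) that(2)])
    show "r \<odot>\<^bsub>F\<^esub> c \<in> S \<rightarrow>\<^sub>E carrier R"
      using mem[OF that(2)] that(1) by (auto simp: F_def free_module_def)
  qed (simp add: app that)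
  have ag: "abelian_group F"
  proof (rule abelian_groupI)
    fix c assume c: "c \<in> carrier F"
    have m: "(\<lambda>s\<in>S. \<ominus>\<^bsub>R\<^esub> c s) \<in> carrier F"
      by (rule cl[OF c c]) (use mem[OF c] in auto)
    have "(\<lambda>s\<in>S. \<ominus>\<^bsub>R\<^esub> c s) \<oplus>\<^bsub>F\<^esub> c = \<zero>\<^bsub>F\<^esub>"
      by (rule eq) (use mem[OF c] in \<open>auto simp: add zero m c app l_neg\<close>)
    then show "\<exists>y\<in>carrier F. y \<oplus>\<^bsub>F\<^esub> c = \<zero>\<^bsub>F\<^esub>" using m by blast
  next
    fix x y z assume *: "x \<in> carrier F" "y \<in> carrier F" "z \<in> carrier F"
    show "x \<oplus>\<^bsub>F\<^esub> y \<oplus>\<^bsub>F\<^esub> z = x \<oplus>\<^bsub>F\<^esub> (y \<oplus>\<^bsub>F\<^esub> z)"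
      by (rule eq) (simp_all add: add app mem * a_assoc)
  next
    fix x y assume *: "x \<in> carrier F" "y \<in> carrier F"
    show "x \<oplus>\<^bsub>F\<^esub> y = y \<oplus>\<^bsub>F\<^esub> x"
      by (rule eq) (simp_all add: add app mem * a_comm)
  next
    fix x assume *: "x \<in> carrier F"
    show "\<zero>\<^bsub>F\<^esub> \<oplus>\<^bsub>F\<^esub> x = x"
      by (rule eq) (simp_all add: add zero app mem *)
  qed (simp_all add: zero add)
  have "module R F"
  proof (rule moduleI[OF R ag])
    fix a b x y assume *: "a \<in> carrier R" "x \<in> carrier F"
    show "a \<odot>\<^bsub>F\<^esub> x \<in> carrier F" by (rule smult[OF *])
    show "(a \<oplus>\<^bsub>R\<^esub> b) \<odot>\<^bsub>F\<^esub> x = a \<odot>\<^bsub>F\<^esub> x \<oplus>\<^bsub>F\<^esub> b \<odot>\<^bsub>F\<^esub> x" if "b \<in> carrier R"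
      by (rule eq) (simp_all add: add smult app mem * that l_distr)
    show "a \<odot>\<^bsub>F\<^esub> (x \<oplus>\<^bsub>F\<^esub> y) = a \<odot>\<^bsub>F\<^esub> x \<oplus>\<^bsub>F\<^esub> a \<odot>\<^bsub>F\<^esub> y" if "y \<in> carrier F"
      by (rule eq) (simp_all add: add smult app mem * that r_distr)
    show "(a \<otimes>\<^bsub>R\<^esub> b) \<odot>\<^bsub>F\<^esub> x = a \<odot>\<^bsub>F\<^esub> (b \<odot>\<^bsub>F\<^esub> x)" if "b \<in> carrier R"
      by (rule eq) (simp_all add: smult app mem * that m_assoc)
  next
    fix x assume "x \<in> carrier F"
    then show "\<one>\<^bsub>R\<^esub> \<odot>\<^bsub>F\<^esub> x = x"
      by (intro eq) (simp_all add: smult app mem)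
  qed
  then show ?thesis by (simp add: F_def)
qed

lemma hom_module_is_module:
  assumes M: "module R M" and N: "module R N" shows "module R (hom_module R M N)"
proof -
  interpret M: module R M by fact
  interpret N: module R N by fact
  define H where "H = hom_module R M N"
  have mem: "f s \<in> carrier N" if "f \<in> carrier H" "s \<in> carrier M" for f s
    using that by (auto simp: H_def hom_module_def mod_hom_def)
  have fa: "f (s \<oplus>\<^bsub>M\<^esub> t) = f s \<oplus>\<^bsub>N\<^esub> f t"
    if "f \<in> carrier H" "s \<in> carrier M" "t \<in> carrier M" for f s t
    using that by (auto simp: H_def hom_module_def mod_hom_def)
  have fs: "f (r \<odot>\<^bsub>M\<^esub> t) = r \<odot>\<^bsub>N\<^esub> f t"
    if "f \<in> carrier H" "r \<in> carrier R" "t \<in> carrier M" for f r t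
    using that by (auto simp: H_def hom_module_def mod_hom_def)
  have eq: "f = g" if "f \<in> carrier H" "g \<in> carrier H" "\<And>s. s \<in> carrier M \<Longrightarrow> f s = g s" for f g
    using that by (intro PiE_ext[of f "carrier M" "\<lambda>_. carrier N" g])
      (auto simp: H_def hom_module_def mod_hom_def)
  have app: "(f \<oplus>\<^bsub>H\<^esub> g) s = f s \<oplus>\<^bsub>N\<^esub> g s" "(r \<odot>\<^bsub>H\<^esub> f) s = r \<odot>\<^bsub>N\<^esub> f s" "\<zero>\<^bsub>H\<^esub> s = \<zero>\<^bsub>N\<^esub>"
    if "s \<in> carrier M" for f g r s
    using that by (auto simp: H_def hom_module_def)
  have cl: "f \<in> carrier H" if "f \<in> extensional (carrier M)"
     "\<And>s. s \<in> carrier M \<Longrightarrow> f s \<in> carrier N"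
     "\<And>s t. s \<in> carrier M \<Longrightarrow> t \<in> carrier M \<Longrightarrow> f (s \<oplus>\<^bsub>M\<^esub> t) = f s \<oplus>\<^bsub>N\<^esub> f t"
     "\<And>r t. r \<in> carrier R \<Longrightarrow> t \<in> carrier M \<Longrightarrow> f (r \<odot>\<^bsub>M\<^esub> t) = r \<odot>\<^bsub>N\<^esub> f t" for f
    using that by (auto simp: H_def hom_module_def mod_hom_def PiE_def)
  have ext: "f \<oplus>\<^bsub>H\<^esub> g \<in> extensional (carrier M)" "r \<odot>\<^bsub>H\<^esub> f \<in> extensional (carrier M)"
     "\<zero>\<^bsub>H\<^esub> \<in> extensional (carrier M)" for f g r
    by (auto simp: H_def hom_module_def)
  have zero: "\<zero>\<^bsub>H\<^esub> \<in> carrier H" by (rule cl) (simp_all add: ext app)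
  have add: "f \<oplus>\<^bsub>H\<^esub> g \<in> carrier H" if "f \<in> carrier H" "g \<in> carrier H" for f g
    by (rule cl) (simp_all add: ext app that mem fa fs N.smult_r_distr N.a_ac)
  have smult: "r \<odot>\<^bsub>H\<^esub> f \<in> carrier H" if r: "r \<in> carrier R" and f: "f \<in> carrier H" for r f
  proof (rule cl)
    fix a t assume *: "a \<in> carrier R" "t \<in> carrier M"
    show "(r \<odot>\<^bsub>H\<^esub> f) (a \<odot>\<^bsub>M\<^esub> t) = a \<odot>\<^bsub>N\<^esub> (r \<odot>\<^bsub>H\<^esub> f) t"
      using N.smult_assoc1[OF r *(1) mem[OF f *(2)]] N.smult_assoc1[OF *(1) r mem[OF f *(2)]]
        M.R.m_comm[OF r *(1)]
      by (simp add: app fs * r f)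
  qed (simp_all add: ext app r f mem fa N.smult_r_distr)
  have ag: "abelian_group H"
  proof (rule abelian_groupI)
    fix f assume f: "f \<in> carrier H"
    have m: "(\<lambda>s\<in>carrier M. \<ominus>\<^bsub>N\<^esub> f s) \<in> carrier H"
      by (rule cl) (simp_all add: f mem fa fs N.minus_add N.smult_r_minus)
    have "(\<lambda>s\<in>carrier M. \<ominus>\<^bsub>N\<^esub> f s) \<oplus>\<^bsub>H\<^esub> f = \<zero>\<^bsub>H\<^esub>"
      by (rule eq) (simp_all add: add zero m f app mem N.l_neg)
    then show "\<exists>y\<in>carrier H. y \<oplus>\<^bsub>H\<^esub> f = \<zero>\<^bsub>H\<^esub>" using m by blast
  next
    fix x y z assume *: "x \<in> carrier H" "y \<in> carrier H" "z \<in> carrier H"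
    show "x \<oplus>\<^bsub>H\<^esub> y \<oplus>\<^bsub>H\<^esub> z = x \<oplus>\<^bsub>H\<^esub> (y \<oplus>\<^bsub>H\<^esub> z)"
      by (rule eq) (simp_all add: add app mem * N.a_assoc)
  next
    fix x y assume *: "x \<in> carrier H" "y \<in> carrier H"
    show "x \<oplus>\<^bsub>H\<^esub> y = y \<oplus>\<^bsub>H\<^esub> x"
      by (rule eq) (simp_all add: add app mem * N.a_comm)
  next
    fix x assume *: "x \<in> carrier H"
    show "\<zero>\<^bsub>H\<^esub> \<oplus>\<^bsub>H\<^esub> x = x"
      by (rule eq) (simp_all add: add zero app mem *)
  qed (simp_all add: zero add)
  have "module R H"
  proof (rule moduleI[OF M.is_cring ag])
    fix a b x y assume *: "a \<in> carrier R" "x \<in> carrier H"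
    show "a \<odot>\<^bsub>H\<^esub> x \<in> carrier H" by (rule smult[OF *])
    show "(a \<oplus>\<^bsub>R\<^esub> b) \<odot>\<^bsub>H\<^esub> x = a \<odot>\<^bsub>H\<^esub> x \<oplus>\<^bsub>H\<^esub> b \<odot>\<^bsub>H\<^esub> x" if "b \<in> carrier R"
      by (rule eq) (simp_all add: add smult app mem * that N.smult_l_distr)
    show "a \<odot>\<^bsub>H\<^esub> (x \<oplus>\<^bsub>H\<^esub> y) = a \<odot>\<^bsub>H\<^esub> x \<oplus>\<^bsub>H\<^esub> a \<odot>\<^bsub>H\<^esub> y" if "y \<in> carrier H"
      by (rule eq) (simp_all add: add smult app mem * that N.smult_r_distr)
    show "(a \<otimes>\<^bsub>R\<^esub> b) \<odot>\<^bsub>H\<^esub> x = a \<odot>\<^bsub>H\<^esub> (b \<odot>\<^bsub>H\<^esub> x)" if "b \<in> carrier R"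
      by (rule eq) (simp_all add: smult app mem * that N.smult_assoc1)
  next
    fix x assume "x \<in> carrier H"
    then show "\<one>\<^bsub>R\<^esub> \<odot>\<^bsub>H\<^esub> x = x"
      by (intro eq) (simp_all add: smult app mem)
  qed
  then show ?thesis by (simp add: H_def)
qed

lemma dual_is_module: assumes M: "module R M" shows "module R (dual R M)"
proof -
  have "cring R" using M by (rule module.axioms)
  show ?thesis unfolding dual_def by (rule hom_module_is_module[OF M self_module_is_module]) fact
qed

lemma gen_submodule_is_submodule:
  assumes M: "module R M" and A: "A \<subseteq> carrier M"
  shows "submodule (gen_submodule R M A) R M" "A \<subseteq> gen_submodule R M A"
proof -
  interpret module R M by fact
  have c: "submodule (carrier M) R M" by (rule carrier_is_submodule)
  show "submodule (gen_submodule R M A) R M"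
  proof (rule submoduleI)
    show "gen_submodule R M A \<subseteq> carrier M"
      using c A by (auto simp: gen_submodule_def)
    show "\<zero>\<^bsub>M\<^esub> \<in> gen_submodule R M A"
      using subgroup.one_closed[OF submodule.axioms(1)] by (force simp: gen_submodule_def)
  qed (auto simp: gen_submodule_def dest: submoduleE)
  show "A \<subseteq> gen_submodule R M A" by (auto simp: gen_submodule_def)
qed

lemma submodule_abelian_subgroup:
  assumes M: "module R M" and U: "submodule U R M" shows "abelian_subgroup U M"
proof -
  interpret module R M by fact
  show ?thesis
    by (rule abelian_subgroupI3[OF additive_subgroupI[OF submodule.axioms(1)[OF U]] M.abelian_group_axioms])
qed

lemma quot_smult:
  assumes M: "module R M" and U: "submodule U R M" and "r \<in> carrier R" "x \<in> carrier M"
  shows "r \<odot>\<^bsub>quot_module M U\<^esub> (U +>\<^bsub>M\<^esub> x) = U +>\<^bsub>M\<^esub> (r \<odot>\<^bsub>M\<^esub> x)"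
proof -
  interpret module R M by fact
  interpret U: abelian_subgroup U M by (rule submodule_abelian_subgroup[OF M U])
  have eq: "U +>\<^bsub>M\<^esub> (r \<odot>\<^bsub>M\<^esub> y) = U +>\<^bsub>M\<^esub> (r \<odot>\<^bsub>M\<^esub> x)" if "y \<in> U +>\<^bsub>M\<^esub> x" for y
  proof -
    from that obtain u where u: "u \<in> U" "y = u \<oplus>\<^bsub>M\<^esub> x" by (auto simp: a_r_coset_def')
    then have uc: "u \<in> carrier M" by simp
    have "r \<odot>\<^bsub>M\<^esub> y = r \<odot>\<^bsub>M\<^esub> u \<oplus>\<^bsub>M\<^esub> r \<odot>\<^bsub>M\<^esub> x"
      using u uc assms by (simp add: smult_r_distr)
    moreover have "r \<odot>\<^bsub>M\<^esub> u \<in> U" using submodule.smult_closed[OF U] assms u by blast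
    ultimately have "r \<odot>\<^bsub>M\<^esub> y \<in> U +>\<^bsub>M\<^esub> (r \<odot>\<^bsub>M\<^esub> x)" by (auto simp: a_r_coset_def')
    then show ?thesis
      using U.a_repr_independence' assms by (metis smult_closed)
  qed
  have x: "x \<in> U +>\<^bsub>M\<^esub> x" using assms U.a_rcos_self by blast
  have "(\<Union>y\<in>U +>\<^bsub>M\<^esub> x. U +>\<^bsub>M\<^esub> (r \<odot>\<^bsub>M\<^esub> y)) = U +>\<^bsub>M\<^esub> (r \<odot>\<^bsub>M\<^esub> x)"
    using UN_constant_eq[OF x, of "\<lambda>y. U +>\<^bsub>M\<^esub> (r \<odot>\<^bsub>M\<^esub> y)"] eq by blast
  then show ?thesis by (simp add: quot_module_def)
qed

lemma quot_module_is_module: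
  assumes M: "module R M" and U: "submodule U R M"
  shows "module R (quot_module M U)"
proof -
  interpret module R M by fact
  interpret U: abelian_subgroup U M by (rule submodule_abelian_subgroup[OF M U])
  let ?Q = "quot_module M U"
  have car: "carrier ?Q = (\<lambda>x. U +>\<^bsub>M\<^esub> x) ` carrier M"
    by (auto simp: quot_module_def A_RCOSETS_def')
  have add: "(U +>\<^bsub>M\<^esub> x) \<oplus>\<^bsub>?Q\<^esub> (U +>\<^bsub>M\<^esub> y) = U +>\<^bsub>M\<^esub> (x \<oplus>\<^bsub>M\<^esub> y)"
    if "x \<in> carrier M" "y \<in> carrier M" for x y
    using that by (simp add: quot_module_def U.a_rcos_sum)
  have zero: "\<zero>\<^bsub>?Q\<^esub> = U +>\<^bsub>M\<^esub> \<zero>\<^bsub>M\<^esub>"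
    using U.a_subset by (simp add: quot_module_def)
  note sm = quot_smult[OF M U]
  have ag: "abelian_group ?Q"
  proof (rule abelian_groupI)
    fix X assume "X \<in> carrier ?Q"
    then obtain x where x: "x \<in> carrier M" "X = U +>\<^bsub>M\<^esub> x" by (auto simp: car)
    then have "(U +>\<^bsub>M\<^esub> (\<ominus>\<^bsub>M\<^esub> x)) \<oplus>\<^bsub>?Q\<^esub> X = \<zero>\<^bsub>?Q\<^esub>"
      by (simp add: add zero M.l_neg)
    then show "\<exists>Y\<in>carrier ?Q. Y \<oplus>\<^bsub>?Q\<^esub> X = \<zero>\<^bsub>?Q\<^esub>" using x by (auto simp: car)
  qed (auto simp: car add zero M.a_ac)
  show ?thesis
    by (rule moduleI[OF is_cring ag])
       (auto simp: car add sm smult_l_distr smult_r_distr smult_assoc1)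
qed

lemma lin_ext_eq:
  assumes P: "module R P" and \<beta>: "\<beta> \<in> S \<rightarrow> carrier P"
    and c: "c \<in> carrier (free_module R S)"
    and A: "finite A" "A \<subseteq> S" "{s \<in> S. c s \<noteq> \<zero>\<^bsub>R\<^esub>} \<subseteq> A"
  shows "lin_ext R P S \<beta> c = (\<Oplus>\<^bsub>P\<^esub>s\<in>A. c s \<odot>\<^bsub>P\<^esub> \<beta> s)"
proof -
  interpret P: module R P by fact
  have cm: "c s \<in> carrier R" if "s \<in> S" for s
    using c that by (auto simp: free_module_def)
  have bm: "\<beta> s \<in> carrier P" if "s \<in> S" for s using \<beta> that by auto
  show ?thesis unfolding lin_ext_def
    by (rule P.add.finprod_mono_neutral_cong_left) (use A cm bm in auto)
qed

lemma lin_ext_closed: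
  assumes P: "module R P" and \<beta>: "\<beta> \<in> S \<rightarrow> carrier P"
    and c: "c \<in> carrier (free_module R S)"
  shows "lin_ext R P S \<beta> c \<in> carrier P"
proof -
  interpret P: module R P by fact
  show ?thesis unfolding lin_ext_def
    by (rule P.finsum_closed) (use c \<beta> in \<open>auto simp: free_module_def\<close>)
qed

lemma lin_ext_add:
  assumes P: "module R P" and \<beta>: "\<beta> \<in> S \<rightarrow> carrier P"
    and c: "c \<in> carrier (free_module R S)" and d: "d \<in> carrier (free_module R S)"
  shows "lin_ext R P S \<beta> (c \<oplus>\<^bsub>free_module R S\<^esub> d) = lin_ext R P S \<beta> c \<oplus>\<^bsub>P\<^esub> lin_ext R P S \<beta> d"
proof -
  interpret P: module R P by fact
  interpret F: module R "free_module R S" by (rule free_module_is_module[OF P.is_cring])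
  have cm: "c s \<in> carrier R" and dm: "d s \<in> carrier R" if "s \<in> S" for s
    using c d that by (auto simp: free_module_def)
  have bm: "\<beta> s \<in> carrier P" if "s \<in> S" for s using \<beta> that by auto
  define A where "A = {s \<in> S. c s \<noteq> \<zero>\<^bsub>R\<^esub>} \<union> {s \<in> S. d s \<noteq> \<zero>\<^bsub>R\<^esub>}"
  have A: "finite A" "A \<subseteq> S" using c d by (auto simp: A_def free_module_def)
  have s: "{s \<in> S. (c \<oplus>\<^bsub>free_module R S\<^esub> d) s \<noteq> \<zero>\<^bsub>R\<^esub>} \<subseteq> A"
    by (auto simp: A_def free_module_def)
  have "lin_ext R P S \<beta> (c \<oplus>\<^bsub>free_module R S\<^esub> d)
      = (\<Oplus>\<^bsub>P\<^esub>s\<in>A. (c \<oplus>\<^bsub>free_module R S\<^esub> d) s \<odot>\<^bsub>P\<^esub> \<beta> s)"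
    by (rule lin_ext_eq[OF P \<beta> F.a_closed[OF c d] A s])
  also have "\<dots> = (\<Oplus>\<^bsub>P\<^esub>s\<in>A. c s \<odot>\<^bsub>P\<^esub> \<beta> s \<oplus>\<^bsub>P\<^esub> d s \<odot>\<^bsub>P\<^esub> \<beta> s)"
    by (rule P.finsum_cong')
       (use A cm dm bm in \<open>auto simp: free_module_def P.smult_l_distr subset_iff\<close>)
  also have "\<dots> = (\<Oplus>\<^bsub>P\<^esub>s\<in>A. c s \<odot>\<^bsub>P\<^esub> \<beta> s) \<oplus>\<^bsub>P\<^esub> (\<Oplus>\<^bsub>P\<^esub>s\<in>A. d s \<odot>\<^bsub>P\<^esub> \<beta> s)"
    by (rule P.finsum_addf) (use A cm dm bm in auto)
  also have "\<dots> = lin_ext R P S \<beta> c \<oplus>\<^bsub>P\<^esub> lin_ext R P S \<beta> d"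
    using lin_ext_eq[OF P \<beta> c A] lin_ext_eq[OF P \<beta> d A] by (simp add: A_def)
  finally show ?thesis .
qed

lemma lin_ext_smult:
  assumes P: "module R P" and \<beta>: "\<beta> \<in> S \<rightarrow> carrier P"
    and c: "c \<in> carrier (free_module R S)" and r: "r \<in> carrier R"
  shows "lin_ext R P S \<beta> (r \<odot>\<^bsub>free_module R S\<^esub> c) = r \<odot>\<^bsub>P\<^esub> lin_ext R P S \<beta> c"
proof -
  interpret P: module R P by fact
  interpret F: module R "free_module R S" by (rule free_module_is_module[OF P.is_cring])
  have cm: "c s \<in> carrier R" if "s \<in> S" for s
    using c that by (auto simp: free_module_def)
  have bm: "\<beta> s \<in> carrier P" if "s \<in> S" for s using \<beta> that by auto
  define A where "A = {s \<in> S. c s \<noteq> \<zero>\<^bsub>R\<^esub>}"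
  have A: "finite A" "A \<subseteq> S" using c by (auto simp: A_def free_module_def)
  have s: "{s \<in> S. (r \<odot>\<^bsub>free_module R S\<^esub> c) s \<noteq> \<zero>\<^bsub>R\<^esub>} \<subseteq> A"
    using r by (auto simp: A_def free_module_def)
  have "lin_ext R P S \<beta> (r \<odot>\<^bsub>free_module R S\<^esub> c)
      = (\<Oplus>\<^bsub>P\<^esub>s\<in>A. (r \<odot>\<^bsub>free_module R S\<^esub> c) s \<odot>\<^bsub>P\<^esub> \<beta> s)"
    by (rule lin_ext_eq[OF P \<beta> F.smult_closed[OF r c] A s])
  also have "\<dots> = (\<Oplus>\<^bsub>P\<^esub>s\<in>A. r \<odot>\<^bsub>P\<^esub> (c s \<odot>\<^bsub>P\<^esub> \<beta> s))"
    by (rule P.finsum_cong')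
       (use A cm bm r in \<open>auto simp: free_module_def P.smult_assoc1 subset_iff\<close>)
  also have "\<dots> = r \<odot>\<^bsub>P\<^esub> lin_ext R P S \<beta> c"
    unfolding lin_ext_def A_def[symmetric]
    by (rule P.finsum_smult_ldistr[symmetric]) (use A cm bm r in auto)
  finally show ?thesis .
qed

lemma free_gen_closed: "cring R \<Longrightarrow> free_gen R S s \<in> carrier (free_module R S)"
  by (auto simp: free_gen_def free_module_def cring.cring_simprules intro: finite_subset[of _ "{s}"])

lemma lin_ext_free_gen:
  assumes P: "module R P" and \<beta>: "\<beta> \<in> S \<rightarrow> carrier P" and s: "s \<in> S"
  shows "lin_ext R P S \<beta> (free_gen R S s) = \<beta> s"
proof -
  interpret P: module R P by fact
  have b: "\<beta> s \<in> carrier P" using \<beta> s by auto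
  have "lin_ext R P S \<beta> (free_gen R S s) = (\<Oplus>\<^bsub>P\<^esub>t\<in>{s}. free_gen R S s t \<odot>\<^bsub>P\<^esub> \<beta> t)"
    by (rule lin_ext_eq[OF P \<beta> free_gen_closed[OF P.is_cring]]) (use s in \<open>auto simp: free_gen_def\<close>)
  then show ?thesis using b s by (simp add: free_gen_def)
qed

lemma tensor_rels_subset:
  assumes M: "module R M" and N: "module R N"
  shows "tensor_rels R M N \<subseteq> carrier (free_module R (carrier M \<times> carrier N))"
proof -
  interpret M: module R M by fact
  interpret N: module R N by fact
  interpret F: module R "free_module R (carrier M \<times> carrier N)"
    by (rule free_module_is_module[OF M.is_cring])
  show ?thesis
    unfolding tensor_rels_def Let_def using free_gen_closed[OF M.is_cring]
    by (auto intro!: F.minus_closed F.a_closed F.smult_closed)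
qed

lemma tensor_kernel_submodule:
  assumes "module R M" and "module R N"
  shows "submodule (tensor_kernel R M N) R (free_module R (carrier M \<times> carrier N))"
  unfolding tensor_kernel_def
  by (rule gen_submodule_is_submodule[OF free_module_is_module[OF module.axioms(1)[OF assms(1)]]
        tensor_rels_subset[OF assms]])

lemma tensor_is_module:
  assumes "module R M" and "module R N"
  shows "module R (tensor R M N)"
  unfolding tensor_def
  by (rule quot_module_is_module[OF free_module_is_module[OF module.axioms(1)[OF assms(1)]]
        tensor_kernel_submodule[OF assms]])

lemma tensor_kernel_bilinear:
  assumes M: "module R M" and N: "module R N" and P: "module R P"
    and \<beta>: "\<And>m n. m \<in> carrier M \<Longrightarrow> n \<in> carrier N \<Longrightarrow> \<beta> (m, n) \<in> carrier P"
    and add1: "\<And>m m' n. m \<in> carrier M \<Longrightarrow> m' \<in> carrier M \<Longrightarrow> n \<in> carrier N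
      \<Longrightarrow> \<beta> (m \<oplus>\<^bsub>M\<^esub> m', n) = \<beta> (m, n) \<oplus>\<^bsub>P\<^esub> \<beta> (m', n)"
    and add2: "\<And>m n n'. m \<in> carrier M \<Longrightarrow> n \<in> carrier N \<Longrightarrow> n' \<in> carrier N
      \<Longrightarrow> \<beta> (m, n \<oplus>\<^bsub>N\<^esub> n') = \<beta> (m, n) \<oplus>\<^bsub>P\<^esub> \<beta> (m, n')"
    and sm1: "\<And>r m n. r \<in> carrier R \<Longrightarrow> m \<in> carrier M \<Longrightarrow> n \<in> carrier N
      \<Longrightarrow> \<beta> (r \<odot>\<^bsub>M\<^esub> m, n) = r \<odot>\<^bsub>P\<^esub> \<beta> (m, n)"
    and sm2: "\<And>r m n. r \<in> carrier R \<Longrightarrow> m \<in> carrier M \<Longrightarrow> n \<in> carrier N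
      \<Longrightarrow> \<beta> (m, r \<odot>\<^bsub>N\<^esub> n) = r \<odot>\<^bsub>P\<^esub> \<beta> (m, n)"
    and c: "c \<in> tensor_kernel R M N"
  shows "lin_ext R P (carrier M \<times> carrier N) \<beta> c = \<zero>\<^bsub>P\<^esub>"
proof -
  interpret M: module R M by fact
  interpret N: module R N by fact
  interpret P: module R P by fact
  define S where "S = carrier M \<times> carrier N"
  define F where "F = free_module R S"
  interpret F: module R F
    unfolding F_def by (rule free_module_is_module[OF M.is_cring])
  have \<beta>': "\<beta> \<in> S \<rightarrow> carrier P" using \<beta> by (auto simp: S_def)
  define L where "L = lin_ext R P S \<beta>"
  have La: "L (x \<oplus>\<^bsub>F\<^esub> y) = L x \<oplus>\<^bsub>P\<^esub> L y" if "x \<in> carrier F" "y \<in> carrier F" for x y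
    using that lin_ext_add[OF P \<beta>'] by (simp add: L_def F_def)
  have Ls: "L (r \<odot>\<^bsub>F\<^esub> y) = r \<odot>\<^bsub>P\<^esub> L y" if "r \<in> carrier R" "y \<in> carrier F" for r y
    using that lin_ext_smult[OF P \<beta>'] by (simp add: L_def F_def)
  have Lc: "L y \<in> carrier P" if "y \<in> carrier F" for y
    using that lin_ext_closed[OF P \<beta>'] by (simp add: L_def F_def)
  have Lg: "L (free_gen R S (m, n)) = \<beta> (m, n)" if "m \<in> carrier M" "n \<in> carrier N" for m n
    using that lin_ext_free_gen[OF P \<beta>'] by (simp add: L_def S_def)
  have gc: "free_gen R S (m, n) \<in> carrier F" for m n
    using free_gen_closed[OF M.is_cring] by (simp add: F_def)
  have Lz: "L \<zero>\<^bsub>F\<^esub> = \<zero>\<^bsub>P\<^esub>"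
    using La[of "\<zero>\<^bsub>F\<^esub>" "\<zero>\<^bsub>F\<^esub>"] Lc[of "\<zero>\<^bsub>F\<^esub>"] by (simp add: P.add.l_cancel_one')
  have Ln: "L (\<ominus>\<^bsub>F\<^esub> x) = \<ominus>\<^bsub>P\<^esub> L x" if "x \<in> carrier F" for x
  proof -
    have "L (\<ominus>\<^bsub>F\<^esub> x) \<oplus>\<^bsub>P\<^esub> L x = \<zero>\<^bsub>P\<^esub>" using La[of "\<ominus>\<^bsub>F\<^esub> x" x] that Lz by (simp add: F.l_neg)
    then show ?thesis using P.minus_equality Lc that by simp
  qed
  have Lm: "L (x \<ominus>\<^bsub>F\<^esub> y) = \<zero>\<^bsub>P\<^esub>" if "x \<in> carrier F" "y \<in> carrier F" "L x = L y" for x y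
    using that La Ln Lc by (simp add: a_minus_def P.r_neg)
  have K: "submodule {x \<in> carrier F. L x = \<zero>\<^bsub>P\<^esub>} R F"
    by (rule F.submoduleI) (auto simp: La Ls Ln Lz)
  have "tensor_rels R M N \<subseteq> {x \<in> carrier F. L x = \<zero>\<^bsub>P\<^esub>}"
    unfolding tensor_rels_def Let_def S_def[symmetric] F_def[symmetric]
    by (auto intro!: Lm simp: gc Lg La Ls add1 add2 sm1 sm2)
  then have "tensor_kernel R M N \<subseteq> {x \<in> carrier F. L x = \<zero>\<^bsub>P\<^esub>}"
    using K unfolding tensor_kernel_def gen_submodule_def S_def[symmetric] F_def[symmetric] by blast
  then show ?thesis using c by (auto simp: L_def S_def)
qed

lemma tensor_lift_coset:
  assumes M: "module R M" and N: "module R N" and P: "module R P"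
    and \<beta>: "\<And>m n. m \<in> carrier M \<Longrightarrow> n \<in> carrier N \<Longrightarrow> \<beta> (m, n) \<in> carrier P"
    and add1: "\<And>m m' n. m \<in> carrier M \<Longrightarrow> m' \<in> carrier M \<Longrightarrow> n \<in> carrier N
      \<Longrightarrow> \<beta> (m \<oplus>\<^bsub>M\<^esub> m', n) = \<beta> (m, n) \<oplus>\<^bsub>P\<^esub> \<beta> (m', n)"
    and add2: "\<And>m n n'. m \<in> carrier M \<Longrightarrow> n \<in> carrier N \<Longrightarrow> n' \<in> carrier N
      \<Longrightarrow> \<beta> (m, n \<oplus>\<^bsub>N\<^esub> n') = \<beta> (m, n) \<oplus>\<^bsub>P\<^esub> \<beta> (m, n')"
    and sm1: "\<And>r m n. r \<in> carrier R \<Longrightarrow> m \<in> carrier M \<Longrightarrow> n \<in> carrier N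
      \<Longrightarrow> \<beta> (r \<odot>\<^bsub>M\<^esub> m, n) = r \<odot>\<^bsub>P\<^esub> \<beta> (m, n)"
    and sm2: "\<And>r m n. r \<in> carrier R \<Longrightarrow> m \<in> carrier M \<Longrightarrow> n \<in> carrier N
      \<Longrightarrow> \<beta> (m, r \<odot>\<^bsub>N\<^esub> n) = r \<odot>\<^bsub>P\<^esub> \<beta> (m, n)"
    and c: "c \<in> carrier (free_module R (carrier M \<times> carrier N))"
  shows "tensor_lift R M N P \<beta> (tensor_kernel R M N +>\<^bsub>free_module R (carrier M \<times> carrier N)\<^esub> c)
    = lin_ext R P (carrier M \<times> carrier N) \<beta> c"
proof -
  interpret M: module R M by fact
  interpret P: module R P by fact
  define S where "S = carrier M \<times> carrier N"
  define F where "F = free_module R S"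
  define U where "U = tensor_kernel R M N"
  interpret F: module R F
    unfolding F_def by (rule free_module_is_module[OF M.is_cring])
  have U: "submodule U R F"
    unfolding U_def F_def S_def by (rule tensor_kernel_submodule[OF M N])
  interpret U: abelian_subgroup U F
    by (rule submodule_abelian_subgroup[OF F.module_axioms U])
  have \<beta>': "\<beta> \<in> S \<rightarrow> carrier P" using \<beta> by (auto simp: S_def)
  have cF: "c \<in> carrier F" using c by (simp add: F_def S_def)
  have "lin_ext R P S \<beta> (u \<oplus>\<^bsub>F\<^esub> c) = lin_ext R P S \<beta> c" if "u \<in> U" for u
  proof -
    have u: "u \<in> carrier F" using that by simp
    have "lin_ext R P S \<beta> u = \<zero>\<^bsub>P\<^esub>"
      unfolding S_def
      by (rule tensor_kernel_bilinear[OF M N P \<beta> add1 add2 sm1 sm2]) (use that U_def in auto)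
    then show ?thesis
      using lin_ext_add[OF P \<beta>', of u c] lin_ext_closed[OF P \<beta>', of c] u cF by (simp add: F_def)
  qed
  then have "lin_ext R P S \<beta> ` (U +>\<^bsub>F\<^esub> c) \<subseteq> {lin_ext R P S \<beta> c}"
    by (auto simp: a_r_coset_def')
  then have "lin_ext R P S \<beta> ` (U +>\<^bsub>F\<^esub> c) = {lin_ext R P S \<beta> c}"
    using U.a_rcos_self[OF cF] by blast
  moreover have "U +>\<^bsub>F\<^esub> c \<in> carrier (tensor R M N)"
    using cF by (auto simp: tensor_def quot_module_def A_RCOSETS_def' U_def F_def S_def)
  ultimately show ?thesis
    by (simp add: tensor_lift_def U_def F_def S_def)
qed

lemma tensor_lift_pure:
  assumes "module R M" and "module R N" and P: "module R P"
    and \<beta>: "\<And>m n. m \<in> carrier M \<Longrightarrow> n \<in> carrier N \<Longrightarrow> \<beta> (m, n) \<in> carrier P"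
    and "\<And>m m' n. m \<in> carrier M \<Longrightarrow> m' \<in> carrier M \<Longrightarrow> n \<in> carrier N
      \<Longrightarrow> \<beta> (m \<oplus>\<^bsub>M\<^esub> m', n) = \<beta> (m, n) \<oplus>\<^bsub>P\<^esub> \<beta> (m', n)"
    and "\<And>m n n'. m \<in> carrier M \<Longrightarrow> n \<in> carrier N \<Longrightarrow> n' \<in> carrier N
      \<Longrightarrow> \<beta> (m, n \<oplus>\<^bsub>N\<^esub> n') = \<beta> (m, n) \<oplus>\<^bsub>P\<^esub> \<beta> (m, n')"
    and "\<And>r m n. r \<in> carrier R \<Longrightarrow> m \<in> carrier M \<Longrightarrow> n \<in> carrier N
      \<Longrightarrow> \<beta> (r \<odot>\<^bsub>M\<^esub> m, n) = r \<odot>\<^bsub>P\<^esub> \<beta> (m, n)"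
    and "\<And>r m n. r \<in> carrier R \<Longrightarrow> m \<in> carrier M \<Longrightarrow> n \<in> carrier N
      \<Longrightarrow> \<beta> (m, r \<odot>\<^bsub>N\<^esub> n) = r \<odot>\<^bsub>P\<^esub> \<beta> (m, n)"
    and mn: "m \<in> carrier M" "n \<in> carrier N"
  shows "tensor_lift R M N P \<beta> (pure_tensor R M N m n) = \<beta> (m, n)"
proof -
  have \<beta>': "\<beta> \<in> carrier M \<times> carrier N \<rightarrow> carrier P" using \<beta> by auto
  show ?thesis
    unfolding pure_tensor_def
    using tensor_lift_coset[OF assms(1-8) free_gen_closed[OF module.axioms(1)[OF P]]]
      lin_ext_free_gen[OF P \<beta>'] mn by simp
qed

lemma tensor_lift_hom:
  assumes M: "module R M" and N: "module R N" and P: "module R P"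
    and \<beta>: "\<And>m n. m \<in> carrier M \<Longrightarrow> n \<in> carrier N \<Longrightarrow> \<beta> (m, n) \<in> carrier P"
    and "\<And>m m' n. m \<in> carrier M \<Longrightarrow> m' \<in> carrier M \<Longrightarrow> n \<in> carrier N
      \<Longrightarrow> \<beta> (m \<oplus>\<^bsub>M\<^esub> m', n) = \<beta> (m, n) \<oplus>\<^bsub>P\<^esub> \<beta> (m', n)"
    and "\<And>m n n'. m \<in> carrier M \<Longrightarrow> n \<in> carrier N \<Longrightarrow> n' \<in> carrier N
      \<Longrightarrow> \<beta> (m, n \<oplus>\<^bsub>N\<^esub> n') = \<beta> (m, n) \<oplus>\<^bsub>P\<^esub> \<beta> (m, n')"
    and "\<And>r m n. r \<in> carrier R \<Longrightarrow> m \<in> carrier M \<Longrightarrow> n \<in> carrier N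
      \<Longrightarrow> \<beta> (r \<odot>\<^bsub>M\<^esub> m, n) = r \<odot>\<^bsub>P\<^esub> \<beta> (m, n)"
    and "\<And>r m n. r \<in> carrier R \<Longrightarrow> m \<in> carrier M \<Longrightarrow> n \<in> carrier N
      \<Longrightarrow> \<beta> (m, r \<odot>\<^bsub>N\<^esub> n) = r \<odot>\<^bsub>P\<^esub> \<beta> (m, n)"
  shows "tensor_lift R M N P \<beta> \<in> mod_hom R (tensor R M N) P"
proof -
  interpret M: module R M by fact
  define F where "F = free_module R (carrier M \<times> carrier N)"
  define U where "U = tensor_kernel R M N"
  interpret F: module R F
    unfolding F_def by (rule free_module_is_module[OF M.is_cring])
  have U: "submodule U R F"
    unfolding U_def F_def by (rule tensor_kernel_submodule[OF M N])
  interpret U: abelian_subgroup U F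
    by (rule submodule_abelian_subgroup[OF F.module_axioms U])
  have \<beta>': "\<beta> \<in> carrier M \<times> carrier N \<rightarrow> carrier P" using \<beta> by auto
  have T: "tensor R M N = quot_module F U" by (simp add: tensor_def U_def F_def)
  have car: "carrier (quot_module F U) = (\<lambda>x. U +>\<^bsub>F\<^esub> x) ` carrier F"
    by (auto simp: quot_module_def A_RCOSETS_def')
  have add: "(U +>\<^bsub>F\<^esub> x) \<oplus>\<^bsub>quot_module F U\<^esub> (U +>\<^bsub>F\<^esub> y) = U +>\<^bsub>F\<^esub> (x \<oplus>\<^bsub>F\<^esub> y)"
    if "x \<in> carrier F" "y \<in> carrier F" for x y
    using that by (simp add: quot_module_def U.a_rcos_sum)
  note sm = quot_smult[OF F.module_axioms U]
  have L: "tensor_lift R M N P \<beta> (U +>\<^bsub>F\<^esub> c) = lin_ext R P (carrier M \<times> carrier N) \<beta> c"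
    if "c \<in> carrier F" for c
    using tensor_lift_coset[OF assms] that by (simp add: U_def F_def)
  have "tensor_lift R M N P \<beta> \<in> extensional (carrier (tensor R M N))"
    by (simp add: tensor_lift_def)
  then show ?thesis
    using lin_ext_add[OF P \<beta>'] lin_ext_smult[OF P \<beta>'] lin_ext_closed[OF P \<beta>']
    by (auto simp: mod_hom_def T car add sm L PiE_def F_def[symmetric])
qed

lemma pure_tensor_bilinear:
  assumes M: "module R M" and N: "module R N"
  shows pure_tensor_closed: "m \<in> carrier M \<Longrightarrow> n \<in> carrier N
      \<Longrightarrow> pure_tensor R M N m n \<in> carrier (tensor R M N)"
    and pure_tensor_add_left: "m \<in> carrier M \<Longrightarrow> m' \<in> carrier M \<Longrightarrow> n \<in> carrier N
      \<Longrightarrow> pure_tensor R M N (m \<oplus>\<^bsub>M\<^esub> m') n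
          = pure_tensor R M N m n \<oplus>\<^bsub>tensor R M N\<^esub> pure_tensor R M N m' n"
    and pure_tensor_add_right: "m \<in> carrier M \<Longrightarrow> n \<in> carrier N \<Longrightarrow> n' \<in> carrier N
      \<Longrightarrow> pure_tensor R M N m (n \<oplus>\<^bsub>N\<^esub> n')
          = pure_tensor R M N m n \<oplus>\<^bsub>tensor R M N\<^esub> pure_tensor R M N m n'"
    and pure_tensor_smult_left: "r \<in> carrier R \<Longrightarrow> m \<in> carrier M \<Longrightarrow> n \<in> carrier N
      \<Longrightarrow> pure_tensor R M N (r \<odot>\<^bsub>M\<^esub> m) n = r \<odot>\<^bsub>tensor R M N\<^esub> pure_tensor R M N m n"
    and pure_tensor_smult_right: "r \<in> carrier R \<Longrightarrow> m \<in> carrier M \<Longrightarrow> n \<in> carrier N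
      \<Longrightarrow> pure_tensor R M N m (r \<odot>\<^bsub>N\<^esub> n) = r \<odot>\<^bsub>tensor R M N\<^esub> pure_tensor R M N m n"
proof -
  interpret M: module R M by fact
  define F where "F = free_module R (carrier M \<times> carrier N)"
  define U where "U = tensor_kernel R M N"
  define g where "g m n = free_gen R (carrier M \<times> carrier N) (m, n)" for m n
  interpret F: module R F
    unfolding F_def by (rule free_module_is_module[OF M.is_cring])
  have U: "submodule U R F"
    unfolding U_def F_def by (rule tensor_kernel_submodule[OF M N])
  interpret U: abelian_subgroup U F
    by (rule submodule_abelian_subgroup[OF F.module_axioms U])
  have T: "tensor R M N = quot_module F U" by (simp add: tensor_def U_def F_def)
  have p: "pure_tensor R M N m n = U +>\<^bsub>F\<^esub> g m n" for m n
    by (simp add: pure_tensor_def U_def F_def g_def)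
  have gc: "g m n \<in> carrier F" for m n
    unfolding g_def F_def by (rule free_gen_closed[OF M.is_cring])
  have add: "(U +>\<^bsub>F\<^esub> x) \<oplus>\<^bsub>quot_module F U\<^esub> (U +>\<^bsub>F\<^esub> y) = U +>\<^bsub>F\<^esub> (x \<oplus>\<^bsub>F\<^esub> y)"
    if "x \<in> carrier F" "y \<in> carrier F" for x y
    using that by (simp add: quot_module_def U.a_rcos_sum)
  note sm = quot_smult[OF F.module_axioms U]
  have rel: "tensor_rels R M N \<subseteq> U"
    unfolding U_def tensor_kernel_def
    by (rule gen_submodule_is_submodule(2)[OF free_module_is_module[OF M.is_cring]
          tensor_rels_subset[OF M N]])
  have eq: "U +>\<^bsub>F\<^esub> x = U +>\<^bsub>F\<^esub> y"
    if "x \<ominus>\<^bsub>F\<^esub> y \<in> tensor_rels R M N" "x \<in> carrier F" "y \<in> carrier F" for x y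
  proof -
    have "x \<in> U +>\<^bsub>F\<^esub> y"
      by (rule U.a_rcos_module_rev) (use that rel in \<open>auto simp: a_minus_def\<close>)
    then show ?thesis using U.a_repr_independence' that(3) by blast
  qed
  show "pure_tensor R M N m n \<in> carrier (tensor R M N)" if "m \<in> carrier M" "n \<in> carrier N"
    using gc by (auto simp: p T quot_module_def A_RCOSETS_def')
  show "pure_tensor R M N (m \<oplus>\<^bsub>M\<^esub> m') n
          = pure_tensor R M N m n \<oplus>\<^bsub>tensor R M N\<^esub> pure_tensor R M N m' n"
    if "m \<in> carrier M" "m' \<in> carrier M" "n \<in> carrier N"
    unfolding T p add[OF gc gc]
    by (rule eq, unfold tensor_rels_def Let_def F_def[symmetric] g_def[symmetric])
      (use that in blast, simp_all add: gc that)
  show "pure_tensor R M N m (n \<oplus>\<^bsub>N\<^esub> n')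
          = pure_tensor R M N m n \<oplus>\<^bsub>tensor R M N\<^esub> pure_tensor R M N m n'"
    if "m \<in> carrier M" "n \<in> carrier N" "n' \<in> carrier N"
    unfolding T p add[OF gc gc]
    by (rule eq, unfold tensor_rels_def Let_def F_def[symmetric] g_def[symmetric])
      (use that in blast, simp_all add: gc that)
  show "pure_tensor R M N (r \<odot>\<^bsub>M\<^esub> m) n = r \<odot>\<^bsub>tensor R M N\<^esub> pure_tensor R M N m n"
    if "r \<in> carrier R" "m \<in> carrier M" "n \<in> carrier N"
    unfolding T p sm[OF that(1) gc]
    by (rule eq, unfold tensor_rels_def Let_def F_def[symmetric] g_def[symmetric])
      (use that in blast, simp_all add: gc that)
  show "pure_tensor R M N m (r \<odot>\<^bsub>N\<^esub> n) = r \<odot>\<^bsub>tensor R M N\<^esub> pure_tensor R M N m n"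
    if "r \<in> carrier R" "m \<in> carrier M" "n \<in> carrier N"
    unfolding T p sm[OF that(1) gc]
    by (rule eq, unfold tensor_rels_def Let_def F_def[symmetric] g_def[symmetric])
      (use that in blast, simp_all add: gc that)
qed

lemma mod_homD:
  assumes "f \<in> mod_hom R M N"
  shows "x \<in> carrier M \<Longrightarrow> f x \<in> carrier N"
    and "x \<in> carrier M \<Longrightarrow> y \<in> carrier M \<Longrightarrow> f (x \<oplus>\<^bsub>M\<^esub> y) = f x \<oplus>\<^bsub>N\<^esub> f y"
    and "r \<in> carrier R \<Longrightarrow> x \<in> carrier M \<Longrightarrow> f (r \<odot>\<^bsub>M\<^esub> x) = r \<odot>\<^bsub>N\<^esub> f x"
  using assms by (auto simp: mod_hom_def)

lemma
  assumes M: "module R M" and N: "module R N" and M': "module R M'" and N': "module R N'"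
    and f: "f \<in> mod_hom R M M'" and g: "g \<in> mod_hom R N N'"
  shows tensor_map_hom:
      "tensor_map R M N M' N' f g \<in> mod_hom R (tensor R M N) (tensor R M' N')" (is ?H)
    and tensor_map_pure: "m \<in> carrier M \<Longrightarrow> n \<in> carrier N
      \<Longrightarrow> tensor_map R M N M' N' f g (pure_tensor R M N m n) = pure_tensor R M' N' (f m) (g n)"
proof -
  note T = tensor_is_module[OF M' N']
  show ?H
    unfolding tensor_map_def
    by (rule tensor_lift_hom[OF M N T])
      (simp_all add: mod_homD[OF f] mod_homD[OF g] pure_tensor_bilinear[OF M' N'])
  show "tensor_map R M N M' N' f g (pure_tensor R M N m n) = pure_tensor R M' N' (f m) (g n)"
    if "m \<in> carrier M" "n \<in> carrier N"
    unfolding tensor_map_def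
    by (subst tensor_lift_pure[OF M N T])
      (simp_all add: mod_homD[OF f] mod_homD[OF g] pure_tensor_bilinear[OF M' N'] that)
qed

lemma dual_apply:
  assumes "f \<in> carrier (dual R M)" and "x \<in> carrier M"
  shows "f x \<in> carrier R"
    and "y \<in> carrier M \<Longrightarrow> f (x \<oplus>\<^bsub>M\<^esub> y) = f x \<oplus>\<^bsub>R\<^esub> f y"
    and "r \<in> carrier R \<Longrightarrow> f (r \<odot>\<^bsub>M\<^esub> x) = r \<otimes>\<^bsub>R\<^esub> f x"
  using assms by (auto simp: dual_def hom_module_def mod_hom_def self_module_def)

lemma dual_ops:
  assumes "x \<in> carrier M"
  shows "(f \<oplus>\<^bsub>dual R M\<^esub> g) x = f x \<oplus>\<^bsub>R\<^esub> g x" and "(r \<odot>\<^bsub>dual R M\<^esub> f) x = r \<otimes>\<^bsub>R\<^esub> f x"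
  using assms by (simp_all add: dual_def hom_module_def self_module_def)

lemma bidual_map_hom:
  assumes M: "module R M"
  shows "bidual_map R M \<in> mod_hom R M (dual R (dual R M))"
proof -
  interpret M: module R M by fact
  define D where "D = dual R M"
  interpret D: module R D unfolding D_def by (rule dual_is_module[OF M])
  have app: "f x \<in> carrier R" "y \<in> carrier M \<Longrightarrow> f (x \<oplus>\<^bsub>M\<^esub> y) = f x \<oplus>\<^bsub>R\<^esub> f y"
    "r \<in> carrier R \<Longrightarrow> f (r \<odot>\<^bsub>M\<^esub> x) = r \<otimes>\<^bsub>R\<^esub> f x"
    "(f \<oplus>\<^bsub>D\<^esub> g) x = f x \<oplus>\<^bsub>R\<^esub> g x" "(r \<odot>\<^bsub>D\<^esub> f) x = r \<otimes>\<^bsub>R\<^esub> f x"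
    if "f \<in> carrier D" "x \<in> carrier M" for f g x y r
    using dual_apply[of f R M x] dual_ops[of x M R] that
    by (simp_all add: D_def)
  have "(\<lambda>f\<in>carrier D. f x) \<in> carrier (dual R D)" if "x \<in> carrier M" for x
    unfolding dual_def hom_module_def mod_hom_def
    by (auto simp: self_module_def app that)
  moreover have "(\<lambda>f\<in>carrier D. f (x \<oplus>\<^bsub>M\<^esub> y))
      = (\<lambda>f\<in>carrier D. f x) \<oplus>\<^bsub>dual R D\<^esub> (\<lambda>f\<in>carrier D. f y)"
    if "x \<in> carrier M" "y \<in> carrier M" for x y
    using that by (simp add: dual_def[of R D] hom_module_def self_module_def app cong: restrict_cong)
  moreover have "(\<lambda>f\<in>carrier D. f (r \<odot>\<^bsub>M\<^esub> x)) = r \<odot>\<^bsub>dual R D\<^esub> (\<lambda>f\<in>carrier D. f x)"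
    if "r \<in> carrier R" "x \<in> carrier M" for r x
    using that by (simp add: dual_def[of R D] hom_module_def self_module_def app cong: restrict_cong)
  ultimately show ?thesis
    unfolding bidual_map_def mod_hom_def D_def[symmetric] by auto
qed

lemma
  assumes M: "module R M" and N: "module R N"
  shows bidual_tensor_eval_hom:
      "bidual_tensor_eval R M N
        \<in> mod_hom R (tensor R (dual R (dual R M)) N) (hom_module R (dual R M) N)" (is ?H)
    and bidual_tensor_eval_pure: "\<phi> \<in> carrier (dual R (dual R M)) \<Longrightarrow> n \<in> carrier N
      \<Longrightarrow> bidual_tensor_eval R M N (pure_tensor R (dual R (dual R M)) N \<phi> n)
          = (\<lambda>f\<in>carrier (dual R M). \<phi> f \<odot>\<^bsub>N\<^esub> n)"
proof -
  interpret M: module R M by fact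
  interpret N: module R N by fact
  define D where "D = dual R M"
  note DM = dual_is_module[OF M, folded D_def]
  note DDM = dual_is_module[OF DM]
  interpret D: module R D by (rule DM)
  note H = hom_module_is_module[OF DM N]
  have a: "\<phi> \<in> mod_hom R D (self_module R)" if "\<phi> \<in> carrier (dual R D)" for \<phi>
    using that by (simp add: dual_def hom_module_def)
  have c: "\<phi> x \<in> carrier R" "x \<in> carrier D \<Longrightarrow> y \<in> carrier D \<Longrightarrow> \<phi> (x \<oplus>\<^bsub>D\<^esub> y) = \<phi> x \<oplus>\<^bsub>R\<^esub> \<phi> y"
      "r \<in> carrier R \<Longrightarrow> \<phi> (r \<odot>\<^bsub>D\<^esub> x) = r \<otimes>\<^bsub>R\<^esub> \<phi> x"
    if "\<phi> \<in> carrier (dual R D)" "x \<in> carrier D" for \<phi> x y r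
    using mod_homD[OF a[OF that(1)]] that by (auto simp: self_module_def)
  have cl: "(\<lambda>f\<in>carrier D. \<phi> f \<odot>\<^bsub>N\<^esub> n) \<in> carrier (hom_module R D N)"
    if p: "\<phi> \<in> carrier (dual R D)" and n: "n \<in> carrier N" for \<phi> n
    using n by (auto simp: hom_module_def mod_hom_def c[OF p] N.smult_l_distr N.smult_assoc1)
  have ops: "(\<phi> \<oplus>\<^bsub>dual R D\<^esub> \<psi>) f = \<phi> f \<oplus>\<^bsub>R\<^esub> \<psi> f" "(r \<odot>\<^bsub>dual R D\<^esub> \<phi>) f = r \<otimes>\<^bsub>R\<^esub> \<phi> f"
    if "f \<in> carrier D" for \<phi> \<psi> f r
    using that by (simp_all add: dual_def[of R D] hom_module_def self_module_def)
  have hops: "\<phi> \<oplus>\<^bsub>hom_module R D N\<^esub> \<psi> = (\<lambda>f\<in>carrier D. \<phi> f \<oplus>\<^bsub>N\<^esub> \<psi> f)"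
     "r \<odot>\<^bsub>hom_module R D N\<^esub> \<phi> = (\<lambda>f\<in>carrier D. r \<odot>\<^bsub>N\<^esub> \<phi> f)" for \<phi> \<psi> r
    by (simp_all add: hom_module_def)
  have sw: "\<phi> f \<odot>\<^bsub>N\<^esub> (r \<odot>\<^bsub>N\<^esub> n) = r \<odot>\<^bsub>N\<^esub> (\<phi> f \<odot>\<^bsub>N\<^esub> n)"
    if "\<phi> \<in> carrier (dual R D)" "f \<in> carrier D" "r \<in> carrier R" "n \<in> carrier N" for \<phi> f r n
    using c(1)[OF that(1,2)] that
    by (metis M.R.m_comm N.smult_assoc1)
  show ?H
    unfolding bidual_tensor_eval_def D_def[symmetric]
    by (rule tensor_lift_hom[OF DDM N H])
      (simp_all add: cl hops ops c sw N.smult_l_distr N.smult_r_distr N.smult_assoc1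
        cong: restrict_cong)
  show "bidual_tensor_eval R M N (pure_tensor R (dual R (dual R M)) N \<phi> n)
          = (\<lambda>f\<in>carrier (dual R M). \<phi> f \<odot>\<^bsub>N\<^esub> n)"
    if "\<phi> \<in> carrier (dual R (dual R M))" "n \<in> carrier N"
    unfolding bidual_tensor_eval_def D_def[symmetric]
    by (subst tensor_lift_pure[OF DDM N H])
      (use that in \<open>simp_all add: D_def[symmetric] cl hops ops c sw N.smult_l_distr
        N.smult_r_distr N.smult_assoc1 cong: restrict_cong\<close>)
qed

lemma
  assumes M: "module R M" and N: "module R N"
  shows natural_map_hom:
      "natural_map R M N \<in> mod_hom R (tensor R M N) (hom_module R (dual R M) N)" (is ?H)
    and natural_map_pure: "m \<in> carrier M \<Longrightarrow> n \<in> carrier N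
      \<Longrightarrow> natural_map R M N (pure_tensor R M N m n) = (\<lambda>f\<in>carrier (dual R M). f m \<odot>\<^bsub>N\<^esub> n)"
proof -
  interpret M: module R M by fact
  interpret N: module R N by fact
  note DDM = dual_is_module[OF dual_is_module[OF M]]
  interpret T: module R "tensor R M N" by (rule tensor_is_module[OF M N])
  have id: "(\<lambda>n\<in>carrier N. n) \<in> mod_hom R N N" by (auto simp: mod_hom_def)
  note tm = tensor_map_hom[OF M N DDM N bidual_map_hom[OF M] id]
  note ev = bidual_tensor_eval_hom[OF M N]
  show ?H
    unfolding mod_hom_def[of R "tensor R M N"] natural_map_def
    by (auto simp: compose_def mod_homD[OF tm] mod_homD[OF ev])
  show "natural_map R M N (pure_tensor R M N m n) = (\<lambda>f\<in>carrier (dual R M). f m \<odot>\<^bsub>N\<^esub> n)"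
    if "m \<in> carrier M" "n \<in> carrier N"
    using that mod_homD(1)[OF bidual_map_hom[OF M]] pure_tensor_closed[OF M N]
    by (simp add: natural_map_def compose_eq tensor_map_pure[OF M N DDM N bidual_map_hom[OF M] id]
        bidual_tensor_eval_pure[OF M N])
      (simp add: bidual_map_def cong: restrict_cong)
qed


section \<open>Resolutions, Tor and Ext\<close>

text \<open>The complex \<open>\<dots> \<rightarrow> G 2 \<rightarrow> G 1 \<rightarrow> G 0 \<rightarrow> M \<rightarrow> 0\<close>, with \<open>d i : G (i + 1) \<rightarrow> G i\<close> and
  augmentation \<open>e : G 0 \<rightarrow> M\<close>, is exact.\<close>

definition resolution ::
  "('a, 'r) ring_scheme \<Rightarrow> ('a, 'm, 'x) module_scheme \<Rightarrow> (nat \<Rightarrow> ('a, 'g) module)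
    \<Rightarrow> (nat \<Rightarrow> 'g \<Rightarrow> 'g) \<Rightarrow> ('g \<Rightarrow> 'm) \<Rightarrow> bool"
  where "resolution R M G d e \<longleftrightarrow>
    e \<in> mod_hom R (G 0) M \<and>
    (\<forall>i. d i \<in> mod_hom R (G (Suc i)) (G i)) \<and>
    e ` carrier (G 0) = carrier M \<and>
    d 0 ` carrier (G 1) = a_kernel (G 0) M e \<and>
    (\<forall>i. d (Suc i) ` carrier (G (Suc (Suc i))) = a_kernel (G (Suc i)) (G i) (d i))"

record ('a, 'm) free_res =
  res_rank :: "nat \<Rightarrow> nat"
  res_diff :: "nat \<Rightarrow> (nat \<Rightarrow> 'a) \<Rightarrow> (nat \<Rightarrow> 'a)"
  res_aug :: "(nat \<Rightarrow> 'a) \<Rightarrow> 'm"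

definition res_module ::
  "('a, 'r) ring_scheme \<Rightarrow> ('a, 'm) free_res \<Rightarrow> nat \<Rightarrow> ('a, nat \<Rightarrow> 'a) module"
  where "res_module R F i = free_module R {..<res_rank F i}"

definition is_free_resolution ::
  "('a, 'r) ring_scheme \<Rightarrow> ('a, 'm, 'x) module_scheme \<Rightarrow> ('a, 'm) free_res \<Rightarrow> bool"
  where "is_free_resolution R M F \<longleftrightarrow>
    resolution R M (res_module R F) (res_diff F) (res_aug F)"

text \<open>A resolution by free modules of finite rank; one exists whenever \<open>R\<close> is Noetherian and \<open>M\<close> is
  finitely generated. Up to isomorphism, \<open>Tor\<close> and \<open>Ext\<close> do not depend on the choice.\<close>

definition free_resolution ::
  "('a, 'r) ring_scheme \<Rightarrow> ('a, 'm, 'x) module_scheme \<Rightarrow> ('a, 'm) free_res"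
  where "free_resolution R M = (SOME F. is_free_resolution R M F)"

definition Tor_diff ::
  "('a, 'r) ring_scheme \<Rightarrow> ('a, 'm) free_res \<Rightarrow> ('a, 'n, 'y) module_scheme \<Rightarrow> nat
    \<Rightarrow> ((nat \<Rightarrow> 'a) \<times> 'n \<Rightarrow> 'a) set \<Rightarrow> ((nat \<Rightarrow> 'a) \<times> 'n \<Rightarrow> 'a) set"
  where "Tor_diff R F N i =
    tensor_map R (res_module R F (Suc i)) N (res_module R F i) N (res_diff F i) (\<lambda>n\<in>carrier N. n)"

definition Tor_cycles ::
  "('a, 'r) ring_scheme \<Rightarrow> ('a, 'm) free_res \<Rightarrow> ('a, 'n, 'y) module_scheme \<Rightarrow> nat
    \<Rightarrow> ((nat \<Rightarrow> 'a) \<times> 'n \<Rightarrow> 'a) set set"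
  where "Tor_cycles R F N i =
    (case i of
       0 \<Rightarrow> carrier (tensor R (res_module R F 0) N)
     | Suc j \<Rightarrow> a_kernel (tensor R (res_module R F (Suc j)) N) (tensor R (res_module R F j) N)
                  (Tor_diff R F N j))"

definition Tor ::
  "('a, 'r) ring_scheme \<Rightarrow> ('a, 'm, 'x) module_scheme \<Rightarrow> ('a, 'n, 'y) module_scheme \<Rightarrow> nat
    \<Rightarrow> ('a, ((nat \<Rightarrow> 'a) \<times> 'n \<Rightarrow> 'a) set set) module"
  where "Tor R M N i =
    (let F = free_resolution R M
     in quot_module ((tensor R (res_module R F i) N)\<lparr>carrier := Tor_cycles R F N i\<rparr>)
          (Tor_diff R F N i ` carrier (tensor R (res_module R F (Suc i)) N)))"

definition Tor_independent ::
  "('a, 'r) ring_scheme \<Rightarrow> ('a, 'm, 'x) module_scheme \<Rightarrow> ('a, 'n, 'y) module_scheme \<Rightarrow> bool"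
  where "Tor_independent R M N \<longleftrightarrow> (\<forall>i\<ge>1. zero_module (Tor R M N i))"

text \<open>Precomposition with the differential, \<open>Hom(F\<^sub>i, N) \<rightarrow> Hom(F\<^sub>i\<^sub>+\<^sub>1, N)\<close>\<close>

definition Ext_diff ::
  "('a, 'r) ring_scheme \<Rightarrow> ('a, 'm) free_res \<Rightarrow> ('a, 'n, 'y) module_scheme \<Rightarrow> nat
    \<Rightarrow> ((nat \<Rightarrow> 'a) \<Rightarrow> 'n) \<Rightarrow> (nat \<Rightarrow> 'a) \<Rightarrow> 'n"
  where "Ext_diff R F N i =
    (\<lambda>f\<in>carrier (hom_module R (res_module R F i) N).
       compose (carrier (res_module R F (Suc i))) f (res_diff F i))"

definition Ext_boundaries ::
  "('a, 'r) ring_scheme \<Rightarrow> ('a, 'm) free_res \<Rightarrow> ('a, 'n, 'y) module_scheme \<Rightarrow> nat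
    \<Rightarrow> ((nat \<Rightarrow> 'a) \<Rightarrow> 'n) set"
  where "Ext_boundaries R F N i =
    (case i of
       0 \<Rightarrow> {\<zero>\<^bsub>hom_module R (res_module R F 0) N\<^esub>}
     | Suc j \<Rightarrow> Ext_diff R F N j ` carrier (hom_module R (res_module R F j) N))"

definition Ext ::
  "('a, 'r) ring_scheme \<Rightarrow> ('a, 'm, 'x) module_scheme \<Rightarrow> ('a, 'n, 'y) module_scheme \<Rightarrow> nat
    \<Rightarrow> ('a, ((nat \<Rightarrow> 'a) \<Rightarrow> 'n) set) module"
  where "Ext R M N i =
    (let F = free_resolution R M
     in quot_module
          ((hom_module R (res_module R F i) N)
             \<lparr>carrier := a_kernel (hom_module R (res_module R F i) N)
                          (hom_module R (res_module R F (Suc i)) N) (Ext_diff R F N i)\<rparr>)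
          (Ext_boundaries R F N i))"


section \<open>Gorenstein dimension\<close>

definition totally_reflexive :: "('a, 'r) ring_scheme \<Rightarrow> ('a, 'm, 'x) module_scheme \<Rightarrow> bool"
  where "totally_reflexive R G \<longleftrightarrow>
    fin_gen_module R G \<and>
    bidual_map R G \<in> mod_iso R G (dual R (dual R G)) \<and>
    (\<forall>i\<ge>1. zero_module (Ext R G (self_module R) i)) \<and>
    (\<forall>i\<ge>1. zero_module (Ext R (dual R G) (self_module R) i))"

text \<open>There is an exact sequence \<open>0 \<rightarrow> G n \<rightarrow> \<dots> \<rightarrow> G 0 \<rightarrow> M \<rightarrow> 0\<close> with all \<open>G i\<close> totally reflexive.
  It is written as an infinite resolution whose terms beyond \<open>n\<close> are zero. The carrier type of the \<open>G i\<close>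
  is no restriction: every finitely generated module is isomorphic to a quotient of some \<open>R\<^sup>k\<close>,
  whose elements are cosets in \<open>R\<^sup>k\<close>.\<close>

definition Gdim_le :: "('a, 'r) ring_scheme \<Rightarrow> ('a, 'm, 'x) module_scheme \<Rightarrow> nat \<Rightarrow> bool"
  where "Gdim_le R M n \<longleftrightarrow>
    (\<exists>(G :: nat \<Rightarrow> ('a, (nat \<Rightarrow> 'a) set) module) d e.
       resolution R M G d e \<and>
       (\<forall>i\<le>n. totally_reflexive R (G i)) \<and>
       (\<forall>i>n. module R (G i) \<and> zero_module (G i)))"

definition finite_Gdim :: "('a, 'r) ring_scheme \<Rightarrow> ('a, 'm, 'x) module_scheme \<Rightarrow> bool"
  where "finite_Gdim R M \<longleftrightarrow> (\<exists>n. Gdim_le R M n)"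


section \<open>Local rings, minimal resolutions, syzygies\<close>

definition local_ring :: "('a, 'r) ring_scheme \<Rightarrow> bool"
  where "local_ring R \<longleftrightarrow> cring R \<and> (\<exists>!I. maximalideal I R)"

definition max_ideal :: "('a, 'r) ring_scheme \<Rightarrow> 'a set"
  where "max_ideal R = (THE I. maximalideal I R)"

definition ideal_smult ::
  "('a, 'r) ring_scheme \<Rightarrow> 'a set \<Rightarrow> ('a, 'm, 'x) module_scheme \<Rightarrow> 'm set"
  where "ideal_smult R I M = gen_submodule R M {r \<odot>\<^bsub>M\<^esub> x | r x. r \<in> I \<and> x \<in> carrier M}"

definition is_minimal_free_resolution ::
  "('a, 'r) ring_scheme \<Rightarrow> ('a, 'm, 'x) module_scheme \<Rightarrow> ('a, 'm) free_res \<Rightarrow> bool"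
  where "is_minimal_free_resolution R M F \<longleftrightarrow>
    is_free_resolution R M F \<and>
    (\<forall>i. res_diff F i ` carrier (res_module R F (Suc i))
          \<subseteq> ideal_smult R (max_ideal R) (res_module R F i))"

text \<open>For a finitely generated module over a Noetherian local ring, this exists and is unique up to
  isomorphism of complexes.\<close>

definition minimal_free_resolution ::
  "('a, 'r) ring_scheme \<Rightarrow> ('a, 'm, 'x) module_scheme \<Rightarrow> ('a, 'm) free_res"
  where "minimal_free_resolution R M = (SOME F. is_minimal_free_resolution R M F)"

text \<open>The \<open>i\<close>-th syzygy as the submodule \<open>im (F\<^sub>i \<rightarrow> F\<^sub>i\<^sub>-\<^sub>1)\<close> of \<open>F\<^sub>i\<^sub>-\<^sub>1\<close>. Only \<open>i \<ge> 1\<close> is meaningful;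
  the 0-th syzygy, which is the module itself, lives in a different type.\<close>

definition syzygy ::
  "('a, 'r) ring_scheme \<Rightarrow> nat \<Rightarrow> ('a, 'm, 'x) module_scheme \<Rightarrow> ('a, nat \<Rightarrow> 'a) module"
  where "syzygy R i M =
    (let F = minimal_free_resolution R M
     in (res_module R F (i - 1))\<lparr>carrier := res_diff F (i - 1) ` carrier (res_module R F i)\<rparr>)"

definition two_periodic :: "('a, 'r) ring_scheme \<Rightarrow> ('a, 'm, 'x) module_scheme \<Rightarrow> bool"
  where "two_periodic R M \<longleftrightarrow> mod_isomorphic R M (syzygy R 2 M)"

end

(*
Splicing the start F_1 -> F_0 -> M of the minimal resolution with the embedding i : M -> F_1 (whose
image is ker(F_1 -> F_0), by two-periodicity) gives a literally periodic free resolution C of M.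
Along C, Ext^j(M,R) and Ext^(j+2)(M,R) are the same condition for j >= 1. Finite Gorenstein
dimension makes Ext^j(M,R) vanish for large j (iterated mapping cones over the resolution by totally
reflexive modules), hence Ext^2(M,R) = 0, i.e. every map M -> R extends along i, so that M^* is
generated by the coordinates of i.

Let e : F_0 -> M be the augmentation. If u in F_0 (x) N maps to t in M (x) N, the coordinates of
(i e (x) N)(u) are the values of the natural map of t at the coordinates of i. So if t is mapped to
zero, u is a cycle, hence a boundary as Tor_2(M,N) = 0, and t = 0. Conversely, the values of some
phi : M^* -> N at the coordinates of i form a cycle of F_1 (x) N, which is a boundary (i e (x) N)(v)
as Tor_1(M,N) = 0, and the image of v in M (x) N is a preimage of phi.
*)
theory Submission
  imports Defs
begin

section \<open>Linear maps\<close>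

text \<open>The obstacle is that the vanishing facts about M live on different resolutions:
  \<open>Tor_independent\<close> speaks of the one chosen by \<open>SOME\<close>, finite Gorenstein
  dimension yields vanishing along an iterated cone, and the argument needs both along C. Vanishing
  is therefore phrased for explicit ranks and differentials (\<open>ext_vanish\<close>,
  \<open>tor_vanish\<close>), as "every cycle is a boundary", and carried from one resolution to
  another by a chain homotopy; no isomorphism of Tor or Ext modules is constructed.

  The degrees fit as follows. A map g : M -> R composed with e is a cocycle on F_0 in degree 2 of C,
  because e kills the image of F_1, and it is a coboundary exactly when g extends along i. Shifts by
  two keep the parity, so vanishing in one large even degree suffices. The values of phi form a
  cycle because the composite M -> F_1 -> F_0 is zero: each coordinate of F_0 gives a linear
  relation between the coordinates of i, and phi respects linear relations. Finally phi is
  determined by these values, since the coordinates of i generate the dual.\<close>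

text \<open>Unlike \<open>mod_hom\<close>, this puts no condition on the values outside the carrier, so linear maps can be
  composed and added as plain functions.\<close>

definition lin ::
  "('a, 'r) ring_scheme \<Rightarrow> ('a, 'm, 'x) module_scheme \<Rightarrow> ('a, 'n, 'y) module_scheme
    \<Rightarrow> ('m \<Rightarrow> 'n) \<Rightarrow> bool"
  where "lin R M N f \<longleftrightarrow> module R M \<and> module R N \<and>
     (\<forall>x\<in>carrier M. f x \<in> carrier N) \<and>
     (\<forall>x\<in>carrier M. \<forall>y\<in>carrier M. f (x \<oplus>\<^bsub>M\<^esub> y) = f x \<oplus>\<^bsub>N\<^esub> f y) \<and>
     (\<forall>r\<in>carrier R. \<forall>x\<in>carrier M. f (r \<odot>\<^bsub>M\<^esub> x) = r \<odot>\<^bsub>N\<^esub> f x)"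

lemma linI:
  assumes "module R M" "module R N" "\<And>x. x \<in> carrier M \<Longrightarrow> f x \<in> carrier N"
    "\<And>x y. x \<in> carrier M \<Longrightarrow> y \<in> carrier M \<Longrightarrow> f (x \<oplus>\<^bsub>M\<^esub> y) = f x \<oplus>\<^bsub>N\<^esub> f y"
    "\<And>r x. r \<in> carrier R \<Longrightarrow> x \<in> carrier M \<Longrightarrow> f (r \<odot>\<^bsub>M\<^esub> x) = r \<odot>\<^bsub>N\<^esub> f x"
  shows "lin R M N f"
  using assms by (simp add: lin_def)

lemma
  assumes "lin R M N f"
  shows lin_dom: "module R M" and lin_cod: "module R N"
    and lin_closed: "x \<in> carrier M \<Longrightarrow> f x \<in> carrier N"
    and lin_add: "x \<in> carrier M \<Longrightarrow> y \<in> carrier M \<Longrightarrow> f (x \<oplus>\<^bsub>M\<^esub> y) = f x \<oplus>\<^bsub>N\<^esub> f y"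
    and lin_smult: "r \<in> carrier R \<Longrightarrow> x \<in> carrier M \<Longrightarrow> f (r \<odot>\<^bsub>M\<^esub> x) = r \<odot>\<^bsub>N\<^esub> f x"
  using assms by (simp_all add: lin_def)

lemma mod_hom_lin: "module R M \<Longrightarrow> module R N \<Longrightarrow> f \<in> mod_hom R M N \<Longrightarrow> lin R M N f"
  by (auto simp: lin_def mod_hom_def)

lemma lin_restrict_mod_hom: "lin R M N f \<Longrightarrow> restrict f (carrier M) \<in> mod_hom R M N"
proof -
  assume f: "lin R M N f"
  interpret M: module R M by (rule lin_dom[OF f])
  show ?thesis using f by (auto simp: lin_def mod_hom_def)
qed

lemma lin_zero: assumes f: "lin R M N f" shows "f \<zero>\<^bsub>M\<^esub> = \<zero>\<^bsub>N\<^esub>"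
proof -
  interpret M: module R M by (rule lin_dom[OF f])
  interpret N: module R N by (rule lin_cod[OF f])
  show ?thesis
    using lin_add[OF f M.zero_closed M.zero_closed] lin_closed[OF f M.zero_closed]
    by (simp add: N.add.l_cancel_one')
qed

lemma lin_neg: assumes f: "lin R M N f" and x: "x \<in> carrier M" shows "f (\<ominus>\<^bsub>M\<^esub> x) = \<ominus>\<^bsub>N\<^esub> f x"
proof -
  interpret M: module R M by (rule lin_dom[OF f])
  interpret N: module R N by (rule lin_cod[OF f])
  have "f (\<ominus>\<^bsub>M\<^esub> x) \<oplus>\<^bsub>N\<^esub> f x = \<zero>\<^bsub>N\<^esub>"
    using lin_add[OF f, of "\<ominus>\<^bsub>M\<^esub> x" x] x lin_zero[OF f] by (simp add: M.l_neg)
  then show ?thesis using N.minus_equality lin_closed[OF f] x by simp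
qed

lemma lin_diff:
  assumes f: "lin R M N f" and x: "x \<in> carrier M" and y: "y \<in> carrier M"
  shows "f (x \<ominus>\<^bsub>M\<^esub> y) = f x \<ominus>\<^bsub>N\<^esub> f y"
proof -
  interpret M: module R M by (rule lin_dom[OF f])
  show ?thesis using x y by (simp add: a_minus_def lin_add[OF f] lin_neg[OF f])
qed

lemma lin_finsum:
  assumes f: "lin R M N f" and A: "finite A" "\<And>i. i \<in> A \<Longrightarrow> g i \<in> carrier M"
  shows "f (\<Oplus>\<^bsub>M\<^esub>i\<in>A. g i) = (\<Oplus>\<^bsub>N\<^esub>i\<in>A. f (g i))"
proof -
  interpret M: module R M by (rule lin_dom[OF f])
  interpret N: module R N by (rule lin_cod[OF f])
  show ?thesis using A
  proof (induction A rule: finite_induct)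
    case (insert a A)
    have "f (\<Oplus>\<^bsub>M\<^esub>i\<in>insert a A. g i) = f (g a \<oplus>\<^bsub>M\<^esub> (\<Oplus>\<^bsub>M\<^esub>i\<in>A. g i))"
      using insert by (subst M.finsum_insert) auto
    also have "\<dots> = f (g a) \<oplus>\<^bsub>N\<^esub> (\<Oplus>\<^bsub>N\<^esub>i\<in>A. f (g i))"
      using insert by (subst lin_add[OF f]) (auto intro: M.finsum_closed)
    also have "\<dots> = (\<Oplus>\<^bsub>N\<^esub>i\<in>insert a A. f (g i))"
      using insert by (subst N.finsum_insert) (auto intro: lin_closed[OF f])
    finally show ?case .
  qed (simp add: lin_zero[OF f])
qed

lemma lin_comp: "lin R N P g \<Longrightarrow> lin R M N f \<Longrightarrow> lin R M P (\<lambda>x. g (f x))"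
  by (auto simp: lin_def)

lemma lin_cong: "lin R M N f \<Longrightarrow> (\<And>x. x \<in> carrier M \<Longrightarrow> f x = g x) \<Longrightarrow> lin R M N g"
proof -
  assume f: "lin R M N f" and eq: "\<And>x. x \<in> carrier M \<Longrightarrow> f x = g x"
  interpret M: module R M by (rule lin_dom[OF f])
  show ?thesis using f by (auto simp: lin_def eq[symmetric])
qed

lemma lin_id: "module R M \<Longrightarrow> lin R M M (\<lambda>x. x)"
  by (simp add: lin_def)

lemma lin_const_zero: "module R M \<Longrightarrow> module R N \<Longrightarrow> lin R M N (\<lambda>x. \<zero>\<^bsub>N\<^esub>)"
proof -
  assume M: "module R M" and N: "module R N"
  interpret N: module R N by fact
  show ?thesis using M N by (simp add: lin_def)
qed

lemma lin_plus:
  assumes f: "lin R M N f" and g: "lin R M N g" shows "lin R M N (\<lambda>x. f x \<oplus>\<^bsub>N\<^esub> g x)"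
proof -
  interpret N: module R N by (rule lin_cod[OF f])
  note c = lin_closed[OF f] lin_closed[OF g]
  show ?thesis
    by (rule linI[OF lin_dom[OF f] lin_cod[OF f]])
      (simp_all add: c lin_add[OF f] lin_add[OF g] lin_smult[OF f] lin_smult[OF g]
        N.smult_r_distr N.a_ac)
qed

lemma lin_uminus:
  assumes f: "lin R M N f" shows "lin R M N (\<lambda>x. \<ominus>\<^bsub>N\<^esub> f x)"
proof -
  interpret N: module R N by (rule lin_cod[OF f])
  show ?thesis
    by (rule linI[OF lin_dom[OF f] lin_cod[OF f]])
      (simp_all add: lin_closed[OF f] lin_add[OF f] lin_smult[OF f] N.smult_r_minus N.minus_add)
qed

lemma lin_minus:
  assumes f: "lin R M N f" and g: "lin R M N g" shows "lin R M N (\<lambda>x. f x \<ominus>\<^bsub>N\<^esub> g x)"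
  unfolding a_minus_def by (rule lin_plus[OF f lin_uminus[OF g]])

lemma lin_sum:
  assumes M: "module R M" and N: "module R N" and A: "finite A" "\<And>i. i \<in> A \<Longrightarrow> lin R M N (f i)"
  shows "lin R M N (\<lambda>x. \<Oplus>\<^bsub>N\<^esub>i\<in>A. f i x)"
proof -
  interpret N: module R N by fact
  show ?thesis using A
  proof (induction A rule: finite_induct)
    case empty
    then show ?case using lin_const_zero[OF M N] by simp
  next
    case (insert a A)
    have "lin R M N (\<lambda>x. f a x \<oplus>\<^bsub>N\<^esub> (\<Oplus>\<^bsub>N\<^esub>i\<in>A. f i x))"
      by (rule lin_plus) (use insert in auto)
    then show ?case
    proof (rule lin_cong)
      fix x assume x: "x \<in> carrier M"
      show "f a x \<oplus>\<^bsub>N\<^esub> (\<Oplus>\<^bsub>N\<^esub>i\<in>A. f i x) = (\<Oplus>\<^bsub>N\<^esub>i\<in>insert a A. f i x)"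
        using insert x by (subst N.finsum_insert) (auto intro: lin_closed)
    qed
  qed
qed

section \<open>Kernels, images and submodules\<close>

lemma mem_a_kernel: "x \<in> a_kernel M N f \<longleftrightarrow> x \<in> carrier M \<and> f x = \<zero>\<^bsub>N\<^esub>"
  by (simp add: a_kernel_def kernel_def)

lemma lin_kernel_submodule:
  assumes f: "lin R M N f" shows "submodule (a_kernel M N f) R M"
proof -
  interpret M: module R M by (rule lin_dom[OF f])
  interpret N: module R N by (rule lin_cod[OF f])
  show ?thesis
    by (rule M.submoduleI)
      (auto simp: mem_a_kernel lin_zero[OF f] lin_neg[OF f] lin_add[OF f] lin_smult[OF f])
qed

lemma lin_image_submodule:
  assumes f: "lin R M N f" shows "submodule (f ` carrier M) R N"
proof -
  interpret M: module R M by (rule lin_dom[OF f])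
  interpret N: module R N by (rule lin_cod[OF f])
  show ?thesis
  proof (rule N.submoduleI)
    show "\<zero>\<^bsub>N\<^esub> \<in> f ` carrier M" using lin_zero[OF f] M.zero_closed by (metis imageI)
  next
    fix a assume "a \<in> f ` carrier M"
    then show "\<ominus>\<^bsub>N\<^esub> a \<in> f ` carrier M" by (auto simp: lin_neg[OF f, symmetric])
  next
    fix a b assume "a \<in> f ` carrier M" "b \<in> f ` carrier M"
    then show "a \<oplus>\<^bsub>N\<^esub> b \<in> f ` carrier M" by (auto simp: lin_add[OF f, symmetric])
  next
    fix a x assume "a \<in> carrier R" "x \<in> f ` carrier M"
    then show "a \<odot>\<^bsub>N\<^esub> x \<in> f ` carrier M" by (auto simp: lin_smult[OF f, symmetric])
  qed (auto intro: lin_closed[OF f])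
qed

lemma submodule_module:
  assumes M: "module R M" and U: "submodule U R M" shows "module R (M\<lparr>carrier := U\<rparr>)"
  using submodule.submodule_is_module[OF U M] .

lemma submodule_facts:
  assumes M: "module R M" and U: "submodule U R M"
  shows submodule_subset: "U \<subseteq> carrier M" and submodule_zero: "\<zero>\<^bsub>M\<^esub> \<in> U"
    and submodule_add: "x \<in> U \<Longrightarrow> y \<in> U \<Longrightarrow> x \<oplus>\<^bsub>M\<^esub> y \<in> U"
    and submodule_smult: "r \<in> carrier R \<Longrightarrow> x \<in> U \<Longrightarrow> r \<odot>\<^bsub>M\<^esub> x \<in> U"
    and submodule_neg: "x \<in> U \<Longrightarrow> \<ominus>\<^bsub>M\<^esub> x \<in> U"
    and submodule_diff: "x \<in> U \<Longrightarrow> y \<in> U \<Longrightarrow> x \<ominus>\<^bsub>M\<^esub> y \<in> U"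
proof -
  interpret M: module R M by fact
  note E = M.submoduleE[OF U]
  show "U \<subseteq> carrier M" "\<zero>\<^bsub>M\<^esub> \<in> U" 
    using E(1) subgroup.one_closed[OF submodule.axioms(1)[OF U]] by auto
  show a: "x \<oplus>\<^bsub>M\<^esub> y \<in> U" if "x \<in> U" "y \<in> U" for x y
    using that by (rule E(5))
  show "r \<odot>\<^bsub>M\<^esub> x \<in> U" if "r \<in> carrier R" "x \<in> U" for r x
    using that by (rule E(4))
  show n: "\<ominus>\<^bsub>M\<^esub> x \<in> U" if "x \<in> U" for x using E(3) that by blast
  show "x \<ominus>\<^bsub>M\<^esub> y \<in> U" if "x \<in> U" "y \<in> U" for x y
    using a n that by (simp add: a_minus_def)
qed

lemma submodule_finsum:
  assumes M: "module R M" and U: "submodule U R M" and A: "finite A" "\<And>i. i \<in> A \<Longrightarrow> f i \<in> U"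
  shows "(\<Oplus>\<^bsub>M\<^esub>i\<in>A. f i) \<in> U"
proof -
  interpret M: module R M by fact
  note s = submodule_subset[OF M U]
  show ?thesis using A
  proof (induction A rule: finite_induct)
    case (insert a A)
    then have "(\<Oplus>\<^bsub>M\<^esub>i\<in>insert a A. f i) = f a \<oplus>\<^bsub>M\<^esub> (\<Oplus>\<^bsub>M\<^esub>i\<in>A. f i)"
      using s by (subst M.finsum_insert) auto
    then show ?case using submodule_add[OF M U] insert by simp
  qed (simp add: submodule_zero[OF M U])
qed

lemma lin_into_submodule:
  assumes f: "lin R M N f" and U: "submodule U R N" and "f ` carrier M \<subseteq> U"
  shows "lin R M (N\<lparr>carrier := U\<rparr>) f"
  using assms submodule_module[OF lin_cod[OF f] U] by (auto simp: lin_def)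

lemma lin_from_submodule:
  assumes f: "lin R M N f" and U: "submodule U R M"
  shows "lin R (M\<lparr>carrier := U\<rparr>) N f"
  using assms submodule_module[OF lin_dom[OF f] U] submodule_subset[OF lin_dom[OF f] U]
  by (auto simp: lin_def subset_iff)

lemma lin_inclusion:
  assumes "module R M" and "submodule U R M" shows "lin R (M\<lparr>carrier := U\<rparr>) M (\<lambda>x. x)"
  by (rule lin_from_submodule[OF lin_id]) (use assms in auto)

lemma lin_lin_ext:
  assumes P: "module R P" and \<beta>: "\<beta> \<in> S \<rightarrow> carrier P"
  shows "lin R (free_module R S) P (lin_ext R P S \<beta>)"
  by (rule linI[OF free_module_is_module[OF module.axioms(1)[OF P]] P])
    (simp_all add: lin_ext_closed[OF P \<beta>] lin_ext_add[OF P \<beta>] lin_ext_smult[OF P \<beta>])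


section \<open>Finite free modules\<close>

abbreviation (input) pow_module :: "('a, 'r) ring_scheme \<Rightarrow> nat \<Rightarrow> ('a, nat \<Rightarrow> 'a) module"
  where "pow_module R n \<equiv> free_module R {..<n}"

lemma free_module_apply:
  assumes "i \<in> S"
  shows "(c \<oplus>\<^bsub>free_module R S\<^esub> d) i = c i \<oplus>\<^bsub>R\<^esub> d i"
    and "(r \<odot>\<^bsub>free_module R S\<^esub> c) i = r \<otimes>\<^bsub>R\<^esub> c i"
    and "\<zero>\<^bsub>free_module R S\<^esub> i = \<zero>\<^bsub>R\<^esub>"
    and "c \<in> carrier (free_module R S) \<Longrightarrow> c i \<in> carrier R"
  using assms by (auto simp: free_module_def)

lemmas pow_module_apply = free_module_apply[of _ "{..<n}" for n :: nat, unfolded lessThan_iff]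

lemma free_module_eqI:
  assumes "c \<in> carrier (free_module R S)" "d \<in> carrier (free_module R S)" "\<And>i. i \<in> S \<Longrightarrow> c i = d i"
  shows "c = d"
  using assms by (intro PiE_ext[of c S "\<lambda>_. carrier R" d]) (auto simp: free_module_def)

lemmas pow_module_eqI = free_module_eqI[of _ _ "{..<n}" for n :: nat, unfolded lessThan_iff]

lemma pow_module_memI: "(\<And>i. i < n \<Longrightarrow> c i \<in> carrier R) \<Longrightarrow> restrict c {..<n} \<in> carrier (pow_module R n)"
  by (auto simp: free_module_def intro: finite_subset[of _ "{..<n}"])

lemma self_module_simps [simp]:
  "carrier (self_module R) = carrier R" "x \<oplus>\<^bsub>self_module R\<^esub> y = x \<oplus>\<^bsub>R\<^esub> y"
  "r \<odot>\<^bsub>self_module R\<^esub> y = r \<otimes>\<^bsub>R\<^esub> y" "\<zero>\<^bsub>self_module R\<^esub> = \<zero>\<^bsub>R\<^esub>"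
  by (simp_all add: self_module_def)

text \<open>A finite sum sees only the additive structure, which the two records share.\<close>

lemma finsum_self_module: "finsum (self_module R) f A = finsum R f A"
  by (simp add: finsum_def finprod_def self_module_def)

lemma lin_free_coord:
  assumes R: "cring R" and i: "i \<in> S"
  shows "lin R (free_module R S) (self_module R) (\<lambda>c. c i)"
  by (rule linI[OF free_module_is_module[OF R] self_module_is_module[OF R]])
    (simp_all add: free_module_apply[OF i])

lemmas lin_coord = lin_free_coord[of _ _ "{..<n}" for n :: nat, unfolded lessThan_iff]

text \<open>Checked coordinate by coordinate. \<open>S\<close> may be infinite and \<open>A\<close>
  is any finite set containing the support: \<open>A = {..<n}\<close> serves
  \<open>R\<^sup>n\<close>, and the support itself serves the free module underlying a tensor
  product.\<close>

lemma free_module_expand: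
  assumes R: "cring R" and c: "c \<in> carrier (free_module R S)"
    and A: "finite A" "A \<subseteq> S" "\<And>s. s \<in> S \<Longrightarrow> s \<notin> A \<Longrightarrow> c s = \<zero>\<^bsub>R\<^esub>"
  shows "c = (\<Oplus>\<^bsub>free_module R S\<^esub>i\<in>A. c i \<odot>\<^bsub>free_module R S\<^esub> free_gen R S i)"
proof -
  let ?F = "free_module R S"
  interpret R: cring R by fact
  interpret F: module R ?F by (rule free_module_is_module[OF R])
  have ck: "c i \<in> carrier R" if "i \<in> A" for i using free_module_apply(4)[OF _ c] that A(2) by auto
  have g: "c i \<odot>\<^bsub>?F\<^esub> free_gen R S i \<in> carrier ?F" if "i \<in> A" for i
    using ck[OF that] free_gen_closed[OF R] by (intro F.smult_closed)
  show ?thesis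
  proof (rule free_module_eqI[OF c])
    show "(\<Oplus>\<^bsub>?F\<^esub>i\<in>A. c i \<odot>\<^bsub>?F\<^esub> free_gen R S i) \<in> carrier ?F"
      by (rule F.finsum_closed) (use g in auto)
    fix k assume k: "k \<in> S"
    have "(\<Oplus>\<^bsub>?F\<^esub>i\<in>A. c i \<odot>\<^bsub>?F\<^esub> free_gen R S i) k
        = (\<Oplus>\<^bsub>R\<^esub>i\<in>A. (c i \<odot>\<^bsub>?F\<^esub> free_gen R S i) k)"
      using lin_finsum[OF lin_free_coord[OF R k] A(1), of "\<lambda>i. c i \<odot>\<^bsub>?F\<^esub> free_gen R S i"] g
      by (simp add: finsum_self_module)
    also have "\<dots> = (\<Oplus>\<^bsub>R\<^esub>i\<in>A. if k = i then c i else \<zero>\<^bsub>R\<^esub>)"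
      by (rule R.finsum_cong') (use ck k in \<open>auto simp: free_module_apply free_gen_def\<close>)
    also have "\<dots> = c k"
    proof (cases "k \<in> A")
      case True
      then show ?thesis using R.finsum_singleton[of k A c] A(1) ck by simp
    next
      case False
      have "(\<Oplus>\<^bsub>R\<^esub>i\<in>A. if k = i then c i else \<zero>\<^bsub>R\<^esub>) = (\<Oplus>\<^bsub>R\<^esub>i\<in>A. \<zero>\<^bsub>R\<^esub>)"
        by (rule R.finsum_cong') (use False in auto)
      then show ?thesis using A(3)[OF k False] by simp
    qed
    finally show "c k = (\<Oplus>\<^bsub>?F\<^esub>i\<in>A. c i \<odot>\<^bsub>?F\<^esub> free_gen R S i) k" ..
  qed
qed

lemma pow_module_expand:
  assumes R: "cring R" and c: "c \<in> carrier (pow_module R n)"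
  shows "c = (\<Oplus>\<^bsub>pow_module R n\<^esub>i\<in>{..<n}. c i \<odot>\<^bsub>pow_module R n\<^esub> free_gen R {..<n} i)"
  by (rule free_module_expand[OF R c]) auto

lemma lin_pow_expand:
  assumes f: "lin R (pow_module R n) P f" and c: "c \<in> carrier (pow_module R n)"
  shows "f c = (\<Oplus>\<^bsub>P\<^esub>i\<in>{..<n}. c i \<odot>\<^bsub>P\<^esub> f (free_gen R {..<n} i))"
proof -
  interpret P: module R P by (rule lin_cod[OF f])
  interpret F: module R "pow_module R n" by (rule lin_dom[OF f])
  have R: "cring R" by (rule P.is_cring)
  note g = free_gen_closed[OF R] and ci = pow_module_apply(4)[OF _ c]
  have "f c = f (\<Oplus>\<^bsub>pow_module R n\<^esub>i\<in>{..<n}. c i \<odot>\<^bsub>pow_module R n\<^esub> free_gen R {..<n} i)"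
    using pow_module_expand[OF R c] by simp
  also have "\<dots> = (\<Oplus>\<^bsub>P\<^esub>i\<in>{..<n}. f (c i \<odot>\<^bsub>pow_module R n\<^esub> free_gen R {..<n} i))"
    by (rule lin_finsum[OF f]) (auto intro: g ci)
  also have "\<dots> = (\<Oplus>\<^bsub>P\<^esub>i\<in>{..<n}. c i \<odot>\<^bsub>P\<^esub> f (free_gen R {..<n} i))"
    by (rule P.finsum_cong') (auto simp: lin_smult[OF f] g ci lin_closed[OF f])
  finally show ?thesis .
qed

lemma lin_pow_eqI:
  assumes f: "lin R (pow_module R n) P f" and g: "lin R (pow_module R n) P g"
    and eq: "\<And>i. i < n \<Longrightarrow> f (free_gen R {..<n} i) = g (free_gen R {..<n} i)"
    and c: "c \<in> carrier (pow_module R n)"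
  shows "f c = g c"
proof -
  interpret P: module R P by (rule lin_cod[OF f])
  have R: "cring R" by (rule P.is_cring)
  show ?thesis
    unfolding lin_pow_expand[OF f c] lin_pow_expand[OF g c]
    by (rule P.finsum_cong') 
      (auto simp: eq lin_closed[OF g] free_gen_closed[OF R] pow_module_apply(4)[OF _ c])
qed

text \<open>Projectivity of \<open>R\<^sup>n\<close>: preimages of the images of the basis vectors
  are chosen and extended linearly. Asking for containment of images instead of surjectivity of
  \<open>v\<close> suits lifts through a differential, whose image is a kernel.\<close>

lemma lin_pow_lift:
  assumes u: "lin R (pow_module R n) X u" and v: "lin R Y X v"
    and im: "u ` carrier (pow_module R n) \<subseteq> v ` carrier Y"
  obtains w where "lin R (pow_module R n) Y w" "\<And>c. c \<in> carrier (pow_module R n) \<Longrightarrow> v (w c) = u c"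
proof -
  interpret Y: module R Y by (rule lin_dom[OF v])
  have R: "cring R" by (rule Y.is_cring)
  note g = free_gen_closed[OF R]
  have "\<exists>y. y \<in> carrier Y \<and> v y = u (free_gen R {..<n} i)" for i
    using im g[of "{..<n}" i] by (metis (no_types, lifting) imageE imageI subsetD)
  then obtain y where y: "\<And>i. y i \<in> carrier Y" "\<And>i. v (y i) = u (free_gen R {..<n} i)"
    by metis
  have yc: "y \<in> {..<n} \<rightarrow> carrier Y" using y by auto
  define w where "w = lin_ext R Y {..<n} y"
  have w: "lin R (pow_module R n) Y w"
    unfolding w_def by (rule lin_lin_ext[OF Y.module_axioms yc])
  have "v (w c) = u c" if "c \<in> carrier (pow_module R n)" for c
    by (rule lin_pow_eqI[OF lin_comp[OF v w] u _ that])
      (simp add: w_def lin_ext_free_gen[OF Y.module_axioms yc] y)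
  with w show thesis by (rule that)
qed

section \<open>Free resolutions over Noetherian rings\<close>

lemma gen_submodule_least: "submodule W R M \<Longrightarrow> A \<subseteq> W \<Longrightarrow> gen_submodule R M A \<subseteq> W"
  by (auto simp: gen_submodule_def)

text \<open>Turns the intersection that defines \<open>gen_submodule\<close> into the set of linear
  combinations.\<close>

lemma lin_ext_image:
  assumes M: "module R M" and x: "x \<in> {..<n} \<rightarrow> carrier M"
  shows "lin_ext R M {..<n} x ` carrier (pow_module R n) = gen_submodule R M (x ` {..<n})"
proof
  interpret M: module R M by fact
  note f = lin_lin_ext[OF M x]
  have xs: "x ` {..<n} \<subseteq> carrier M" using x by auto
  note G = gen_submodule_is_submodule[OF M xs]
  show "lin_ext R M {..<n} x ` carrier (pow_module R n) \<subseteq> gen_submodule R M (x ` {..<n})"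
  proof (rule image_subsetI)
    fix c assume c: "c \<in> carrier (pow_module R n)"
    show "lin_ext R M {..<n} x c \<in> gen_submodule R M (x ` {..<n})"
      unfolding lin_pow_expand[OF f c]
      using G(2) pow_module_apply(4)[OF _ c]
      by (intro submodule_finsum[OF M G(1)] submodule_smult[OF M G(1)])
        (auto simp: lin_ext_free_gen[OF M x])
  qed
  have "x ` {..<n} \<subseteq> lin_ext R M {..<n} x ` carrier (pow_module R n)"
  proof (rule image_subsetI)
    fix i assume "i \<in> {..<n}"
    then show "x i \<in> lin_ext R M {..<n} x ` carrier (pow_module R n)"
      using lin_ext_free_gen[OF M x] free_gen_closed[OF M.is_cring] by (metis imageI)
  qed
  then show "gen_submodule R M (x ` {..<n}) \<subseteq> lin_ext R M {..<n} x ` carrier (pow_module R n)"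
    by (rule gen_submodule_least[OF lin_image_submodule[OF f]])
qed

section \<open>Finite generation of submodules of \<open>R\<^sup>n\<close>\<close>

lemma self_module_uminus: "\<ominus>\<^bsub>self_module R\<^esub> x = \<ominus>\<^bsub>R\<^esub> x"
  by (simp add: a_inv_def m_inv_def self_module_def)

text \<open>Link to the notion of ideal in which \<open>noetherian_ring\<close> is
  formulated.\<close>

lemma submodule_self_ideal:
  assumes R: "cring R" and J: "submodule J R (self_module R)" shows "ideal J R"
proof -
  interpret R: cring R by fact
  note M = self_module_is_module[OF R]
  interpret M: module R "self_module R" by (rule M)
  note F = submodule_facts[OF M J, simplified self_module_simps self_module_uminus]
  have Jc: "x \<in> J \<Longrightarrow> x \<in> carrier R" for x using F(1) by auto
  show ?thesis
  proof (rule idealI[OF R.ring_axioms])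
    show "subgroup J (add_monoid R)"
    proof (rule R.add.subgroupI)
      show "J \<noteq> {}" using F(2) by auto
    qed (use F Jc in \<open>auto simp: a_inv_def[symmetric]\<close>)
  next
    fix a x assume a: "a \<in> J" "x \<in> carrier R"
    show "x \<otimes>\<^bsub>R\<^esub> a \<in> J" using F(4) a by blast
    then show "a \<otimes>\<^bsub>R\<^esub> x \<in> J" using R.m_comm a Jc by simp
  qed
qed

lemma submodule_Int_pow_lower:
  assumes R: "cring R" and U: "submodule U R (pow_module R n)"
  shows "submodule {x \<in> U. \<forall>i. k \<le> i \<and> i < n \<longrightarrow> x i = \<zero>\<^bsub>R\<^esub>} R (pow_module R n)"
proof -
  interpret R: cring R by fact
  note M = free_module_is_module[OF R]
  interpret M: module R "pow_module R n" by (rule M)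
  note F = submodule_facts[OF M U]
  have neg: "(\<ominus>\<^bsub>pow_module R n\<^esub> x) i = \<zero>\<^bsub>R\<^esub>"
    if "x \<in> U" "i < n" "x i = \<zero>\<^bsub>R\<^esub>" for x i
    using lin_neg[OF lin_coord[OF R, of i n], of x] that F(1)
    by (auto simp: self_module_uminus)
  show ?thesis
    by (rule M.submoduleI) (use F neg in \<open>auto simp: pow_module_apply\<close>)
qed

text \<open>Induction on the number of possibly nonzero leading coordinates: the elements vanishing from
  coordinate \<open>k\<close> on, modulo those vanishing already from \<open>k - 1\<close> on, form an ideal of \<open>R\<close>.\<close>

lemma noetherian_submodule_pow:
  assumes R: "cring R" and noeth: "noetherian_ring R" and U: "submodule U R (pow_module R n)"
  obtains A where "finite A" "A \<subseteq> carrier (pow_module R n)" "gen_submodule R (pow_module R n) A = U"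
proof -
  interpret R: cring R by fact
  let ?P = "pow_module R n"
  note M = free_module_is_module[OF R]
  interpret M: module R ?P by (rule M)
  define V where "V k = {x \<in> U. \<forall>i. k \<le> i \<and> i < n \<longrightarrow> x i = \<zero>\<^bsub>R\<^esub>}" for k
  have V: "submodule (V k) R ?P" for k
    unfolding V_def by (rule submodule_Int_pow_lower[OF R U])
  have "k \<le> n \<Longrightarrow> \<exists>A. finite A \<and> A \<subseteq> carrier ?P \<and> gen_submodule R ?P A = V k" for k
  proof (induction k)
    case 0
    have "x = \<zero>\<^bsub>?P\<^esub>" if "x \<in> V 0" for x
      by (rule pow_module_eqI)
        (use that submodule_subset[OF M U] in \<open>auto simp: V_def pow_module_apply\<close>)
    then have "V 0 \<subseteq> {\<zero>\<^bsub>?P\<^esub>}" by auto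
    moreover have "\<zero>\<^bsub>?P\<^esub> \<in> gen_submodule R ?P {}"
      by (rule submodule_zero[OF M gen_submodule_is_submodule(1)[OF M]]) simp
    moreover have "gen_submodule R ?P {} \<subseteq> V 0" by (rule gen_submodule_least[OF V]) simp
    ultimately show ?case by (intro exI[of _ "{}"]) auto
  next
    case (Suc k)
    then obtain B where B: "finite B" "B \<subseteq> carrier ?P" "gen_submodule R ?P B = V k" by auto
    have k: "k < n" using Suc.prems by simp
    note VS = submodule_facts[OF M V[of "Suc k"]]
    note coord = lin_coord[OF R k]
    let ?I = "\<lambda>W. (\<lambda>c. c k) ` W"
    have sub: "ideal (?I W) R" if "submodule W R ?P" for W
      using lin_image_submodule[OF lin_from_submodule[OF coord that]]
      by (intro submodule_self_ideal[OF R]) simp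
    obtain a where a: "a \<subseteq> carrier R" "finite a" "?I (V (Suc k)) = genideal R a"
      using noetherian_ring.finetely_gen[OF noeth sub[OF V]] by blast
    have "a \<subseteq> ?I (V (Suc k))" using R.genideal_self[OF a(1)] a(3) by simp
    \<comment> \<open>\<open>C\<close> lifts the generators of the ideal of \<open>k\<close>-th
      coordinates to vectors; together with the generators \<open>B\<close> of \<open>V k\<close> it
      will generate \<open>V (Suc k)\<close>.\<close>
    then obtain C where C: "C \<subseteq> V (Suc k)" "finite C" "a = ?I C"
      using finite_subset_image[OF a(2)] by meson
    have CB: "C \<union> B \<subseteq> carrier ?P" using C(1) B(2) VS(1) by auto
    note G = gen_submodule_is_submodule[OF M CB]
    have VkS: "V k \<subseteq> V (Suc k)" by (auto simp: V_def)
    have "B \<subseteq> V k" using gen_submodule_is_submodule(2)[OF M B(2)] B(3) by simp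
    then have le: "gen_submodule R ?P (C \<union> B) \<subseteq> V (Suc k)"
      using C(1) VkS by (intro gen_submodule_least[OF V]) auto
    have Vk: "V k \<subseteq> gen_submodule R ?P (C \<union> B)"
      using gen_submodule_least[OF G(1), of B] G(2) B(3) by auto
    have "x \<in> gen_submodule R ?P (C \<union> B)" if x: "x \<in> V (Suc k)" for x
    proof -
      \<comment> \<open>The \<open>k\<close>-th coordinates of the span form an ideal containing
        \<open>a\<close>, hence containing \<open>x k\<close>. Subtracting a vector \<open>v\<close>
        of the span with the same \<open>k\<close>-th coordinate moves \<open>x\<close> into
        \<open>V k\<close>, which the span already contains.\<close>
      have "genideal R a \<subseteq> ?I (gen_submodule R ?P (C \<union> B))"
        by (rule R.genideal_minimal[OF sub[OF G(1)]]) (use G(2) C(3) in auto)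
      then have "x k \<in> ?I (gen_submodule R ?P (C \<union> B))" using a(3) x by auto
      then obtain v where v: "v \<in> gen_submodule R ?P (C \<union> B)" "v k = x k" by auto
      have vV: "v \<in> V (Suc k)" using v(1) le by auto
      have xc: "x \<in> carrier ?P" and vc: "v \<in> carrier ?P" using x vV VS(1) by auto
      have d: "x \<ominus>\<^bsub>?P\<^esub> v \<in> V (Suc k)" using VS(6) x vV by blast
      have "(x \<ominus>\<^bsub>?P\<^esub> v) k = x k \<ominus>\<^bsub>self_module R\<^esub> v k" by (rule lin_diff[OF coord xc vc])
      also have "\<dots> = \<zero>\<^bsub>R\<^esub>"
        using v(2) pow_module_apply(4)[OF k xc] by (simp add: a_minus_def self_module_uminus R.r_neg)
      finally have vk: "(x \<ominus>\<^bsub>?P\<^esub> v) k = \<zero>\<^bsub>R\<^esub>" .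
      have "(x \<ominus>\<^bsub>?P\<^esub> v) i = \<zero>\<^bsub>R\<^esub>" if "k \<le> i" "i < n" for i
        using d vk that by (cases "i = k") (auto simp: V_def)
      then have "x \<ominus>\<^bsub>?P\<^esub> v \<in> V k"
        using d by (simp add: V_def)
      then have "(x \<ominus>\<^bsub>?P\<^esub> v) \<oplus>\<^bsub>?P\<^esub> v \<in> gen_submodule R ?P (C \<union> B)"
        using Vk v(1) submodule_add[OF M G(1)] by blast
      then show ?thesis using xc vc by (simp add: a_minus_def M.a_assoc M.l_neg)
    qed
    then show ?case using le C(2) B(1) CB by (intro exI[of _ "C \<union> B"]) auto
  qed
  from this[of n] obtain A where "finite A" "A \<subseteq> carrier ?P" "gen_submodule R ?P A = V n" by auto
  moreover have "V n = U" by (auto simp: V_def)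
  ultimately show thesis using that by blast
qed

text \<open>A maximal element among the proper ideals containing \<open>x\<close> is a maximal
  ideal, hence the unique one. It exists by Zorn's lemma: over a Noetherian ring a nonempty chain of
  ideals contains its own union, and the principal ideal of a nonunit is proper.\<close>

lemma nonunit_in_max_ideal:
  assumes loc: "local_ring R" and noeth: "noetherian_ring R"
    and x: "x \<in> carrier R" "x \<notin> Units R"
  shows "x \<in> max_ideal R"
proof -
  have R: "cring R" using loc by (simp add: local_ring_def)
  interpret R: cring R by fact
  interpret noetherian_ring R by fact
  define \<A> where "\<A> = {I. ideal I R \<and> x \<in> I \<and> I \<noteq> carrier R}"
  have "PIdl\<^bsub>R\<^esub> x \<in> \<A>"
    using R.cgenideal_ideal R.cgenideal_self R.ideal_eq_carrier_iff x by (auto simp: \<A>_def)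
  then have "\<exists>I\<in>\<A>. \<forall>X\<in>\<A>. I \<subseteq> X \<longrightarrow> X = I"
  proof (intro subset_Zorn_nonempty)
    fix C assume C: "C \<noteq> {}" "subset.chain \<A> C"
    then have "\<Union>C \<in> C"
      by (intro ideal_chain_is_trivial) (auto simp: subset.chain_def \<A>_def)
    then show "\<Union>C \<in> \<A>" using C(2) by (auto simp: subset.chain_def)
  qed auto
  then obtain I where I: "ideal I R" "x \<in> I" "I \<noteq> carrier R" "\<And>X. X \<in> \<A> \<Longrightarrow> I \<subseteq> X \<Longrightarrow> X = I"
    by (auto simp: \<A>_def)
  have "maximalideal I R"
    by (rule maximalidealI[OF I(1)]) (use I in \<open>auto simp: \<A>_def\<close>)
  then have "max_ideal R = I"
    using loc unfolding local_ring_def max_ideal_def by (metis the1_equality)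
  then show ?thesis using I(2) by simp
qed

text \<open>A generating set of least cardinality: a relation with a unit coefficient would make one
  generator redundant.\<close>

lemma minimal_cover:
  assumes loc: "local_ring R" and noeth: "noetherian_ring R" and M: "module R M"
    and A: "finite A" "A \<subseteq> carrier M"
  obtains n f where "lin R (pow_module R n) M f"
    "f ` carrier (pow_module R n) = gen_submodule R M A"
    "\<And>c i. c \<in> carrier (pow_module R n) \<Longrightarrow> f c = \<zero>\<^bsub>M\<^esub> \<Longrightarrow> i < n \<Longrightarrow> c i \<in> max_ideal R"
proof -
  interpret M: module R M by fact
  define Q where "Q k \<longleftrightarrow> (\<exists>B. finite B \<and> B \<subseteq> carrier M \<and> card B = k \<and>
    gen_submodule R M B = gen_submodule R M A)" for k
  define n where "n = (LEAST k. Q k)"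
  have "Q (card A)" using A by (auto simp: Q_def)
  then have "Q n" unfolding n_def by (rule LeastI)
  then obtain B where B: "finite B" "B \<subseteq> carrier M" "card B = n"
      "gen_submodule R M B = gen_submodule R M A"
    by (auto simp: Q_def)
  have least: "\<not> Q k" if "k < n" for k using not_less_Least that by (auto simp: n_def)
  obtain x where x: "bij_betw x {..<n} B"
    using ex_bij_betw_nat_finite[OF B(1)] B(3) by (auto simp: atLeast0LessThan)
  have xim: "x ` {..<n} = B" using x by (simp add: bij_betw_def)
  have xc: "x \<in> {..<n} \<rightarrow> carrier M" using xim B(2) by auto
  define f where "f = lin_ext R M {..<n} x"
  have f: "lin R (pow_module R n) M f" unfolding f_def by (rule lin_lin_ext[OF M xc])
  have im: "f ` carrier (pow_module R n) = gen_submodule R M A"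
    unfolding f_def using lin_ext_image[OF M xc] xim B(4) by simp
  show thesis
  proof (rule that[OF f im])
    fix c i assume c: "c \<in> carrier (pow_module R n)" and fc: "f c = \<zero>\<^bsub>M\<^esub>" and i: "i < n"
    note ck = pow_module_apply(4)[OF _ c]
    show "c i \<in> max_ideal R"
    proof (rule ccontr)
      assume "c i \<notin> max_ideal R"
      then have u: "c i \<in> Units R" using nonunit_in_max_ideal[OF loc noeth] ck[OF i] by blast
      define B' where "B' = B - {x i}"
      have xi: "x i \<in> B" using xim i by auto
      have B'c: "B' \<subseteq> carrier M" using B(2) by (auto simp: B'_def)
      note G = gen_submodule_is_submodule[OF M B'c]
      \<comment> \<open>Injectivity of the enumeration \<open>x\<close> enters here: no index other
        than \<open>i\<close> can hit the removed generator.\<close>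
      have xj: "x j \<in> B'" if "j < n" "j \<noteq> i" for j
        using that i x unfolding B'_def bij_betw_def by (auto simp: inj_on_def)
      have xM: "x j \<in> carrier M" if "j < n" for j using xc that by auto
      let ?s = "\<Oplus>\<^bsub>M\<^esub>j\<in>{..<n}-{i}. c j \<odot>\<^bsub>M\<^esub> x j"
      have s: "?s \<in> gen_submodule R M B'"
        by (rule submodule_finsum[OF M G(1)])
          (use xj G(2) ck in \<open>auto intro!: submodule_smult[OF M G(1)]\<close>)
      then have sc: "?s \<in> carrier M" using submodule_subset[OF M G(1)] by auto
      have "f c = (\<Oplus>\<^bsub>M\<^esub>j\<in>{..<n}. c j \<odot>\<^bsub>M\<^esub> f (free_gen R {..<n} j))"
        by (rule lin_pow_expand[OF f c])
      also have "\<dots> = (\<Oplus>\<^bsub>M\<^esub>j\<in>insert i ({..<n}-{i}). c j \<odot>\<^bsub>M\<^esub> x j)"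
        by (rule M.finsum_cong') (use i ck xM in \<open>auto simp: f_def lin_ext_free_gen[OF M xc]\<close>)
      also have "\<dots> = c i \<odot>\<^bsub>M\<^esub> x i \<oplus>\<^bsub>M\<^esub> ?s"
        by (subst M.finsum_insert) (use i ck xM in auto)
      finally have "c i \<odot>\<^bsub>M\<^esub> x i \<oplus>\<^bsub>M\<^esub> ?s = \<zero>\<^bsub>M\<^esub>" using fc by simp
      then have "c i \<odot>\<^bsub>M\<^esub> x i = \<ominus>\<^bsub>M\<^esub> ?s"
        using M.minus_equality sc ck[OF i] xM[OF i] by (metis M.smult_closed)
      then have e: "c i \<odot>\<^bsub>M\<^esub> x i \<in> gen_submodule R M B'" using submodule_neg[OF M G(1) s] by simp
      have "inv\<^bsub>R\<^esub> (c i) \<odot>\<^bsub>M\<^esub> (c i \<odot>\<^bsub>M\<^esub> x i) = x i"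
        using u xM[OF i] ck[OF i] by (simp add: M.smult_assoc1[symmetric])
      then have xin: "x i \<in> gen_submodule R M B'"
        using submodule_smult[OF M G(1) _ e, of "inv\<^bsub>R\<^esub> (c i)"] u by simp
      have "B \<subseteq> gen_submodule R M B'" using G(2) xin by (auto simp: B'_def)
      then have "gen_submodule R M B \<subseteq> gen_submodule R M B'" by (rule gen_submodule_least[OF G(1)])
      moreover have "gen_submodule R M B' \<subseteq> gen_submodule R M B"
        using gen_submodule_is_submodule[OF M B(2)]
        by (intro gen_submodule_least) (auto simp: B'_def)
      moreover have "card B' < n" using B(1,3) xi by (metis B'_def card_Diff1_less)
      ultimately have "Q (card B')" using B(1,4) B'c by (auto simp: Q_def B'_def)
      then show False using least \<open>card B' < n\<close> by blast
    qed
  qed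
qed

text \<open>Converts the coordinatewise minimality delivered by \<open>minimal_cover\<close> into
  the \<open>ideal_smult\<close> form of \<open>is_minimal_free_resolution\<close>, by expanding
  \<open>c\<close> in the standard basis.\<close>

lemma ideal_smult_powI:
  assumes R: "cring R" and I: "I \<subseteq> carrier R" and c: "c \<in> carrier (pow_module R n)"
    and ci: "\<And>i. i < n \<Longrightarrow> c i \<in> I"
  shows "c \<in> ideal_smult R I (pow_module R n)"
proof -
  note M = free_module_is_module[OF R]
  interpret M: module R "pow_module R n" by (rule M)
  let ?A = "{r \<odot>\<^bsub>pow_module R n\<^esub> x |r x. r \<in> I \<and> x \<in> carrier (pow_module R n)}"
  have A: "?A \<subseteq> carrier (pow_module R n)"
  proof clarify
    fix r x assume "r \<in> I" "x \<in> carrier (pow_module R n)"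
    then show "r \<odot>\<^bsub>pow_module R n\<^esub> x \<in> carrier (pow_module R n)"
      using I by (intro M.smult_closed) blast+
  qed
  note G = gen_submodule_is_submodule[OF M A]
  have "(\<Oplus>\<^bsub>pow_module R n\<^esub>i\<in>{..<n}. c i \<odot>\<^bsub>pow_module R n\<^esub> free_gen R {..<n} i)
      \<in> gen_submodule R (pow_module R n) ?A"
  proof (rule submodule_finsum[OF M G(1)])
    fix i assume "i \<in> {..<n}"
    then have "c i \<odot>\<^bsub>pow_module R n\<^esub> free_gen R {..<n} i \<in> ?A"
      using ci free_gen_closed[OF R, of "{..<n}" i] by blast
    then show "c i \<odot>\<^bsub>pow_module R n\<^esub> free_gen R {..<n} i \<in> gen_submodule R (pow_module R n) ?A"
      using G(2) by blast
  qed simp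
  then show ?thesis unfolding ideal_smult_def pow_module_expand[OF R c, symmetric] .
qed

text \<open>The exactness of \<open>is_free_resolution\<close> with \<open>lin\<close> in place of
  \<open>mod_hom\<close>, so that splices and cones made of plain composites and sums qualify
  without being restricted to carriers.\<close>

definition fres ::
  "('a, 'r) ring_scheme \<Rightarrow> ('a, 'm, 'x) module_scheme \<Rightarrow> (nat \<Rightarrow> nat)
    \<Rightarrow> (nat \<Rightarrow> (nat \<Rightarrow> 'a) \<Rightarrow> (nat \<Rightarrow> 'a)) \<Rightarrow> ((nat \<Rightarrow> 'a) \<Rightarrow> 'm) \<Rightarrow> bool"
  where "fres R M n d e \<longleftrightarrow>
    lin R (pow_module R (n 0)) M e \<and>
    (\<forall>i. lin R (pow_module R (n (Suc i))) (pow_module R (n i)) (d i)) \<and>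
    e ` carrier (pow_module R (n 0)) = carrier M \<and>
    d 0 ` carrier (pow_module R (n 1)) = a_kernel (pow_module R (n 0)) M e \<and>
    (\<forall>i. d (Suc i) ` carrier (pow_module R (n (Suc (Suc i))))
      = a_kernel (pow_module R (n (Suc i))) (pow_module R (n i)) (d i))"

lemma is_free_resolution_fres:
  assumes M: "module R M" and F: "is_free_resolution R M F"
  shows "fres R M (res_rank F) (res_diff F) (res_aug F)"
proof -
  interpret M: module R M by fact
  note P = free_module_is_module[OF M.is_cring, of "{..<n}" for n :: nat]
  show ?thesis
    using F mod_hom_lin[OF P M] mod_hom_lin[OF P P]
    unfolding is_free_resolution_def resolution_def fres_def res_module_def by simp
qed

text \<open>Each kernel is a submodule of some \<open>R\<^sup>n\<close>, hence finitely generated,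
  and is covered minimally by the next free module; the choices are strung together by dependent
  choice.\<close>

lemma minimal_free_resolution_exists:
  assumes loc: "local_ring R" and noeth: "noetherian_ring R" and M: "fin_gen_module R M"
  shows "\<exists>F. is_minimal_free_resolution R M F"
proof -
  have mod: "module R M" using M by (simp add: fin_gen_module_def)
  interpret M: module R M by (rule mod)
  have R: "cring R" by (rule M.is_cring)
  note P = free_module_is_module[OF R, of "{..<n}" for n :: nat]
  obtain A where A: "A \<subseteq> carrier M" "finite A" "gen_submodule R M A = carrier M"
    using M by (auto simp: fin_gen_module_def)
  let ?m = "max_ideal R"
  have mR: "?m \<subseteq> carrier R"
  proof -
    have "maximalideal ?m R"
      using loc theI'[of "\<lambda>I. maximalideal I R"] by (simp add: local_ring_def max_ideal_def)
    then interpret maximalideal ?m R .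
    show ?thesis by (rule a_subset)
  qed
  obtain n0 e where e: "lin R (pow_module R n0) M e" "e ` carrier (pow_module R n0) = carrier M"
    "\<And>c i. c \<in> carrier (pow_module R n0) \<Longrightarrow> e c = \<zero>\<^bsub>M\<^esub> \<Longrightarrow> i < n0 \<Longrightarrow> c i \<in> ?m"
    using minimal_cover[OF loc noeth mod A(2,1)] A(3) by metis
  \<comment> \<open>A state is a rank with the kernel in it that is still to be covered. Its
    coordinates lie in the maximal ideal, which is the minimality of the next differential, since
    that differential will have image \<open>U\<close>.\<close>
  define Good where "Good = (\<lambda>(n, U). submodule U R (pow_module R n) \<and>
      (\<forall>c\<in>U. \<forall>i<n. c i \<in> ?m))"
  define step where "step = (\<lambda>(n, U) (n', U') f. f \<in> mod_hom R (pow_module R n') (pow_module R n) \<and>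
      f ` carrier (pow_module R n') = U \<and> a_kernel (pow_module R n') (pow_module R n) f = U')"
  define start where "start = (n0, a_kernel (pow_module R n0) M e)"
  have Gs: "Good start"
    using lin_kernel_submodule[OF e(1)] e(3) by (auto simp: Good_def start_def mem_a_kernel)
  have ex: "\<exists>y. Good y \<and> (\<exists>f. step x y f)" if "Good x" for x
  proof -
    obtain n U where x: "x = (n, U)" by (cases x)
    have U: "submodule U R (pow_module R n)" using that by (simp add: x Good_def)
    obtain B where B: "finite B" "B \<subseteq> carrier (pow_module R n)" "gen_submodule R (pow_module R n) B = U"
      by (rule noetherian_submodule_pow[OF R noeth U])
    obtain n' f where f: "lin R (pow_module R n') (pow_module R n) f"
        "f ` carrier (pow_module R n') = U"
        "\<And>c i. c \<in> carrier (pow_module R n') \<Longrightarrow> f c = \<zero>\<^bsub>pow_module R n\<^esub> \<Longrightarrow> i < n' \<Longrightarrow> c i \<in> ?m"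
      using minimal_cover[OF loc noeth P B(1,2)] B(3) by metis
    let ?K = "a_kernel (pow_module R n') (pow_module R n) f"
    have "Good (n', ?K)"
      using lin_kernel_submodule[OF f(1)] f(3) by (auto simp: Good_def mem_a_kernel)
    moreover have "a_kernel (pow_module R n') (pow_module R n) (restrict f (carrier (pow_module R n'))) = ?K"
      by (auto simp: mem_a_kernel)
    then have "step x (n', ?K) (restrict f (carrier (pow_module R n')))"
      using lin_restrict_mod_hom[OF f(1)] f(2) by (simp add: step_def x)
    ultimately show ?thesis by blast
  qed
  \<comment> \<open>Dependent choice does not prescribe the initial state, so the clause for
    \<open>i = 0\<close> pins it down.\<close>
  have "\<exists>s. \<forall>i. (Good (s i) \<and> (i = 0 \<longrightarrow> s i = start)) \<and> (\<exists>f. step (s i) (s (Suc i)) f)"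
  proof (rule dependent_nat_choice)
    show "\<exists>x. Good x \<and> (0 = (0::nat) \<longrightarrow> x = start)" using Gs by blast
    show "\<exists>y. (Good y \<and> (Suc i = 0 \<longrightarrow> y = start)) \<and> (\<exists>f. step x y f)"
      if "Good x \<and> (i = 0 \<longrightarrow> x = start)" for x i
      using ex[of x] that by blast
  qed
  then obtain s where s: "\<And>i. Good (s i)" "s 0 = start" "\<And>i. \<exists>f. step (s i) (s (Suc i)) f"
    by auto
  from s(3) obtain d where d: "\<And>i. step (s i) (s (Suc i)) (d i)" by metis
  define n where "n i = fst (s i)" for i
  define U where "U i = snd (s i)" for i
  have n0: "n 0 = n0" "U 0 = a_kernel (pow_module R n0) M e"
    using s(2) by (simp_all add: n_def U_def start_def)
  have d': "d i \<in> mod_hom R (pow_module R (n (Suc i))) (pow_module R (n i))"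
      "d i ` carrier (pow_module R (n (Suc i))) = U i"
      "a_kernel (pow_module R (n (Suc i))) (pow_module R (n i)) (d i) = U (Suc i)" for i
    using d[of i] by (auto simp: step_def n_def U_def split: prod.splits)
  have small: "U i \<subseteq> ideal_smult R ?m (pow_module R (n i))" for i
  proof
    fix c assume "c \<in> U i"
    moreover have "Good (n i, U i)" using s(1)[of i] by (simp add: n_def U_def)
    ultimately show "c \<in> ideal_smult R ?m (pow_module R (n i))"
      using submodule_subset[OF P, of "U i" "n i"]
      by (intro ideal_smult_powI[OF R mR]) (auto simp: Good_def)
  qed
  define F where "F = \<lparr>res_rank = n, res_diff = d, res_aug = restrict e (carrier (pow_module R n0))\<rparr>"
  have "a_kernel (pow_module R n0) M (restrict e (carrier (pow_module R n0))) = U 0"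
    unfolding n0(2) by (auto simp: mem_a_kernel)
  then have "is_minimal_free_resolution R M F"
    unfolding is_minimal_free_resolution_def is_free_resolution_def resolution_def
    using d'(1) lin_restrict_mod_hom[OF e(1)] e(2) small
    by (simp add: F_def res_module_def n0(1) d'(2,3))
  then show ?thesis ..
qed

lemma minimal_free_resolution_is_minimal:
  assumes "local_ring R" and "noetherian_ring R" and "fin_gen_module R M"
  shows "is_minimal_free_resolution R M (minimal_free_resolution R M)"
  unfolding minimal_free_resolution_def by (rule someI_ex[OF minimal_free_resolution_exists[OF assms]])

text \<open>The choice behind \<open>free_resolution\<close> is legitimate because a minimal
  resolution is in particular a free one.\<close>

lemma free_resolution_is_free_resolution:
  assumes "local_ring R" and "noetherian_ring R" and "fin_gen_module R M"
  shows "is_free_resolution R M (free_resolution R M)"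
proof -
  obtain F where "is_free_resolution R M F"
    using minimal_free_resolution_exists[OF assms] by (auto simp: is_minimal_free_resolution_def)
  then show ?thesis unfolding free_resolution_def by (rule someI)
qed

section \<open>Comparison of resolutions\<close>

text \<open>\<open>fres\<close> stripped of exactness, as the source of a chain lift. In
  \<open>cone_resolution\<close> it lets a resolution of a kernel be regarded as a complex over the
  ambient module, onto which its augmentation is in general not surjective.\<close>

definition fcomplex ::
  "('a, 'r) ring_scheme \<Rightarrow> ('a, 'm, 'x) module_scheme \<Rightarrow> (nat \<Rightarrow> nat)
    \<Rightarrow> (nat \<Rightarrow> (nat \<Rightarrow> 'a) \<Rightarrow> (nat \<Rightarrow> 'a)) \<Rightarrow> ((nat \<Rightarrow> 'a) \<Rightarrow> 'm) \<Rightarrow> bool"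
  where "fcomplex R M n d e \<longleftrightarrow>
    lin R (pow_module R (n 0)) M e \<and>
    (\<forall>i. lin R (pow_module R (n (Suc i))) (pow_module R (n i)) (d i)) \<and>
    (\<forall>c\<in>carrier (pow_module R (n (Suc 0))). e (d 0 c) = \<zero>\<^bsub>M\<^esub>) \<and>
    (\<forall>i. \<forall>c\<in>carrier (pow_module R (n (Suc (Suc i)))). d i (d (Suc i) c) = \<zero>\<^bsub>pow_module R (n i)\<^esub>)"

lemma
  assumes "fcomplex R M n d e"
  shows fcomplex_aug: "lin R (pow_module R (n 0)) M e"
    and fcomplex_diff: "lin R (pow_module R (n (Suc i))) (pow_module R (n i)) (d i)"
    and fcomplex_aug_diff: "c \<in> carrier (pow_module R (n (Suc 0))) \<Longrightarrow> e (d 0 c) = \<zero>\<^bsub>M\<^esub>"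
    and fcomplex_diff_diff: "c \<in> carrier (pow_module R (n (Suc (Suc i))))
      \<Longrightarrow> d i (d (Suc i) c) = \<zero>\<^bsub>pow_module R (n i)\<^esub>"
  using assms by (simp_all add: fcomplex_def)

lemma
  assumes "fres R M n d e"
  shows fres_aug: "lin R (pow_module R (n 0)) M e"
    and fres_diff: "lin R (pow_module R (n (Suc i))) (pow_module R (n i)) (d i)"
    and fres_surj: "e ` carrier (pow_module R (n 0)) = carrier M"
    and fres_exact0: "c \<in> carrier (pow_module R (n 0)) \<Longrightarrow> e c = \<zero>\<^bsub>M\<^esub>
      \<Longrightarrow> c \<in> d 0 ` carrier (pow_module R (n (Suc 0)))"
    and fres_exact: "c \<in> carrier (pow_module R (n (Suc i))) \<Longrightarrow> d i c = \<zero>\<^bsub>pow_module R (n i)\<^esub>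
      \<Longrightarrow> c \<in> d (Suc i) ` carrier (pow_module R (n (Suc (Suc i))))"
    and fres_fcomplex: "fcomplex R M n d e"
proof -
  have k0: "d 0 ` carrier (pow_module R (n (Suc 0))) = a_kernel (pow_module R (n 0)) M e"
    and k: "\<And>i. d (Suc i) ` carrier (pow_module R (n (Suc (Suc i))))
      = a_kernel (pow_module R (n (Suc i))) (pow_module R (n i)) (d i)"
    using assms by (simp_all add: fres_def)
  show l: "lin R (pow_module R (n 0)) M e" 
    and ld: "lin R (pow_module R (n (Suc i))) (pow_module R (n i)) (d i)" for i
    using assms by (simp_all add: fres_def)
  show "e ` carrier (pow_module R (n 0)) = carrier M" using assms by (simp add: fres_def)
  show "c \<in> d 0 ` carrier (pow_module R (n (Suc 0)))"
    if "c \<in> carrier (pow_module R (n 0))" "e c = \<zero>\<^bsub>M\<^esub>"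
    unfolding k0 mem_a_kernel using that ..
  show "c \<in> d (Suc i) ` carrier (pow_module R (n (Suc (Suc i))))"
    if "c \<in> carrier (pow_module R (n (Suc i)))" "d i c = \<zero>\<^bsub>pow_module R (n i)\<^esub>"
    unfolding k mem_a_kernel using that ..
  have "e (d 0 c) = \<zero>\<^bsub>M\<^esub>" if "c \<in> carrier (pow_module R (n (Suc 0)))" for c
    using imageI[OF that, of "d 0"] unfolding k0 mem_a_kernel by simp
  moreover have "d i (d (Suc i) c) = \<zero>\<^bsub>pow_module R (n i)\<^esub>"
    if "c \<in> carrier (pow_module R (n (Suc (Suc i))))" for c i
    using imageI[OF that, of "d (Suc i)"] unfolding k mem_a_kernel by simp
  ultimately show "fcomplex R M n d e" using l ld by (simp add: fcomplex_def)
qed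

text \<open>Existence part of the comparison theorem: exactness of the target puts
  \<open>\<alpha> i\<close> after \<open>c i\<close> into the image of \<open>d i\<close>, and
  freeness of the source lifts it through \<open>d i\<close>.\<close>

lemma chain_lift:
  assumes F: "fcomplex R M m c e" and Q: "fres R M n d e'"
  obtains \<alpha> where "\<And>i. lin R (pow_module R (m i)) (pow_module R (n i)) (\<alpha> i)"
    "\<And>x. x \<in> carrier (pow_module R (m 0)) \<Longrightarrow> e' (\<alpha> 0 x) = e x"
    "\<And>i x. x \<in> carrier (pow_module R (m (Suc i))) \<Longrightarrow> d i (\<alpha> (Suc i) x) = \<alpha> i (c i x)"
proof -
  let ?F = "\<lambda>i. pow_module R (m i)" and ?Q = "\<lambda>i. pow_module R (n i)"
  \<comment> \<open>Dependent choice sees only one step at a time, so the invariant carries the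
    image containment on which the next lift depends.\<close>
  define Good where "Good i a \<longleftrightarrow> lin R (?F i) (?Q i) a \<and>
    (\<forall>x\<in>carrier (?F (Suc i)). a (c i x) \<in> d i ` carrier (?Q (Suc i)))" for i a
  have "e ` carrier (?F 0) \<subseteq> e' ` carrier (?Q 0)"
    unfolding fres_surj[OF Q] using lin_closed[OF fcomplex_aug[OF F]] by auto
  from lin_pow_lift[OF fcomplex_aug[OF F] fres_aug[OF Q] this]
  obtain a0 where a0: "lin R (?F 0) (?Q 0) a0" "\<And>x. x \<in> carrier (?F 0) \<Longrightarrow> e' (a0 x) = e x"
    by metis
  have G0: "Good 0 a0"
    unfolding Good_def
  proof (intro conjI ballI a0(1))
    fix x assume x: "x \<in> carrier (?F (Suc 0))"
    note y = lin_closed[OF fcomplex_diff[OF F] x]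
    show "a0 (c 0 x) \<in> d 0 ` carrier (?Q (Suc 0))"
      by (rule fres_exact0[OF Q lin_closed[OF a0(1) y]])
        (simp add: a0(2)[OF y] fcomplex_aug_diff[OF F x])
  qed
  have ex: "\<exists>b. Good (Suc i) b \<and> (\<forall>x\<in>carrier (?F (Suc i)). d i (b x) = a (c i x))"
    if g: "Good i a" for i a
  proof -
    note a = g[unfolded Good_def, THEN conjunct1]
    have u: "lin R (?F (Suc i)) (?Q i) (\<lambda>x. a (c i x))" by (rule lin_comp[OF a fcomplex_diff[OF F]])
    have "(\<lambda>x. a (c i x)) ` carrier (?F (Suc i)) \<subseteq> d i ` carrier (?Q (Suc i))"
      using g by (auto simp: Good_def)
    from lin_pow_lift[OF u fres_diff[OF Q] this] obtain b
      where b: "lin R (?F (Suc i)) (?Q (Suc i)) b"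
        "\<And>x. x \<in> carrier (?F (Suc i)) \<Longrightarrow> d i (b x) = a (c i x)" by metis
    have "b (c (Suc i) x) \<in> d (Suc i) ` carrier (?Q (Suc (Suc i)))"
      if x: "x \<in> carrier (?F (Suc (Suc i)))" for x
    proof -
      note y = lin_closed[OF fcomplex_diff[OF F] x]
      show ?thesis
        by (rule fres_exact[OF Q lin_closed[OF b(1) y]])
          (simp add: b(2)[OF y] fcomplex_diff_diff[OF F x] lin_zero[OF a])
    qed
    then show ?thesis using b by (auto simp: Good_def)
  qed
  have "\<exists>\<alpha>. \<forall>i. (Good i (\<alpha> i) \<and> (i = 0 \<longrightarrow> \<alpha> i = a0)) \<and>
      (\<forall>x\<in>carrier (?F (Suc i)). d i (\<alpha> (Suc i) x) = \<alpha> i (c i x))"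
  proof (rule dependent_nat_choice)
    show "\<exists>a. Good 0 a \<and> (0 = (0::nat) \<longrightarrow> a = a0)" using G0 by blast
    show "\<exists>b. (Good (Suc i) b \<and> (Suc i = 0 \<longrightarrow> b = a0)) \<and>
        (\<forall>x\<in>carrier (?F (Suc i)). d i (b x) = a (c i x))"
      if "Good i a \<and> (i = 0 \<longrightarrow> a = a0)" for a i
      using ex[of i a] that by blast
  qed
  then obtain \<alpha> where \<alpha>: "\<And>i. Good i (\<alpha> i)" "\<alpha> 0 = a0"
    "\<And>i x. x \<in> carrier (?F (Suc i)) \<Longrightarrow> d i (\<alpha> (Suc i) x) = \<alpha> i (c i x)" by blast
  show thesis
    by (rule that[of \<alpha>]) (use \<alpha> a0(2) in \<open>auto simp: Good_def\<close>)
qed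

lemma (in abelian_group) uminus_zero: "\<ominus> \<zero> = \<zero>"
  by (rule minus_equality) simp_all

lemma (in abelian_group) minus_eq_zero_iff:
  "x \<in> carrier G \<Longrightarrow> y \<in> carrier G \<Longrightarrow> x \<ominus> y = \<zero> \<longleftrightarrow> x = y"
  by (metis a_minus_def add.inv_closed local.minus_minus minus_equality r_neg)

lemma (in abelian_group) minus_add_cancel':
  "x \<in> carrier G \<Longrightarrow> y \<in> carrier G \<Longrightarrow> (x \<ominus> y) \<oplus> y = x"
  by (simp add: a_minus_def a_assoc l_neg)

lemma (in abelian_group) add_minus_cancel':
  "x \<in> carrier G \<Longrightarrow> y \<in> carrier G \<Longrightarrow> (x \<oplus> y) \<ominus> y = x"
  by (simp add: a_minus_def a_assoc r_neg)

text \<open>What the homotopy built so far does not account for in \<open>\<theta>\<close> minus the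
  identity is a cycle, hence a boundary, and lifts through the next differential because the terms
  are free. The identity is recorded in degrees at least 1, those in which vanishing of Ext and Tor
  is transferred.\<close>

lemma chain_homotopy:
  assumes F: "fres R M n d e"
    and \<theta>: "\<And>i. lin R (pow_module R (n i)) (pow_module R (n i)) (\<theta> i)"
    and \<theta>0: "\<And>x. x \<in> carrier (pow_module R (n 0)) \<Longrightarrow> e (\<theta> 0 x) = e x"
    and \<theta>d: "\<And>i x. x \<in> carrier (pow_module R (n (Suc i))) \<Longrightarrow> d i (\<theta> (Suc i) x) = \<theta> i (d i x)"
  obtains s where "\<And>i. lin R (pow_module R (n i)) (pow_module R (n (Suc i))) (s i)"
    "\<And>i x. x \<in> carrier (pow_module R (n (Suc i))) \<Longrightarrow>
      \<theta> (Suc i) x = (x \<oplus>\<^bsub>pow_module R (n (Suc i))\<^esub> s i (d i x))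
        \<oplus>\<^bsub>pow_module R (n (Suc i))\<^esub> d (Suc i) (s (Suc i) x)"
proof -
  let ?F = "\<lambda>i. pow_module R (n i)"
  note D = fres_diff[OF F] and C = fres_fcomplex[OF F] and E = fres_aug[OF F]
  interpret M: module R M by (rule lin_cod[OF E])
  have P: "module R (?F i)" for i by (rule free_module_is_module[OF M.is_cring])
  have AG: "abelian_group (?F i)" for i using P by (rule module.axioms)
  \<comment> \<open>The part of \<open>\<theta> - id\<close> in degree \<open>Suc i\<close> that is
    left once the homotopy component \<open>a\<close> in degree \<open>i\<close> is taken off; the
    next component must lift it.\<close>
  define u where "u i a x = \<theta> (Suc i) x \<ominus>\<^bsub>?F (Suc i)\<^esub> (x \<oplus>\<^bsub>?F (Suc i)\<^esub> a (d i x))" for i a x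
  have ul: "lin R (?F (Suc i)) (?F (Suc i)) (u i a)" if "lin R (?F i) (?F (Suc i)) a" for i a
    unfolding u_def by (rule lin_minus[OF \<theta> lin_plus[OF lin_id[OF P] lin_comp[OF that D]]])
  have im: "u i a ` carrier (?F (Suc i)) \<subseteq> d (Suc i) ` carrier (?F (Suc (Suc i)))"
    if a: "lin R (?F i) (?F (Suc i)) a"
      and eq: "\<And>x. x \<in> carrier (?F (Suc i)) \<Longrightarrow>
        \<theta> i (d i x) = d i x \<oplus>\<^bsub>?F i\<^esub> d i (a (d i x))" for i a
  proof (rule image_subsetI)
    fix x assume x: "x \<in> carrier (?F (Suc i))"
    interpret S: module R "?F (Suc i)" by (rule P)
    interpret Z: module R "?F i" by (rule P)
    note dx = lin_closed[OF D x]
    note ax = lin_closed[OF a dx]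
    have "d i (u i a x) = \<zero>\<^bsub>?F i\<^esub>"
      using eq[OF x] x dx ax lin_closed[OF D] lin_closed[OF \<theta>]
      by (simp add: u_def lin_diff[OF D] lin_add[OF D] \<theta>d Z.minus_eq_zero_iff)
    then show "u i a x \<in> d (Suc i) ` carrier (?F (Suc (Suc i)))"
      by (rule fres_exact[OF F lin_closed[OF ul[OF a] x]])
  qed
  \<comment> \<open>The homotopy identity in degree \<open>i\<close> evaluated at boundaries only.
    There the term passing through the lower differential vanishes, so degree 0 has the same form as
    the others.\<close>
  define Good where "Good i a \<longleftrightarrow> lin R (?F i) (?F (Suc i)) a \<and>
    (\<forall>x\<in>carrier (?F (Suc i)). \<theta> i (d i x) = d i x \<oplus>\<^bsub>?F i\<^esub> d i (a (d i x)))" for i a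
  have ex: "\<exists>b. Good (Suc i) b \<and> (\<forall>x\<in>carrier (?F (Suc i)). d (Suc i) (b x) = u i a x)"
    if g: "Good i a" for i a
  proof -
    note a = g[unfolded Good_def, THEN conjunct1]
    interpret S: module R "?F (Suc i)" by (rule P)
    obtain b where b: "lin R (?F (Suc i)) (?F (Suc (Suc i))) b"
        "\<And>x. x \<in> carrier (?F (Suc i)) \<Longrightarrow> d (Suc i) (b x) = u i a x"
      using lin_pow_lift[OF ul[OF a] D im[OF a]] g[unfolded Good_def] by metis
    have "\<theta> (Suc i) (d (Suc i) x) = d (Suc i) x \<oplus>\<^bsub>?F (Suc i)\<^esub> d (Suc i) (b (d (Suc i) x))"
      if x: "x \<in> carrier (?F (Suc (Suc i)))" for x
    proof -
      note dx = lin_closed[OF D x]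
      show ?thesis
        unfolding b(2)[OF dx] u_def fcomplex_diff_diff[OF C x] lin_zero[OF a]
        using dx lin_closed[OF \<theta> dx]
        by (simp add: S.minus_add_cancel' S.a_comm[of "d (Suc i) x"])
    qed
    then show ?thesis using b by (auto simp: Good_def)
  qed
  have "(\<lambda>x. \<theta> 0 x \<ominus>\<^bsub>?F 0\<^esub> x) ` carrier (?F 0) \<subseteq> d 0 ` carrier (?F (Suc 0))"
  proof (rule image_subsetI)
    fix x assume x: "x \<in> carrier (?F 0)"
    interpret Z: module R "?F 0" by (rule P)
    have "e (\<theta> 0 x \<ominus>\<^bsub>?F 0\<^esub> x) = \<zero>\<^bsub>M\<^esub>"
      using x \<theta>0[OF x] lin_closed[OF \<theta> x] lin_closed[OF E x]
      by (simp add: lin_diff[OF E] M.minus_eq_zero_iff)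
    then show "\<theta> 0 x \<ominus>\<^bsub>?F 0\<^esub> x \<in> d 0 ` carrier (?F (Suc 0))"
      using x lin_closed[OF \<theta> x] by (intro fres_exact0[OF F]) auto
  qed
  from lin_pow_lift[OF lin_minus[OF \<theta> lin_id[OF P]] D this]
  obtain a0 where a0: "lin R (?F 0) (?F (Suc 0)) a0"
      "\<And>x. x \<in> carrier (?F 0) \<Longrightarrow> d 0 (a0 x) = \<theta> 0 x \<ominus>\<^bsub>?F 0\<^esub> x" by metis
  have G0: "Good 0 a0"
    unfolding Good_def
  proof (intro conjI ballI a0(1))
    fix x assume x: "x \<in> carrier (?F (Suc 0))"
    interpret Z: module R "?F 0" by (rule P)
    note dx = lin_closed[OF D x]
    show "\<theta> 0 (d 0 x) = d 0 x \<oplus>\<^bsub>?F 0\<^esub> d 0 (a0 (d 0 x))"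
      unfolding a0(2)[OF dx] using dx lin_closed[OF \<theta> dx]
      by (simp add: Z.minus_add_cancel' Z.a_comm[of "d 0 x"])
  qed
  have "\<exists>s. \<forall>i. Good i (s i) \<and> (\<forall>x\<in>carrier (?F (Suc i)). d (Suc i) (s (Suc i) x) = u i (s i) x)"
    by (rule dependent_nat_choice) (use G0 in blast, use ex in blast)
  then obtain s where s: "\<And>i. Good i (s i)"
      "\<And>i x. x \<in> carrier (?F (Suc i)) \<Longrightarrow> d (Suc i) (s (Suc i) x) = u i (s i) x" by blast
  have sl: "lin R (?F i) (?F (Suc i)) (s i)" for i using s(1)[of i] by (simp add: Good_def)
  show thesis
  proof (rule that[OF sl])
    fix i x assume x: "x \<in> carrier (?F (Suc i))"
    interpret S: module R "?F (Suc i)" by (rule P)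
    note y = lin_closed[OF sl[of i] lin_closed[OF D x]]
    show "\<theta> (Suc i) x = (x \<oplus>\<^bsub>?F (Suc i)\<^esub> s i (d i x)) \<oplus>\<^bsub>?F (Suc i)\<^esub> d (Suc i) (s (Suc i) x)"
      unfolding s(2)[OF x] u_def using x y lin_closed[OF \<theta> x]
      by (simp add: S.minus_add_cancel' S.a_comm[of "x \<oplus>\<^bsub>?F (Suc i)\<^esub> s i (d i x)"])
  qed
qed

text \<open>The homotopy is recorded for \<open>\<beta>\<close> after \<open>\<alpha>\<close>: it
  compares a cycle or cocycle on the first resolution with its round trip through the second, where
  vanishing is known.\<close>

lemma fres_compare:
  assumes F: "fres R M m c e" and F': "fres R M n d e'"
  obtains \<alpha> \<beta> s where "\<And>i. lin R (pow_module R (m i)) (pow_module R (n i)) (\<alpha> i)"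
    "\<And>i. lin R (pow_module R (n i)) (pow_module R (m i)) (\<beta> i)"
    "\<And>i. lin R (pow_module R (m i)) (pow_module R (m (Suc i))) (s i)"
    "\<And>i x. x \<in> carrier (pow_module R (m (Suc i))) \<Longrightarrow> d i (\<alpha> (Suc i) x) = \<alpha> i (c i x)"
    "\<And>i x. x \<in> carrier (pow_module R (n (Suc i))) \<Longrightarrow> c i (\<beta> (Suc i) x) = \<beta> i (d i x)"
    "\<And>i x. x \<in> carrier (pow_module R (m (Suc i))) \<Longrightarrow>
      \<beta> (Suc i) (\<alpha> (Suc i) x) = (x \<oplus>\<^bsub>pow_module R (m (Suc i))\<^esub> s i (c i x))
        \<oplus>\<^bsub>pow_module R (m (Suc i))\<^esub> c (Suc i) (s (Suc i) x)"
proof -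
  obtain \<alpha> where \<alpha>: "\<And>i. lin R (pow_module R (m i)) (pow_module R (n i)) (\<alpha> i)"
    "\<And>x. x \<in> carrier (pow_module R (m 0)) \<Longrightarrow> e' (\<alpha> 0 x) = e x"
    "\<And>i x. x \<in> carrier (pow_module R (m (Suc i))) \<Longrightarrow> d i (\<alpha> (Suc i) x) = \<alpha> i (c i x)"
    by (rule chain_lift[OF fres_fcomplex[OF F] F']) (rule that)
  obtain \<beta> where \<beta>: "\<And>i. lin R (pow_module R (n i)) (pow_module R (m i)) (\<beta> i)"
    "\<And>x. x \<in> carrier (pow_module R (n 0)) \<Longrightarrow> e (\<beta> 0 x) = e' x"
    "\<And>i x. x \<in> carrier (pow_module R (n (Suc i))) \<Longrightarrow> c i (\<beta> (Suc i) x) = \<beta> i (d i x)"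
    by (rule chain_lift[OF fres_fcomplex[OF F'] F]) (rule that)
  have 1: "lin R (pow_module R (m i)) (pow_module R (m i)) (\<lambda>x. \<beta> i (\<alpha> i x))" for i
    by (rule lin_comp[OF \<beta>(1) \<alpha>(1)])
  have 2: "e (\<beta> 0 (\<alpha> 0 x)) = e x" if "x \<in> carrier (pow_module R (m 0))" for x
    using \<beta>(2)[OF lin_closed[OF \<alpha>(1) that]] \<alpha>(2)[OF that] by simp
  have 3: "c i (\<beta> (Suc i) (\<alpha> (Suc i) x)) = \<beta> i (\<alpha> i (c i x))"
    if "x \<in> carrier (pow_module R (m (Suc i)))" for i x
    using \<beta>(3)[OF lin_closed[OF \<alpha>(1) that]] \<alpha>(3)[OF that] by simp
  obtain s where s: "\<And>i. lin R (pow_module R (m i)) (pow_module R (m (Suc i))) (s i)"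
    "\<And>i x. x \<in> carrier (pow_module R (m (Suc i))) \<Longrightarrow>
      \<beta> (Suc i) (\<alpha> (Suc i) x) = (x \<oplus>\<^bsub>pow_module R (m (Suc i))\<^esub> s i (c i x))
        \<oplus>\<^bsub>pow_module R (m (Suc i))\<^esub> c (Suc i) (s (Suc i) x)"
    using chain_homotopy[OF F 1 2 3] by blast
  show thesis by (rule that[OF \<alpha>(1) \<beta>(1) s(1) \<alpha>(3) \<beta>(3) s(2)])
qed


section \<open>Vanishing of Ext along a resolution\<close>

text \<open>Vanishing of \<open>Ext\<^sup>i\<^sup>+\<^sup>1(M, X)\<close>, computed from the resolution with ranks \<open>n\<close> and differentials \<open>d\<close>.\<close>

definition ext_vanish ::
  "('a, 'r) ring_scheme \<Rightarrow> ('a, 'x, 'z) module_scheme \<Rightarrow> (nat \<Rightarrow> nat)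
    \<Rightarrow> (nat \<Rightarrow> (nat \<Rightarrow> 'a) \<Rightarrow> (nat \<Rightarrow> 'a)) \<Rightarrow> nat \<Rightarrow> bool"
  where "ext_vanish R X n d i \<longleftrightarrow>
    (\<forall>g. lin R (pow_module R (n (Suc i))) X g \<longrightarrow>
      (\<forall>x\<in>carrier (pow_module R (n (Suc (Suc i)))). g (d (Suc i) x) = \<zero>\<^bsub>X\<^esub>) \<longrightarrow>
      (\<exists>h. lin R (pow_module R (n i)) X h \<and>
        (\<forall>x\<in>carrier (pow_module R (n (Suc i))). g x = h (d i x))))"

lemma ext_vanishD:
  assumes "ext_vanish R X n d i" "lin R (pow_module R (n (Suc i))) X g"
    "\<And>x. x \<in> carrier (pow_module R (n (Suc (Suc i)))) \<Longrightarrow> g (d (Suc i) x) = \<zero>\<^bsub>X\<^esub>"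
  obtains h where "lin R (pow_module R (n i)) X h"
    "\<And>x. x \<in> carrier (pow_module R (n (Suc i))) \<Longrightarrow> g x = h (d i x)"
  using assms unfolding ext_vanish_def by blast

lemma ext_vanishI:
  assumes "\<And>g. lin R (pow_module R (n (Suc i))) X g \<Longrightarrow>
      (\<And>x. x \<in> carrier (pow_module R (n (Suc (Suc i)))) \<Longrightarrow> g (d (Suc i) x) = \<zero>\<^bsub>X\<^esub>) \<Longrightarrow>
      \<exists>h. lin R (pow_module R (n i)) X h \<and>
        (\<forall>x\<in>carrier (pow_module R (n (Suc i))). g x = h (d i x))"
  shows "ext_vanish R X n d i"
  using assms unfolding ext_vanish_def by blast

text \<open>For a cocycle \<open>g\<close>, the composite \<open>g \<beta>\<close> is a cocycle on
  the second resolution, so it equals \<open>k d\<close> for some \<open>k\<close>. Evaluating at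
  \<open>\<alpha> x\<close>, the homotopy gives \<open>g = (k \<alpha> - g s) c\<close>, as its
  other term is killed by the cocycle condition.\<close>

lemma ext_vanish_transfer:
  assumes F: "fres R M m c e" and F': "fres R M n d e'" and v: "ext_vanish R X n d i"
  shows "ext_vanish R X m c i"
proof (rule ext_vanishI)
  fix g assume g: "lin R (pow_module R (m (Suc i))) X g"
    and gc: "\<And>x. x \<in> carrier (pow_module R (m (Suc (Suc i)))) \<Longrightarrow> g (c (Suc i) x) = \<zero>\<^bsub>X\<^esub>"
  interpret X: module R X by (rule lin_cod[OF g])
  interpret P: module R "pow_module R (m (Suc i))" by (rule lin_dom[OF g])
  obtain \<alpha> \<beta> s where \<alpha>: "\<And>i. lin R (pow_module R (m i)) (pow_module R (n i)) (\<alpha> i)"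
    and \<beta>: "\<And>i. lin R (pow_module R (n i)) (pow_module R (m i)) (\<beta> i)"
    and s: "\<And>i. lin R (pow_module R (m i)) (pow_module R (m (Suc i))) (s i)"
    and \<alpha>d: "\<And>i x. x \<in> carrier (pow_module R (m (Suc i))) \<Longrightarrow> d i (\<alpha> (Suc i) x) = \<alpha> i (c i x)"
    and \<beta>d: "\<And>i x. x \<in> carrier (pow_module R (n (Suc i))) \<Longrightarrow> c i (\<beta> (Suc i) x) = \<beta> i (d i x)"
    and h: "\<And>i x. x \<in> carrier (pow_module R (m (Suc i))) \<Longrightarrow>
      \<beta> (Suc i) (\<alpha> (Suc i) x) = (x \<oplus>\<^bsub>pow_module R (m (Suc i))\<^esub> s i (c i x))
        \<oplus>\<^bsub>pow_module R (m (Suc i))\<^esub> c (Suc i) (s (Suc i) x)"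
    using fres_compare[OF F F'] by blast
  note C = fres_diff[OF F]
  have "g (\<beta> (Suc i) (d (Suc i) x)) = \<zero>\<^bsub>X\<^esub>" if "x \<in> carrier (pow_module R (n (Suc (Suc i))))" for x
    using gc[OF lin_closed[OF \<beta> that]] \<beta>d[OF that] by simp
  then obtain k where k: "lin R (pow_module R (n i)) X k"
      "\<And>x. x \<in> carrier (pow_module R (n (Suc i))) \<Longrightarrow> g (\<beta> (Suc i) x) = k (d i x)"
    using ext_vanishD[OF v lin_comp[OF g \<beta>]] by metis
  have "g x = k (\<alpha> i (c i x)) \<ominus>\<^bsub>X\<^esub> g (s i (c i x))" if x: "x \<in> carrier (pow_module R (m (Suc i)))" for x
  proof -
    note cx = lin_closed[OF s lin_closed[OF C x]] and sx = lin_closed[OF s x]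
    have "k (\<alpha> i (c i x)) = g (\<beta> (Suc i) (\<alpha> (Suc i) x))"
      using k(2)[OF lin_closed[OF \<alpha> x]] \<alpha>d[OF x] by simp
    also have "\<dots> = (g x \<oplus>\<^bsub>X\<^esub> g (s i (c i x))) \<oplus>\<^bsub>X\<^esub> g (c (Suc i) (s (Suc i) x))"
      using x cx lin_closed[OF C sx] by (simp add: h[OF x] lin_add[OF g])
    also have "\<dots> = g x \<oplus>\<^bsub>X\<^esub> g (s i (c i x))"
      using gc[OF sx] x cx by (simp add: lin_closed[OF g])
    finally show ?thesis using x cx by (simp add: X.add_minus_cancel' lin_closed[OF g])
  qed
  then show "\<exists>h. lin R (pow_module R (m i)) X h \<and> (\<forall>x\<in>carrier (pow_module R (m (Suc i))). g x = h (c i x))"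
    using lin_minus[OF lin_comp[OF k(1) \<alpha>[of i]] lin_comp[OF g s[of i]]] by blast
qed

text \<open>All cosets equal \<open>B\<close>, and \<open>y\<close> witnesses that \<open>x\<close>
  lies in its own coset. Such a \<open>y\<close> stands in for the subgroup structure of
  \<open>B\<close>, so cycles and boundaries need not be set up as modules first.\<close>

lemma zero_quot_module_mem:
  assumes z: "zero_module (quot_module A B)" and x: "x \<in> carrier A"
    and y: "y \<in> B" "y \<oplus>\<^bsub>A\<^esub> x = x"
  shows "x \<in> B"
proof -
  have "B +>\<^bsub>A\<^esub> x \<in> carrier (quot_module A B)" using x by (auto simp: quot_module_def A_RCOSETS_def')
  then have "B +>\<^bsub>A\<^esub> x = B" using z by (simp add: zero_module_def quot_module_def)
  moreover have "x \<in> B +>\<^bsub>A\<^esub> x" using y by (force simp: a_r_coset_def')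
  ultimately show ?thesis by simp
qed

text \<open>Unfolds \<open>Ext\<close> on its chosen resolution. Elements of
  \<open>hom_module\<close> are extensional, so the cocycle enters in restricted form; zero is a
  boundary as the image of the zero map.\<close>

lemma zero_Ext_vanish:
  assumes X: "module R X" and M: "module R M" and F: "is_free_resolution R M (free_resolution R M)"
    and z: "zero_module (Ext R M X (Suc i))"
  shows "ext_vanish R X (res_rank (free_resolution R M)) (res_diff (free_resolution R M)) i"
proof (rule ext_vanishI)
  define n d where "n = res_rank (free_resolution R M)" and "d = res_diff (free_resolution R M)"
  let ?F = "\<lambda>i. pow_module R (n i)"
  fix g assume g: "lin R (?F (Suc i)) X g"
    and gd: "\<And>x. x \<in> carrier (?F (Suc (Suc i))) \<Longrightarrow> g (d (Suc i) x) = \<zero>\<^bsub>X\<^esub>"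
  note D = fres_diff[OF is_free_resolution_fres[OF M F], folded n_def d_def]
  interpret X: module R X by (rule X)
  have P: "module R (?F i)" for i by (rule free_module_is_module[OF X.is_cring])
  interpret H: module R "hom_module R (?F (Suc i)) X" by (rule hom_module_is_module[OF P X])
  have F_simp: "res_module R (free_resolution R M) j = ?F j" for j
    by (simp add: res_module_def n_def)
  let ?g = "restrict g (carrier (?F (Suc i)))"
  have gH: "?g \<in> carrier (hom_module R (?F (Suc i)) X)"
    using lin_restrict_mod_hom[OF g] by (simp add: hom_module_def)
  have "?g \<in> Ext_diff R (free_resolution R M) X i ` carrier (hom_module R (?F i) X)"
  proof (rule zero_quot_module_mem)
    show "zero_module (quot_module ((hom_module R (?F (Suc i)) X)\<lparr>carrier :=
        a_kernel (hom_module R (?F (Suc i)) X) (hom_module R (?F (Suc (Suc i))) X)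
          (Ext_diff R (free_resolution R M) X (Suc i))\<rparr>)
        (Ext_diff R (free_resolution R M) X i ` carrier (hom_module R (?F i) X)))"
      using z by (simp add: Ext_def Ext_boundaries_def Let_def F_simp)
    have "Ext_diff R (free_resolution R M) X (Suc i) ?g = \<zero>\<^bsub>hom_module R (?F (Suc (Suc i))) X\<^esub>"
      using gH gd lin_closed[OF D[of "Suc i"]]
      by (auto simp: Ext_diff_def F_simp hom_module_def compose_def d_def[symmetric] cong: restrict_cong)
    then show "?g \<in> carrier ((hom_module R (?F (Suc i)) X)\<lparr>carrier :=
        a_kernel (hom_module R (?F (Suc i)) X) (hom_module R (?F (Suc (Suc i))) X)
          (Ext_diff R (free_resolution R M) X (Suc i))\<rparr>)"
      using gH by (simp add: mem_a_kernel)
    let ?o = "restrict (\<lambda>x. \<zero>\<^bsub>X\<^esub>) (carrier (?F i))"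
    have "?o \<in> carrier (hom_module R (?F i) X)"
      using lin_restrict_mod_hom[OF lin_const_zero[OF P X]] by (simp add: hom_module_def)
    moreover have "Ext_diff R (free_resolution R M) X i ?o = \<zero>\<^bsub>hom_module R (?F (Suc i)) X\<^esub>"
      using calculation lin_closed[OF D[of i]]
      by (auto simp: Ext_diff_def F_simp hom_module_def compose_def d_def[symmetric] cong: restrict_cong)
    ultimately show "\<zero>\<^bsub>hom_module R (?F (Suc i)) X\<^esub>
        \<in> Ext_diff R (free_resolution R M) X i ` carrier (hom_module R (?F i) X)"
      by (metis imageI)
    show "\<zero>\<^bsub>hom_module R (?F (Suc i)) X\<^esub> \<oplus>\<^bsub>(hom_module R (?F (Suc i)) X)\<lparr>carrier :=
        a_kernel (hom_module R (?F (Suc i)) X) (hom_module R (?F (Suc (Suc i))) X)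
          (Ext_diff R (free_resolution R M) X (Suc i))\<rparr>\<^esub> ?g = ?g"
      using H.l_zero[OF gH] by simp
  qed
  then obtain h where h: "h \<in> carrier (hom_module R (?F i) X)"
      "?g = Ext_diff R (free_resolution R M) X i h" by auto
  have "lin R (?F i) X h"
    using h(1) by (intro mod_hom_lin[OF P X]) (simp add: hom_module_def)
  moreover have "g x = h (d i x)" if x: "x \<in> carrier (?F (Suc i))" for x
    using fun_cong[OF h(2), of x] x h(1) by (simp add: Ext_diff_def F_simp compose_def d_def)
  ultimately show "\<exists>h. lin R (?F i) X h \<and> (\<forall>x\<in>carrier (?F (Suc i)). g x = h (d i x))" by blast
qed

section \<open>Mapping cones\<close>

text \<open>Together with \<open>fst_vec\<close> and \<open>snd_vec\<close> this realises the direct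
  sum of \<open>R\<^sup>a\<close> and \<open>R\<^sup>b\<close> on
  \<open>R\<^sup>a\<^sup>+\<^sup>b\<close>, so that the terms of a cone are again of the form
  required by \<open>fres\<close>.\<close>

definition pair_vec :: "nat \<Rightarrow> nat \<Rightarrow> (nat \<Rightarrow> 'a) \<Rightarrow> (nat \<Rightarrow> 'a) \<Rightarrow> nat \<Rightarrow> 'a"
  where "pair_vec a b x y = (\<lambda>i\<in>{..<a + b}. if i < a then x i else y (i - a))"

definition fst_vec :: "nat \<Rightarrow> (nat \<Rightarrow> 'a) \<Rightarrow> nat \<Rightarrow> 'a"
  where "fst_vec a c = (\<lambda>i\<in>{..<a}. c i)"

definition snd_vec :: "nat \<Rightarrow> nat \<Rightarrow> (nat \<Rightarrow> 'a) \<Rightarrow> nat \<Rightarrow> 'a"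
  where "snd_vec a b c = (\<lambda>i\<in>{..<b}. c (a + i))"

lemma lin_fst_vec:
  assumes R: "cring R" shows "lin R (pow_module R (a + b)) (pow_module R a) (fst_vec a)"
proof (rule linI[OF free_module_is_module[OF R] free_module_is_module[OF R]])
  interpret A: module R "pow_module R a" by (rule free_module_is_module[OF R])
  interpret S: module R "pow_module R (a + b)" by (rule free_module_is_module[OF R])
  show c: "fst_vec a x \<in> carrier (pow_module R a)" if "x \<in> carrier (pow_module R (a + b))" for x
    unfolding fst_vec_def by (rule pow_module_memI) (rule pow_module_apply(4)[OF _ that], simp)
  show "fst_vec a (x \<oplus>\<^bsub>pow_module R (a + b)\<^esub> y) = fst_vec a x \<oplus>\<^bsub>pow_module R a\<^esub> fst_vec a y"
    if "x \<in> carrier (pow_module R (a + b))" "y \<in> carrier (pow_module R (a + b))" for x y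
    by (rule pow_module_eqI[OF c[OF S.a_closed[OF that]] A.a_closed[OF c[OF that(1)] c[OF that(2)]]])
      (simp add: pow_module_apply fst_vec_def)
  show "fst_vec a (r \<odot>\<^bsub>pow_module R (a + b)\<^esub> x) = r \<odot>\<^bsub>pow_module R a\<^esub> fst_vec a x"
    if "r \<in> carrier R" "x \<in> carrier (pow_module R (a + b))" for r x
    by (rule pow_module_eqI[OF c[OF S.smult_closed[OF that]] A.smult_closed[OF that(1) c[OF that(2)]]])
      (simp add: pow_module_apply fst_vec_def)
qed

lemma lin_snd_vec:
  assumes R: "cring R" shows "lin R (pow_module R (a + b)) (pow_module R b) (snd_vec a b)"
proof (rule linI[OF free_module_is_module[OF R] free_module_is_module[OF R]])
  interpret B: module R "pow_module R b" by (rule free_module_is_module[OF R])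
  interpret S: module R "pow_module R (a + b)" by (rule free_module_is_module[OF R])
  show c: "snd_vec a b x \<in> carrier (pow_module R b)" if "x \<in> carrier (pow_module R (a + b))" for x
    unfolding snd_vec_def by (rule pow_module_memI) (rule pow_module_apply(4)[OF _ that], simp)
  show "snd_vec a b (x \<oplus>\<^bsub>pow_module R (a + b)\<^esub> y) = snd_vec a b x \<oplus>\<^bsub>pow_module R b\<^esub> snd_vec a b y"
    if "x \<in> carrier (pow_module R (a + b))" "y \<in> carrier (pow_module R (a + b))" for x y
    by (rule pow_module_eqI[OF c[OF S.a_closed[OF that]] B.a_closed[OF c[OF that(1)] c[OF that(2)]]])
      (simp add: pow_module_apply snd_vec_def)
  show "snd_vec a b (r \<odot>\<^bsub>pow_module R (a + b)\<^esub> x) = r \<odot>\<^bsub>pow_module R b\<^esub> snd_vec a b x"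
    if "r \<in> carrier R" "x \<in> carrier (pow_module R (a + b))" for r x
    by (rule pow_module_eqI[OF c[OF S.smult_closed[OF that]] B.smult_closed[OF that(1) c[OF that(2)]]])
      (simp add: pow_module_apply snd_vec_def)
qed

lemma pair_vec_closed:
  assumes "x \<in> carrier (pow_module R a)" and "y \<in> carrier (pow_module R b)"
  shows "pair_vec a b x y \<in> carrier (pow_module R (a + b))"
  unfolding pair_vec_def
  by (rule pow_module_memI) (use pow_module_apply(4)[OF _ assms(1)] pow_module_apply(4)[OF _ assms(2)] in auto)

lemma pow_module_extensional: "x \<in> carrier (pow_module R a) \<Longrightarrow> x \<in> extensional {..<a}"
  by (simp add: free_module_def PiE_def)

lemma fst_pair_vec:
  assumes "x \<in> carrier (pow_module R a)" shows "fst_vec a (pair_vec a b x y) = x"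
  by (rule extensionalityI[OF _ pow_module_extensional[OF assms]])
    (auto simp: fst_vec_def snd_vec_def pair_vec_def)

lemma snd_pair_vec:
  assumes "y \<in> carrier (pow_module R b)" shows "snd_vec a b (pair_vec a b x y) = y"
  by (rule extensionalityI[OF _ pow_module_extensional[OF assms]])
    (auto simp: fst_vec_def snd_vec_def pair_vec_def)

lemma pair_fst_snd_vec:
  assumes "c \<in> carrier (pow_module R (a + b))" shows "pair_vec a b (fst_vec a c) (snd_vec a b c) = c"
  by (rule extensionalityI[OF _ pow_module_extensional[OF assms]])
    (auto simp: fst_vec_def snd_vec_def pair_vec_def)

lemma lin_pair_vec:
  assumes f: "lin R M (pow_module R a) f" and g: "lin R M (pow_module R b) g"
  shows "lin R M (pow_module R (a + b)) (\<lambda>x. pair_vec a b (f x) (g x))"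
proof -
  interpret M: module R M by (rule lin_dom[OF f])
  interpret S: module R "pow_module R (a + b)" by (rule free_module_is_module[OF M.is_cring])
  note c = pair_vec_closed[OF lin_closed[OF f] lin_closed[OF g]]
  show ?thesis
  proof (rule linI[OF lin_dom[OF f] S.module_axioms c])
    fix x y assume xy: "x \<in> carrier M" "y \<in> carrier M"
    note xy' = M.a_closed[OF xy]
    show "pair_vec a b (f (x \<oplus>\<^bsub>M\<^esub> y)) (g (x \<oplus>\<^bsub>M\<^esub> y))
        = pair_vec a b (f x) (g x) \<oplus>\<^bsub>pow_module R (a + b)\<^esub> pair_vec a b (f y) (g y)"
      by (rule pow_module_eqI[OF c[OF xy' xy'] S.a_closed[OF c c]])
        (simp_all add: xy lin_add[OF f xy] lin_add[OF g xy] pow_module_apply pair_vec_def)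
  next
    fix r x assume rx: "r \<in> carrier R" "x \<in> carrier M"
    note rx' = M.smult_closed[OF rx]
    show "pair_vec a b (f (r \<odot>\<^bsub>M\<^esub> x)) (g (r \<odot>\<^bsub>M\<^esub> x))
        = r \<odot>\<^bsub>pow_module R (a + b)\<^esub> pair_vec a b (f x) (g x)"
      by (rule pow_module_eqI[OF c[OF rx' rx'] S.smult_closed[OF rx(1) c]])
        (simp_all add: rx lin_smult[OF f rx] lin_smult[OF g rx] pow_module_apply pair_vec_def)
  qed
qed

lemma pow_zero_eq_pair:
  assumes R: "cring R"
  shows "\<zero>\<^bsub>pow_module R (a + b)\<^esub> = pair_vec a b \<zero>\<^bsub>pow_module R a\<^esub> \<zero>\<^bsub>pow_module R b\<^esub>"
proof -
  interpret A: module R "pow_module R a" by (rule free_module_is_module[OF R])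
  interpret B: module R "pow_module R b" by (rule free_module_is_module[OF R])
  show ?thesis
    using lin_zero[OF lin_pair_vec[OF lin_id[OF A.module_axioms] lin_const_zero[OF A.module_axioms B.module_axioms]]] by simp
qed

lemma fresI:
  assumes e: "lin R (pow_module R (n 0)) M e"
    and d: "\<And>i. lin R (pow_module R (n (Suc i))) (pow_module R (n i)) (d i)"
    and surj: "carrier M \<subseteq> e ` carrier (pow_module R (n 0))"
    and ed: "\<And>c. c \<in> carrier (pow_module R (n (Suc 0))) \<Longrightarrow> e (d 0 c) = \<zero>\<^bsub>M\<^esub>"
    and dd: "\<And>i c. c \<in> carrier (pow_module R (n (Suc (Suc i)))) \<Longrightarrow>
      d i (d (Suc i) c) = \<zero>\<^bsub>pow_module R (n i)\<^esub>"
    and ex0: "\<And>c. c \<in> carrier (pow_module R (n 0)) \<Longrightarrow> e c = \<zero>\<^bsub>M\<^esub>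
      \<Longrightarrow> c \<in> d 0 ` carrier (pow_module R (n (Suc 0)))"
    and ex: "\<And>i c. c \<in> carrier (pow_module R (n (Suc i))) \<Longrightarrow> d i c = \<zero>\<^bsub>pow_module R (n i)\<^esub>
      \<Longrightarrow> c \<in> d (Suc i) ` carrier (pow_module R (n (Suc (Suc i))))"
  shows "fres R M n d e"
proof -
  have "e ` carrier (pow_module R (n 0)) = carrier M" using surj lin_closed[OF e] by auto
  moreover have "d 0 ` carrier (pow_module R (n 1)) = a_kernel (pow_module R (n 0)) M e"
    using ed ex0 lin_closed[OF d[of 0]] by (auto simp: mem_a_kernel)
  moreover have "d (Suc i) ` carrier (pow_module R (n (Suc (Suc i))))
      = a_kernel (pow_module R (n (Suc i))) (pow_module R (n i)) (d i)" for i
    using dd ex lin_closed[OF d[of "Suc i"]] by (auto simp: mem_a_kernel)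
  ultimately show ?thesis using e d by (simp add: fres_def)
qed

text \<open>For an exact sequence \<open>0 \<rightarrow> K \<rightarrow> G \<rightarrow> M \<rightarrow> 0\<close>, resolutions \<open>Q\<close> of \<open>K\<close> and \<open>P\<close> of \<open>G\<close> and a lift
  \<open>\<psi> : Q \<rightarrow> P\<close> of the inclusion, the cone with terms \<open>P\<^sub>i \<oplus> Q\<^sub>i\<^sub>-\<^sub>1\<close> resolves \<open>M\<close>, and the long exact
  Ext sequence can be read off from it.\<close>

lemma cone_resolution:
  fixes R :: "('a, 'r) ring_scheme" and G :: "('a, 'g, 'y) module_scheme"
    and M :: "('a, 'm, 'w) module_scheme" and X :: "('a, 'x, 'z) module_scheme"
  assumes p: "lin R G M p" and psurj: "p ` carrier G = carrier M"
    and P: "fres R G nP dP eP"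
    and Q: "fres R (G\<lparr>carrier := a_kernel G M p\<rparr>) nQ dQ eQ"
  obtains n d e where "fres R M n d e"
    "\<And>i. ext_vanish R X nP dP (Suc i) \<Longrightarrow> ext_vanish R X nQ dQ i
      \<Longrightarrow> ext_vanish R X n d (Suc i)"
proof -
  interpret G: module R G by (rule lin_dom[OF p])
  interpret M: module R M by (rule lin_cod[OF p])
  have R: "cring R" by (rule G.is_cring)
  have MP: "module R (pow_module R k)" for k by (rule free_module_is_module[OF R])
  have K: "submodule (a_kernel G M p) R G" by (rule lin_kernel_submodule[OF p])
  have eQ: "lin R (pow_module R (nQ 0)) G eQ"
    using lin_comp[OF lin_inclusion[OF G.module_axioms K] fres_aug[OF Q]] .
  have QC: "fcomplex R G nQ dQ eQ"
    using fres_fcomplex[OF Q] eQ by (simp add: fcomplex_def)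
  obtain \<psi> where \<psi>: "\<And>i. lin R (pow_module R (nQ i)) (pow_module R (nP i)) (\<psi> i)"
    and \<psi>0: "\<And>x. x \<in> carrier (pow_module R (nQ 0)) \<Longrightarrow> eP (\<psi> 0 x) = eQ x"
    and \<psi>d: "\<And>i x. x \<in> carrier (pow_module R (nQ (Suc i))) \<Longrightarrow> dP i (\<psi> (Suc i) x) = \<psi> i (dQ i x)"
    by (rule chain_lift[OF QC P]) (rule that)
  note dP = fres_diff[OF P] and dQ = fres_diff[OF Q] and eP = fres_aug[OF P]
    and PC = fres_fcomplex[OF P]
  define n where "n i = (case i of 0 \<Rightarrow> nP 0 | Suc j \<Rightarrow> nP (Suc j) + nQ j)" for i
  have n: "n 0 = nP 0" "n (Suc j) = nP (Suc j) + nQ j" for j by (simp_all add: n_def)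
  define f :: "nat \<Rightarrow> (nat \<Rightarrow> 'a) \<Rightarrow> nat \<Rightarrow> 'a" where "f i = fst_vec (nP (Suc i))" for i
  define s :: "nat \<Rightarrow> (nat \<Rightarrow> 'a) \<Rightarrow> nat \<Rightarrow> 'a" where "s i = snd_vec (nP (Suc i)) (nQ i)" for i
  define pr :: "nat \<Rightarrow> (nat \<Rightarrow> 'a) \<Rightarrow> (nat \<Rightarrow> 'a) \<Rightarrow> nat \<Rightarrow> 'a"
    where "pr i = pair_vec (nP (Suc i)) (nQ i)" for i
  have f: "lin R (pow_module R (n (Suc i))) (pow_module R (nP (Suc i))) (f i)" for i
    unfolding f_def n by (rule lin_fst_vec[OF R])
  have s: "lin R (pow_module R (n (Suc i))) (pow_module R (nQ i)) (s i)" for i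
    unfolding s_def n by (rule lin_snd_vec[OF R])
  have pr: "lin R Y (pow_module R (n (Suc i))) (\<lambda>x. pr i (a x) (b x))"
    if "lin R Y (pow_module R (nP (Suc i))) a" "lin R Y (pow_module R (nQ i)) b" 
    for Y :: "('a, nat \<Rightarrow> 'a) module" and a b i
    unfolding pr_def n by (rule lin_pair_vec[OF that])
  have prc: "pr i x y \<in> carrier (pow_module R (n (Suc i)))"
    if "x \<in> carrier (pow_module R (nP (Suc i)))" "y \<in> carrier (pow_module R (nQ i))" for i x y
    unfolding pr_def n by (rule pair_vec_closed[OF that])
  have fpr: "f i (pr i x y) = x" if "x \<in> carrier (pow_module R (nP (Suc i)))" for i x y
    unfolding f_def pr_def by (rule fst_pair_vec[OF that])
  have spr: "s i (pr i x y) = y" if "y \<in> carrier (pow_module R (nQ i))" for i x y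
    unfolding s_def pr_def by (rule snd_pair_vec[OF that])
  have prfs: "pr i (f i c) (s i c) = c" if "c \<in> carrier (pow_module R (n (Suc i)))" for i c
    unfolding f_def s_def pr_def using that unfolding n by (rule pair_fst_snd_vec)
  have pr0: "pr i \<zero>\<^bsub>pow_module R (nP (Suc i))\<^esub> \<zero>\<^bsub>pow_module R (nQ i)\<^esub> = \<zero>\<^bsub>pow_module R (n (Suc i))\<^esub>" for i
    unfolding pr_def n by (rule pow_zero_eq_pair[OF R, symmetric])
  \<comment> \<open>\<open>up\<close> and \<open>dn\<close> are the components of the cone
    differential (x, y) -> (dP x + psi y, - dQ y); the sign makes the two terms with psi cancel in
    the square. Degree 0 is \<open>P\<close> in degree 0 alone, so \<open>d 0\<close> is just
    \<open>up 0\<close>.\<close>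
  define up where "up i c = dP i (f i c) \<oplus>\<^bsub>pow_module R (nP i)\<^esub> \<psi> i (s i c)" for i c
  have up: "lin R (pow_module R (n (Suc i))) (pow_module R (nP i)) (up i)" for i
    using lin_plus[OF lin_comp[OF dP f] lin_comp[OF \<psi> s]] by (simp add: up_def[abs_def])
  define dn where "dn i c = \<ominus>\<^bsub>pow_module R (nQ i)\<^esub> dQ i (s (Suc i) c)" for i c
  have dn: "lin R (pow_module R (n (Suc (Suc i)))) (pow_module R (nQ i)) (dn i)" for i
    using lin_uminus[OF lin_comp[OF dQ s]] by (simp add: dn_def[abs_def])
  define d where "d i = (case i of 0 \<Rightarrow> up 0 | Suc j \<Rightarrow> (\<lambda>c. pr j (up (Suc j) c) (dn j c)))" for i
  have d0: "d 0 = up 0" and dS: "d (Suc j) = (\<lambda>c. pr j (up (Suc j) c) (dn j c))" for j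
    by (simp_all add: d_def)
  have d: "lin R (pow_module R (n (Suc i))) (pow_module R (n i)) (d i)" for i
  proof (cases i)
    case 0 then show ?thesis using up[of 0] by (simp add: d0 n(1))
  next
    case (Suc j) then show ?thesis using pr[OF up dn] by (simp add: dS)
  qed
  have updS: "up i (d (Suc i) c) = \<zero>\<^bsub>pow_module R (nP i)\<^esub>"
    and sdS: "s i (d (Suc i) c) = dn i c"
    if c: "c \<in> carrier (pow_module R (n (Suc (Suc i))))" for i c
  proof -
    interpret Z: module R "pow_module R (nP i)" by (rule MP)
    note fc = lin_closed[OF f c] and sc = lin_closed[OF s c]
    note upc = lin_closed[OF up c] and dnc = lin_closed[OF dn c]
    have "up i (d (Suc i) c) = dP i (up (Suc i) c) \<oplus>\<^bsub>pow_module R (nP i)\<^esub> \<psi> i (dn i c)"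
      by (simp add: up_def[of i] dS fpr[OF upc] spr[OF dnc])
    also have "dP i (up (Suc i) c) = \<psi> i (dQ i (s (Suc i) c))"
      using lin_closed[OF dP fc] lin_closed[OF \<psi> sc] lin_closed[OF \<psi> lin_closed[OF dQ sc]]
      by (simp add: up_def[of "Suc i"] lin_add[OF dP] fcomplex_diff_diff[OF PC fc] \<psi>d[OF sc])
    also have "\<psi> i (dn i c) = \<ominus>\<^bsub>pow_module R (nP i)\<^esub> \<psi> i (dQ i (s (Suc i) c))"
      unfolding dn_def by (rule lin_neg[OF \<psi> lin_closed[OF dQ sc]])
    finally show "up i (d (Suc i) c) = \<zero>\<^bsub>pow_module R (nP i)\<^esub>"
      using lin_closed[OF \<psi> lin_closed[OF dQ sc]] by (simp add: Z.r_neg)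
    show "s i (d (Suc i) c) = dn i c" by (simp add: dS spr[OF dnc])
  qed
  \<comment> \<open>Common core of exactness in positive degrees, once the
    \<open>Q\<close>-component of \<open>c\<close> is known to be a boundary \<open>dQ q\<close>:
    adding \<open>\<psi> q\<close> turns the \<open>P\<close>-component into a cycle of
    \<open>P\<close>, hence a boundary \<open>dP x\<close>, and \<open>(x, - q)\<close> is a
    preimage. What makes the \<open>Q\<close>-component a boundary differs between the lowest degree
    and the others.\<close>
  have exc: "c \<in> d (Suc i) ` carrier (pow_module R (n (Suc (Suc i))))"
    if c: "c \<in> carrier (pow_module R (n (Suc i)))" and u: "up i c = \<zero>\<^bsub>pow_module R (nP i)\<^esub>"
      and b: "s i c \<in> dQ i ` carrier (pow_module R (nQ (Suc i)))" for i c
  proof -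
    interpret Q0: module R "pow_module R (nQ i)" by (rule MP)
    interpret Q1: module R "pow_module R (nQ (Suc i))" by (rule MP)
    interpret P1: module R "pow_module R (nP (Suc i))" by (rule MP)
    obtain q where q: "q \<in> carrier (pow_module R (nQ (Suc i)))" "s i c = dQ i q" using b by auto
    note fc = lin_closed[OF f c] and \<psi>q = lin_closed[OF \<psi> q(1)]
    have "dP i (f i c \<oplus>\<^bsub>pow_module R (nP (Suc i))\<^esub> \<psi> (Suc i) q) = \<zero>\<^bsub>pow_module R (nP i)\<^esub>"
      using u q by (simp add: lin_add[OF dP fc \<psi>q] \<psi>d up_def)
    then obtain x where x: "x \<in> carrier (pow_module R (nP (Suc (Suc i))))"
        "f i c \<oplus>\<^bsub>pow_module R (nP (Suc i))\<^esub> \<psi> (Suc i) q = dP (Suc i) x"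
      using fres_exact[OF P P1.a_closed[OF fc \<psi>q]] by auto
    note nq = Q1.a_inv_closed[OF q(1)]
    define w where "w = pr (Suc i) x (\<ominus>\<^bsub>pow_module R (nQ (Suc i))\<^esub> q)"
    have w: "w \<in> carrier (pow_module R (n (Suc (Suc i))))" unfolding w_def by (rule prc[OF x(1) nq])
    have "up (Suc i) w = f i c"
      using fc \<psi>q by (simp add: up_def w_def fpr[OF x(1)] spr[OF nq] x(2)[symmetric] lin_neg[OF \<psi> q(1)]
        P1.a_assoc P1.r_neg)
    moreover have "dn i w = s i c"
      using lin_closed[OF dQ q(1)] by (simp add: dn_def w_def spr[OF nq] lin_neg[OF dQ q(1)] q(2))
    ultimately have "d (Suc i) w = c" by (simp add: dS prfs[OF c])
    then show ?thesis using w by blast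
  qed
  define e where "e c = p (eP c)" for c
  have e: "lin R (pow_module R (n 0)) M e"
    unfolding e_def n by (rule lin_comp[OF p eP])
  have Kc: "carrier (G\<lparr>carrier := a_kernel G M p\<rparr>) = a_kernel G M p" by simp
  have eQK: "eQ x \<in> carrier G" "p (eQ x) = \<zero>\<^bsub>M\<^esub>" if "x \<in> carrier (pow_module R (nQ 0))" for x
    using lin_closed[OF fres_aug[OF Q] that] by (simp_all add: mem_a_kernel)
  have eup: "eP (up 0 c) = eQ (s 0 c)" if c: "c \<in> carrier (pow_module R (n (Suc 0)))" for c
    using lin_closed[OF dP lin_closed[OF f c]] lin_closed[OF \<psi> lin_closed[OF s c]]
      eQK(1)[OF lin_closed[OF s c]]
    by (simp add: up_def lin_add[OF eP] \<psi>0[OF lin_closed[OF s c]]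
        fcomplex_aug_diff[OF PC lin_closed[OF f c]])
  have "fres R M n d e"
  proof (rule fresI[OF e d])
    show "carrier M \<subseteq> e ` carrier (pow_module R (n 0))"
      using psurj fres_surj[OF P] unfolding e_def n by (metis image_image order_refl)
  next
    fix c assume c: "c \<in> carrier (pow_module R (n (Suc 0)))"
    show "e (d 0 c) = \<zero>\<^bsub>M\<^esub>"
      unfolding e_def d0 eup[OF c] by (rule eQK(2)[OF lin_closed[OF s c]])
  next
    fix i c assume c: "c \<in> carrier (pow_module R (n (Suc (Suc i))))"
    show "d i (d (Suc i) c) = \<zero>\<^bsub>pow_module R (n i)\<^esub>"
    proof (cases i)
      case 0
      then show ?thesis using updS[OF c] by (simp add: d0 n(1))
    next
      case (Suc j)
      note c' = c[unfolded Suc]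
      interpret Z: module R "pow_module R (nQ j)" by (rule MP)
      note sc = lin_closed[OF s c']
      have "dn j (d (Suc (Suc j)) c) = \<ominus>\<^bsub>pow_module R (nQ j)\<^esub> dQ j (dn (Suc j) c)"
        by (simp add: dn_def[of j] sdS[OF c'])
      also have "dQ j (dn (Suc j) c) = \<zero>\<^bsub>pow_module R (nQ j)\<^esub>"
        unfolding dn_def using lin_closed[OF dQ sc]
        by (simp add: lin_neg[OF dQ] fcomplex_diff_diff[OF QC sc])
      finally have "dn j (d (Suc (Suc j)) c) = \<zero>\<^bsub>pow_module R (nQ j)\<^esub>" by (simp add: Z.uminus_zero)
      then show ?thesis unfolding Suc by (subst dS) (simp add: updS[OF c'] pr0)
    qed
  next
    fix c assume c: "c \<in> carrier (pow_module R (n 0))" and ec: "e c = \<zero>\<^bsub>M\<^esub>"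
    note c' = c[unfolded n]
    interpret Z: module R "pow_module R (nP 0)" by (rule MP)
    interpret P1: module R "pow_module R (nP (Suc 0))" by (rule MP)
    have "eP c \<in> eQ ` carrier (pow_module R (nQ 0))"
      unfolding fres_surj[OF Q] Kc mem_a_kernel using lin_closed[OF eP c'] ec by (simp add: e_def)
    then obtain q where q: "q \<in> carrier (pow_module R (nQ 0))" "eP c = eQ q" by auto
    note \<psi>q = lin_closed[OF \<psi> q(1)]
    have "eP (c \<ominus>\<^bsub>pow_module R (nP 0)\<^esub> \<psi> 0 q) = \<zero>\<^bsub>G\<^esub>"
      using eQK(1)[OF q(1)] by (simp add: lin_diff[OF eP c' \<psi>q] q(2) \<psi>0[OF q(1)] G.minus_eq_zero_iff)
    then obtain x where x: "x \<in> carrier (pow_module R (nP (Suc 0)))"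
        "c \<ominus>\<^bsub>pow_module R (nP 0)\<^esub> \<psi> 0 q = dP 0 x"
      using fres_exact0[OF P Z.minus_closed[OF c' \<psi>q]] by auto
    have "d 0 (pr 0 x q) = c"
      using c' \<psi>q by (simp add: d0 up_def fpr[OF x(1)] spr[OF q(1)] x(2)[symmetric] Z.minus_add_cancel')
    then show "c \<in> d 0 ` carrier (pow_module R (n (Suc 0)))" using prc[OF x(1) q(1)] by blast
  next
    fix i c assume c: "c \<in> carrier (pow_module R (n (Suc i)))" and dc: "d i c = \<zero>\<^bsub>pow_module R (n i)\<^esub>"
    note sc = lin_closed[OF s c]
    show "c \<in> d (Suc i) ` carrier (pow_module R (n (Suc (Suc i))))"
    proof (cases i)
      case 0
      note c' = c[unfolded 0]
      have u: "up 0 c = \<zero>\<^bsub>pow_module R (nP 0)\<^esub>" using dc by (simp add: 0 d0 n(1))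
      have "eQ (s 0 c) = \<zero>\<^bsub>G\<^esub>" using eup[OF c'] by (simp add: u lin_zero[OF eP])
      then have "s 0 c \<in> dQ 0 ` carrier (pow_module R (nQ (Suc 0)))"
        using fres_exact0[OF Q lin_closed[OF s c']] by simp
      then show ?thesis unfolding 0 by (rule exc[OF c' u])
    next
      case (Suc j)
      note c' = c[unfolded Suc]
      interpret Z: module R "pow_module R (nQ j)" by (rule MP)
      interpret ZP: module R "pow_module R (nP (Suc j))" by (rule MP)
      have dc': "pr j (up (Suc j) c) (dn j c)
          = pr j \<zero>\<^bsub>pow_module R (nP (Suc j))\<^esub> \<zero>\<^bsub>pow_module R (nQ j)\<^esub>"
        unfolding pr0 using dc by (simp add: Suc dS)
      have u: "up (Suc j) c = \<zero>\<^bsub>pow_module R (nP (Suc j))\<^esub>"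
        using arg_cong[OF dc', of "f j"] by (simp add: fpr lin_closed[OF up c'])
      have "dn j c = \<zero>\<^bsub>pow_module R (nQ j)\<^esub>"
        using arg_cong[OF dc', of "s j"] by (simp add: spr lin_closed[OF dn c'])
      then have "dQ j (s (Suc j) c) = \<zero>\<^bsub>pow_module R (nQ j)\<^esub>"
        using lin_closed[OF dQ lin_closed[OF s c']] unfolding dn_def
        by (metis Z.minus_minus Z.uminus_zero)
      then have "s (Suc j) c \<in> dQ (Suc j) ` carrier (pow_module R (nQ (Suc (Suc j))))"
        by (rule fres_exact[OF Q lin_closed[OF s c']])
      then show ?thesis unfolding Suc by (rule exc[OF c' u])
    qed
  qed
  \<comment> \<open>The middle of Ext^(i+1)(K,X) -> Ext^(i+2)(M,X) -> Ext^(i+2)(G,X), where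
    \<open>K\<close> is the kernel of \<open>p\<close>; index j of \<open>ext_vanish\<close> stands
    for Ext^(j+1), and \<open>Q\<close> sits one degree higher in the cone.\<close>
  moreover have "ext_vanish R X n d (Suc i)"
    if vP: "ext_vanish R X nP dP (Suc i)" and vQ: "ext_vanish R X nQ dQ i" for i
  proof (rule ext_vanishI)
    fix g assume g: "lin R (pow_module R (n (Suc (Suc i)))) X g"
      and gd: "\<And>x. x \<in> carrier (pow_module R (n (Suc (Suc (Suc i))))) \<Longrightarrow> g (d (Suc (Suc i)) x) = \<zero>\<^bsub>X\<^esub>"
    interpret X: module R X by (rule lin_cod[OF g])
    let ?z = "\<lambda>k. \<zero>\<^bsub>pow_module R k\<^esub>"
    interpret P2: module R "pow_module R (nP (Suc (Suc i)))" by (rule MP)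
    interpret Q1: module R "pow_module R (nQ (Suc i))" by (rule MP)
    interpret P3: module R "pow_module R (nP (Suc (Suc (Suc i))))" by (rule MP)
    interpret Q2: module R "pow_module R (nQ (Suc (Suc i)))" by (rule MP)
    define gP where "gP x = g (pr (Suc i) x (?z (nQ (Suc i))))" for x
    define gQ where "gQ y = g (pr (Suc i) (?z (nP (Suc (Suc i)))) y)" for y
    have gP: "lin R (pow_module R (nP (Suc (Suc i)))) X gP"
      unfolding gP_def[abs_def] by (rule lin_comp[OF g pr[OF lin_id[OF MP] lin_const_zero[OF MP MP]]])
    have gQ: "lin R (pow_module R (nQ (Suc i))) X gQ"
      unfolding gQ_def[abs_def] by (rule lin_comp[OF g pr[OF lin_const_zero[OF MP MP] lin_id[OF MP]]])
    have gsum: "g (pr (Suc i) x y) = gP x \<oplus>\<^bsub>X\<^esub> gQ y"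
      if x: "x \<in> carrier (pow_module R (nP (Suc (Suc i))))"
        and y: "y \<in> carrier (pow_module R (nQ (Suc i)))" for x y
    proof -
      let ?C = "pow_module R (n (Suc (Suc i)))"
      interpret C: module R ?C by (rule MP)
      have cx: "pr (Suc i) x (?z (nQ (Suc i))) \<in> carrier ?C" and cy: "pr (Suc i) (?z (nP (Suc (Suc i)))) y \<in> carrier ?C"
        using x y by (auto intro: prc)
      have "pr (Suc i) x (?z (nQ (Suc i))) \<oplus>\<^bsub>?C\<^esub> pr (Suc i) (?z (nP (Suc (Suc i)))) y = pr (Suc i) x y"
        using prfs[of "pr (Suc i) x (?z (nQ (Suc i))) \<oplus>\<^bsub>?C\<^esub> pr (Suc i) (?z (nP (Suc (Suc i)))) y" "Suc i"] x y cx cy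
        by (simp add: lin_add[OF f] lin_add[OF s] fpr spr)
      then show ?thesis using lin_add[OF g cx cy] by (simp add: gP_def gQ_def)
    qed
    have gdS: "gP (up (Suc (Suc i)) c) \<oplus>\<^bsub>X\<^esub> gQ (dn (Suc i) c) = \<zero>\<^bsub>X\<^esub>"
      if c: "c \<in> carrier (pow_module R (n (Suc (Suc (Suc i)))))" for c
      using gd[OF c] gsum[OF lin_closed[OF up c] lin_closed[OF dn c]] by (simp add: dS)
    have gPd: "gP (dP (Suc (Suc i)) x) = \<zero>\<^bsub>X\<^esub>" if x: "x \<in> carrier (pow_module R (nP (Suc (Suc (Suc i)))))" for x
      using gdS[OF prc[OF x Q2.zero_closed]] lin_closed[OF dP x] lin_closed[OF gP]
      by (simp add: up_def dn_def fpr[OF x] spr[OF Q2.zero_closed] lin_zero[OF \<psi>] lin_zero[OF dQ] lin_zero[OF gQ] Q1.uminus_zero)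
    have gPQ: "gP (\<psi> (Suc (Suc i)) y) = gQ (dQ (Suc i) y)" if y: "y \<in> carrier (pow_module R (nQ (Suc (Suc i))))" for y
    proof -
      note \<psi>y = lin_closed[OF \<psi> y] and dy = lin_closed[OF dQ y]
      have "gP (\<psi> (Suc (Suc i)) y) \<oplus>\<^bsub>X\<^esub> \<ominus>\<^bsub>X\<^esub> gQ (dQ (Suc i) y) = \<zero>\<^bsub>X\<^esub>"
        using gdS[OF prc[OF P3.zero_closed y]] \<psi>y dy
        by (simp add: up_def dn_def fpr[OF P3.zero_closed] spr[OF y] lin_zero[OF dP] lin_neg[OF gQ])
      then show ?thesis
        using lin_closed[OF gP \<psi>y] lin_closed[OF gQ dy] X.minus_eq_zero_iff by (simp add: a_minus_def)
    qed
    obtain h where h: "lin R (pow_module R (nP (Suc i))) X h"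
        "\<And>x. x \<in> carrier (pow_module R (nP (Suc (Suc i)))) \<Longrightarrow> gP x = h (dP (Suc i) x)"
      using ext_vanishD[OF vP gP gPd] by metis
    \<comment> \<open>With \<open>h\<close> accounting for \<open>g\<close> on the
      \<open>P\<close>-summand, its error on the \<open>Q\<close>-summand is a cocycle of
      \<open>Q\<close>. Writing this error as \<open>k\<close> after \<open>dQ\<close> gives the
      correction; the sign in \<open>dn\<close> makes it enter with the right sign.\<close>
    have "h (\<psi> (Suc i) (dQ (Suc i) y)) \<ominus>\<^bsub>X\<^esub> gQ (dQ (Suc i) y) = \<zero>\<^bsub>X\<^esub>"
      if y: "y \<in> carrier (pow_module R (nQ (Suc (Suc i))))" for y
      using h(2)[OF lin_closed[OF \<psi> y]] \<psi>d[OF y] gPQ[OF y] lin_closed[OF gQ lin_closed[OF dQ y]]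
      by (simp add: X.minus_eq_zero_iff)
    then obtain k where k: "lin R (pow_module R (nQ i)) X k"
        "\<And>x. x \<in> carrier (pow_module R (nQ (Suc i))) \<Longrightarrow> h (\<psi> (Suc i) x) \<ominus>\<^bsub>X\<^esub> gQ x = k (dQ i x)"
      using ext_vanishD[OF vQ lin_minus[OF lin_comp[OF h(1) \<psi>] gQ]] by metis
    have "g c = h (f i (d (Suc i) c)) \<oplus>\<^bsub>X\<^esub> k (s i (d (Suc i) c))"
      if c: "c \<in> carrier (pow_module R (n (Suc (Suc i))))" for c
    proof -
      note fc = lin_closed[OF f c] and sc = lin_closed[OF s c]
      note dfc = lin_closed[OF dP fc] and \<psi>sc = lin_closed[OF \<psi> sc] and dsc = lin_closed[OF dQ sc]
      note cl = lin_closed[OF gP fc] lin_closed[OF gQ sc] lin_closed[OF h(1) \<psi>sc]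
      have fd: "f i (d (Suc i) c) = up (Suc i) c" by (simp add: dS fpr[OF lin_closed[OF up c]])
      have "h (f i (d (Suc i) c)) = gP (f (Suc i) c) \<oplus>\<^bsub>X\<^esub> h (\<psi> (Suc i) (s (Suc i) c))"
        unfolding fd by (simp add: up_def lin_add[OF h(1) dfc \<psi>sc] h(2)[OF fc])
      moreover have "k (s i (d (Suc i) c)) = \<ominus>\<^bsub>X\<^esub> (h (\<psi> (Suc i) (s (Suc i) c)) \<ominus>\<^bsub>X\<^esub> gQ (s (Suc i) c))"
        by (simp add: sdS[OF c] dn_def lin_neg[OF k(1) dsc] k(2)[OF sc])
      moreover have "g c = gP (f (Suc i) c) \<oplus>\<^bsub>X\<^esub> gQ (s (Suc i) c)"
        using gsum[OF fc sc] prfs[OF c] by simp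
      ultimately show ?thesis
        using cl by (simp add: a_minus_def X.minus_add X.a_assoc X.r_neg2)
    qed
    then show "\<exists>h. lin R (pow_module R (n (Suc i))) X h \<and>
        (\<forall>x\<in>carrier (pow_module R (n (Suc (Suc i)))). g x = h (d (Suc i) x))"
      using lin_plus[OF lin_comp[OF h(1) f[of i]] lin_comp[OF k(1) s[of i]]] by blast
  qed
  ultimately show thesis by (rule that)
qed

section \<open>Modules of finite Gorenstein dimension\<close>

text \<open>Starts the descent in \<open>finite_Gdim_ext_vanish\<close>, where the last image is
  zero.\<close>

lemma zero_module_fres:
  fixes R :: "('a, 'r) ring_scheme"
  assumes Z: "module R Z" and zero: "zero_module Z" and X: "module R X"
  obtains n d e where "fres R Z n d e" "\<And>i. ext_vanish R X n d i"
proof -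
  interpret Z: module R Z by fact
  let ?P = "pow_module R 0"
  have P: "module R ?P" by (rule free_module_is_module[OF Z.is_cring])
  interpret P: module R ?P by (rule P)
  have c: "c = \<zero>\<^bsub>?P\<^esub>" if "c \<in> carrier ?P" for c
    by (rule pow_module_eqI[OF that P.zero_closed]) simp
  define d :: "nat \<Rightarrow> (nat \<Rightarrow> 'a) \<Rightarrow> nat \<Rightarrow> 'a" where "d i x = \<zero>\<^bsub>?P\<^esub>" for i x
  have d: "lin R ?P ?P (d i)" for i unfolding d_def[abs_def] by (rule lin_const_zero[OF P P])
  have im: "c \<in> d i ` carrier ?P" if "c \<in> carrier ?P" for c i
    using c[OF that] that by (auto simp: d_def)
  have "fres R Z (\<lambda>_. 0) d (\<lambda>_. \<zero>\<^bsub>Z\<^esub>)"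
  proof (rule fresI[OF lin_const_zero[OF P Z] d _ refl _ im im])
    show "carrier Z \<subseteq> (\<lambda>_. \<zero>\<^bsub>Z\<^esub>) ` carrier ?P"
      using zero P.zero_closed by (auto simp: zero_module_def)
  qed (simp add: d_def)
  moreover have "ext_vanish R X (\<lambda>_. 0) d i" for i
  proof (rule ext_vanishI)
    fix g assume g: "lin R ?P X g"
    have "g x = \<zero>\<^bsub>X\<^esub>" if "x \<in> carrier ?P" for x using c[OF that] lin_zero[OF g] by simp
    then show "\<exists>h. lin R ?P X h \<and> (\<forall>x\<in>carrier ?P. g x = h (d i x))"
      using lin_const_zero[OF P X] by (intro exI[of _ "\<lambda>_. \<zero>\<^bsub>X\<^esub>"]) simp
  qed
  ultimately show thesis by (rule that)
qed

text \<open>Dimension shifting along 0 -> Z (j+1) -> G (j+1) -> Z j -> 0 down from the zero module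
  \<open>Z N\<close>, and finally along 0 -> Z 0 -> G 0 -> M -> 0. The vanishing holds for the
  resolution assembled from cones; \<open>ext_vanish_transfer\<close> takes it elsewhere.\<close>

lemma finite_Gdim_ext_vanish:
  fixes R :: "('a, 'r) ring_scheme" and M :: "('a, 'm, 'w) module_scheme"
  assumes loc: "local_ring R" and noeth: "noetherian_ring R"
    and M: "module R M" and fin: "finite_Gdim R M"
  obtains n d e N where "fres R M n d e" "\<And>i. N \<le> i \<Longrightarrow> ext_vanish R (self_module R) n d i"
proof -
  interpret M: module R M by fact
  have S: "module R (self_module R)" by (rule self_module_is_module[OF M.is_cring])
  obtain N :: nat and G :: "nat \<Rightarrow> ('a, (nat \<Rightarrow> 'a) set) module" and d e
    where res: "resolution R M G d e" and tr: "\<And>i. i \<le> N \<Longrightarrow> totally_reflexive R (G i)"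
      and zm: "\<And>i. N < i \<Longrightarrow> module R (G i) \<and> zero_module (G i)"
    using fin by (auto simp: finite_Gdim_def Gdim_le_def)
  have fg: "fin_gen_module R (G i)" if "i \<le> N" for i
    using tr[OF that] by (simp add: totally_reflexive_def)
  have G: "module R (G i)" for i
  proof (cases "i \<le> N")
    case True
    then show ?thesis using fg by (simp add: fin_gen_module_def)
  next
    case False
    then show ?thesis using zm by simp
  qed
  have P: "\<exists>n d e. fres R (G i) n d e \<and> (\<forall>j. ext_vanish R (self_module R) n d j)" for i
  proof (cases "i \<le> N")
    case True
    note F = free_resolution_is_free_resolution[OF loc noeth fg[OF True]]
    have z: "zero_module (Ext R (G i) (self_module R) (Suc j))" for j
      using tr[OF True] by (simp add: totally_reflexive_def)
    then show ?thesis
      using is_free_resolution_fres[OF G F] zero_Ext_vanish[OF S G F z]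
      by (intro exI conjI allI) assumption+
  next
    case False
    then have "zero_module (G i)" using zm by simp
    from zero_module_fres[OF G this S] show ?thesis by metis
  qed
  have mh: "e \<in> mod_hom R (G 0) M" "d i \<in> mod_hom R (G (Suc i)) (G i)" for i
    using res by (simp_all add: resolution_def)
  note e = mod_hom_lin[OF G M mh(1)] and d = mod_hom_lin[OF G G mh(2)]
  have esurj: "e ` carrier (G 0) = carrier M"
    and ek: "a_kernel (G 0) M e = d 0 ` carrier (G (Suc 0))"
    and dk: "a_kernel (G (Suc i)) (G i) (d i) = d (Suc i) ` carrier (G (Suc (Suc i)))" for i
    using res by (simp_all add: resolution_def)
  define Z where "Z j = (G j)\<lparr>carrier := d j ` carrier (G (Suc j))\<rparr>" for j
  have sub: "submodule (d j ` carrier (G (Suc j))) R (G j)" for j by (rule lin_image_submodule[OF d])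
  have Zm: "module R (Z j)" for j unfolding Z_def by (rule submodule_module[OF G sub])
  have dZ: "lin R (G (Suc j)) (Z j) (d j)" for j
    unfolding Z_def by (rule lin_into_submodule[OF d sub]) simp
  \<comment> \<open>Shrinking the codomain leaves the kernel unchanged, and by exactness it is the
    next image; this is the form in which \<open>cone_resolution\<close> expects the kernel.\<close>
  have Zk: "(G (Suc j))\<lparr>carrier := a_kernel (G (Suc j)) (Z j) (d j)\<rparr> = Z (Suc j)" for j
  proof -
    have "a_kernel (G (Suc j)) (Z j) (d j) = a_kernel (G (Suc j)) (G j) (d j)"
      by (auto simp: mem_a_kernel Z_def)
    then show ?thesis unfolding dk by (simp add: Z_def)
  qed
  \<comment> \<open>Each cone costs one degree, since the \<open>Q\<close>-part of a cone is shifted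
    by one; hence the bound \<open>k\<close> after \<open>k\<close> cones.\<close>
  have "k \<le> N \<Longrightarrow> \<exists>n d e. fres R (Z (N - k)) n d e \<and> (\<forall>i\<ge>k. ext_vanish R (self_module R) n d i)" for k
  proof (induction k)
    case 0
    have "carrier (Z N) = {\<zero>\<^bsub>Z N\<^esub>}"
      using zm[of "Suc N"] lin_zero[OF d[of N]] by (simp add: Z_def zero_module_def)
    then have "zero_module (Z N)" by (simp add: zero_module_def)
    from zero_module_fres[OF Zm this S] have "\<exists>n d e. fres R (Z N) n d e \<and> (\<forall>i. ext_vanish R (self_module R) n d i)"
      by metis
    then show ?case by auto
  next
    case (Suc k)
    define j where "j = N - Suc k"
    have j: "N - k = Suc j" using Suc.prems by (simp add: j_def)
    obtain nQ dQ eQ where Q: "fres R (Z (Suc j)) nQ dQ eQ"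
      "\<And>i. k \<le> i \<Longrightarrow> ext_vanish R (self_module R) nQ dQ i"
      using Suc by (auto simp: j)
    obtain nP dP eP where P': "fres R (G (Suc j)) nP dP eP"
      "\<And>i. ext_vanish R (self_module R) nP dP i" using P by blast
    have "d j ` carrier (G (Suc j)) = carrier (Z j)" by (simp add: Z_def)
    from cone_resolution[where X = "self_module R", OF dZ this P'(1) Q(1)[folded Zk]]
    obtain n d e where "fres R (Z j) n d e"
      "\<And>i. ext_vanish R (self_module R) nP dP (Suc i) \<Longrightarrow> ext_vanish R (self_module R) nQ dQ i
        \<Longrightarrow> ext_vanish R (self_module R) n d (Suc i)" by blast
    moreover have "ext_vanish R (self_module R) n d i" if "Suc k \<le> i" for i
      using calculation(2)[OF P'(2) Q(2), of "i - 1"] that by (cases i) auto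
    ultimately have "fres R (Z j) n d e \<and> (\<forall>i\<ge>Suc k. ext_vanish R (self_module R) n d i)"
      by blast
    then show ?case unfolding j_def by blast
  qed
  from this[of N] obtain nQ dQ eQ where Q: "fres R (Z 0) nQ dQ eQ"
    "\<And>i. N \<le> i \<Longrightarrow> ext_vanish R (self_module R) nQ dQ i" by auto
  obtain nP dP eP where P': "fres R (G 0) nP dP eP"
    "\<And>i. ext_vanish R (self_module R) nP dP i" using P by blast
  have Z0: "(G 0)\<lparr>carrier := a_kernel (G 0) M e\<rparr> = Z 0" unfolding ek Z_def ..
  from cone_resolution[where X = "self_module R", OF e esurj P'(1) Q(1)[folded Z0]]
  obtain n d e where F: "fres R M n d e"
      "\<And>i. ext_vanish R (self_module R) nP dP (Suc i) \<Longrightarrow> ext_vanish R (self_module R) nQ dQ i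
        \<Longrightarrow> ext_vanish R (self_module R) n d (Suc i)" by blast
  have "ext_vanish R (self_module R) n d i" if "Suc N \<le> i" for i
    using F(2)[OF P'(2) Q(2), of "i - 1"] that by (cases i) auto
  with F(1) show thesis by (rule that)
qed


section \<open>Tensor products and Tor\<close>

text \<open>The induction principle for tensors: an element is the coset of a finite combination of
  free generators, and the quotient map sends these generators to pure tensors.\<close>

lemma submodule_tensor_eq:
  assumes M: "module R M" and N: "module R N" and W: "submodule W R (tensor R M N)"
    and pure: "\<And>m n. m \<in> carrier M \<Longrightarrow> n \<in> carrier N \<Longrightarrow> pure_tensor R M N m n \<in> W"
  shows "W = carrier (tensor R M N)"
proof
  interpret M: module R M by fact
  note T = tensor_is_module[OF M N]
  show "W \<subseteq> carrier (tensor R M N)" by (rule submodule_subset[OF T W])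
  let ?S = "carrier M \<times> carrier N"
  let ?F = "free_module R ?S"
  let ?U = "tensor_kernel R M N"
  note FM = free_module_is_module[OF M.is_cring, of ?S]
  note U = tensor_kernel_submodule[OF M N]
  interpret F: module R ?F by (rule FM)
  interpret U: abelian_subgroup ?U ?F by (rule submodule_abelian_subgroup[OF FM U])
  have \<pi>: "lin R ?F (tensor R M N) (\<lambda>c. ?U +>\<^bsub>?F\<^esub> c)"
  proof (rule linI[OF FM T])
    show "?U +>\<^bsub>?F\<^esub> x \<in> carrier (tensor R M N)" if "x \<in> carrier ?F" for x
      using that by (auto simp: tensor_def quot_module_def A_RCOSETS_def')
    show "?U +>\<^bsub>?F\<^esub> (x \<oplus>\<^bsub>?F\<^esub> y) = (?U +>\<^bsub>?F\<^esub> x) \<oplus>\<^bsub>tensor R M N\<^esub> (?U +>\<^bsub>?F\<^esub> y)"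
      if "x \<in> carrier ?F" "y \<in> carrier ?F" for x y
      using that by (simp add: tensor_def quot_module_def U.a_rcos_sum)
    show "?U +>\<^bsub>?F\<^esub> (r \<odot>\<^bsub>?F\<^esub> x) = r \<odot>\<^bsub>tensor R M N\<^esub> (?U +>\<^bsub>?F\<^esub> x)"
      if "r \<in> carrier R" "x \<in> carrier ?F" for r x
      unfolding tensor_def by (rule quot_smult[OF FM U that, symmetric])
  qed
  show "carrier (tensor R M N) \<subseteq> W"
  proof
    fix t assume "t \<in> carrier (tensor R M N)"
    then obtain c where c: "c \<in> carrier ?F" "t = ?U +>\<^bsub>?F\<^esub> c"
      by (auto simp: tensor_def quot_module_def A_RCOSETS_def')
    define A where "A = {s \<in> ?S. c s \<noteq> \<zero>\<^bsub>R\<^esub>}"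
    have A: "finite A" "A \<subseteq> ?S" using c(1) by (auto simp: A_def free_module_def)
    have ca: "c s \<in> carrier R" if "s \<in> A" for s using free_module_apply(4)[OF _ c(1)] that A(2) by blast
    note g = free_gen_closed[OF M.is_cring, of ?S]
    have ex: "c = (\<Oplus>\<^bsub>?F\<^esub>s\<in>A. c s \<odot>\<^bsub>?F\<^esub> free_gen R ?S s)"
      by (rule free_module_expand[OF M.is_cring c(1) A]) (simp add: A_def)
    have "t = (\<Oplus>\<^bsub>tensor R M N\<^esub>s\<in>A. ?U +>\<^bsub>?F\<^esub> (c s \<odot>\<^bsub>?F\<^esub> free_gen R ?S s))"
      unfolding c(2) by (subst ex, rule lin_finsum[OF \<pi> A(1)]) (use ca g in auto)
    also have "\<dots> \<in> W"
    proof (rule submodule_finsum[OF T W A(1)])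
      fix s assume s: "s \<in> A"
      obtain m n where mn: "s = (m, n)" "m \<in> carrier M" "n \<in> carrier N" using s A(2) by auto
      have "?U +>\<^bsub>?F\<^esub> (c s \<odot>\<^bsub>?F\<^esub> free_gen R ?S s) = c s \<odot>\<^bsub>tensor R M N\<^esub> pure_tensor R M N m n"
        unfolding pure_tensor_def mn(1)[symmetric] by (rule lin_smult[OF \<pi> ca[OF s] g])
      then show "?U +>\<^bsub>?F\<^esub> (c s \<odot>\<^bsub>?F\<^esub> free_gen R ?S s) \<in> W"
        using submodule_smult[OF T W ca[OF s] pure[OF mn(2,3)]] by simp
    qed
    finally show "t \<in> W" .
  qed
qed

text \<open>The kernel of \<open>f - g\<close> is a submodule containing all pure tensors.\<close>

lemma tensor_eqI:
  assumes M: "module R M" and N: "module R N"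
    and f: "lin R (tensor R M N) P f" and g: "lin R (tensor R M N) P g"
    and eq: "\<And>m n. m \<in> carrier M \<Longrightarrow> n \<in> carrier N
      \<Longrightarrow> f (pure_tensor R M N m n) = g (pure_tensor R M N m n)"
    and t: "t \<in> carrier (tensor R M N)"
  shows "f t = g t"
proof -
  interpret P: module R P by (rule lin_cod[OF f])
  note K = lin_kernel_submodule[OF lin_minus[OF f g]]
  have k: "a_kernel (tensor R M N) P (\<lambda>x. f x \<ominus>\<^bsub>P\<^esub> g x) = carrier (tensor R M N)"
    by (rule submodule_tensor_eq[OF M N K])
      (simp add: mem_a_kernel pure_tensor_closed[OF M N] eq P.minus_eq_zero_iff
        lin_closed[OF g])
  show ?thesis
    using t[folded k] P.minus_eq_zero_iff[OF lin_closed[OF f t] lin_closed[OF g t]]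
    by (simp add: mem_a_kernel)
qed

lemma lin_pure_left:
  assumes M: "module R M" and N: "module R N" and y: "y \<in> carrier N"
  shows "lin R M (tensor R M N) (\<lambda>x. pure_tensor R M N x y)"
  by (rule linI[OF M tensor_is_module[OF M N]])
    (simp_all add: y pure_tensor_closed[OF M N] pure_tensor_add_left[OF M N] pure_tensor_smult_left[OF M N])

lemma lin_pure_right:
  assumes M: "module R M" and N: "module R N" and x: "x \<in> carrier M"
  shows "lin R N (tensor R M N) (\<lambda>y. pure_tensor R M N x y)"
  by (rule linI[OF N tensor_is_module[OF M N]])
    (simp_all add: x pure_tensor_closed[OF M N] pure_tensor_add_right[OF M N] pure_tensor_smult_right[OF M N])

section \<open>Functoriality of tensoring with a fixed module\<close>

abbreviation (input) tensor_right ::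
  "('a, 'r) ring_scheme \<Rightarrow> ('a, 'n, 'y) module_scheme \<Rightarrow> ('a, 'm, 'x) module_scheme
    \<Rightarrow> ('a, 'm1, 'x1) module_scheme \<Rightarrow> ('m \<Rightarrow> 'm1) \<Rightarrow> ('m \<times> 'n \<Rightarrow> 'a) set \<Rightarrow> ('m1 \<times> 'n \<Rightarrow> 'a) set"
  where "tensor_right R N A B f \<equiv> tensor_map R A N B N f (\<lambda>n\<in>carrier N. n)"

text \<open>Counterpart of \<open>tensor_map_hom\<close> and \<open>tensor_map_pure\<close> for maps
  that are only \<open>lin\<close>: the bilinear map inducing \<open>f \<otimes> id\<close>
  evaluates \<open>f\<close> on the carrier alone.\<close>

lemma
  assumes N: "module R N" and f: "lin R A B f"
  shows lin_tensor_right: "lin R (tensor R A N) (tensor R B N) (tensor_right R N A B f)"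
    and tensor_right_pure: "x \<in> carrier A \<Longrightarrow> y \<in> carrier N
      \<Longrightarrow> tensor_right R N A B f (pure_tensor R A N x y) = pure_tensor R B N (f x) y"
proof -
  note A = lin_dom[OF f] and B = lin_cod[OF f]
  note T = tensor_is_module[OF B N]
  interpret N: module R N by (rule N)
  have "tensor_right R N A B f \<in> mod_hom R (tensor R A N) (tensor R B N)"
    unfolding tensor_map_def
    by (rule tensor_lift_hom[OF A N T])
      (simp_all add: lin_closed[OF f] lin_add[OF f] lin_smult[OF f] pure_tensor_bilinear[OF B N])
  then show "lin R (tensor R A N) (tensor R B N) (tensor_right R N A B f)"
    by (rule mod_hom_lin[OF tensor_is_module[OF A N] T])
  show "tensor_right R N A B f (pure_tensor R A N x y) = pure_tensor R B N (f x) y"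
    if "x \<in> carrier A" "y \<in> carrier N"
    unfolding tensor_map_def
    by (subst tensor_lift_pure[OF A N T])
      (simp_all add: lin_closed[OF f] lin_add[OF f] lin_smult[OF f] pure_tensor_bilinear[OF B N] that)
qed

text \<open>Formulated for any \<open>h\<close> agreeing with the composite on the carrier, so that
  both ways round a commutative square can be compared with one and the same map.\<close>

lemma tensor_right_comp:
  assumes N: "module R N" and f: "lin R A B f" and g: "lin R B C g" and h: "lin R A C h"
    and eq: "\<And>x. x \<in> carrier A \<Longrightarrow> g (f x) = h x" and t: "t \<in> carrier (tensor R A N)"
  shows "tensor_right R N B C g (tensor_right R N A B f t) = tensor_right R N A C h t"
  by (rule tensor_eqI[OF lin_dom[OF f] N lin_comp[OF lin_tensor_right[OF N g] lin_tensor_right[OF N f]]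
        lin_tensor_right[OF N h] _ t])
    (simp add: tensor_right_pure[OF N f] tensor_right_pure[OF N g] tensor_right_pure[OF N h]
      lin_closed[OF f] eq)

lemma tensor_right_zero:
  assumes N: "module R N" and f: "lin R A B f"
    and eq: "\<And>x. x \<in> carrier A \<Longrightarrow> f x = \<zero>\<^bsub>B\<^esub>" and t: "t \<in> carrier (tensor R A N)"
  shows "tensor_right R N A B f t = \<zero>\<^bsub>tensor R B N\<^esub>"
  by (rule tensor_eqI[OF lin_dom[OF f] N lin_tensor_right[OF N f]
        lin_const_zero[OF tensor_is_module[OF lin_dom[OF f] N] tensor_is_module[OF lin_cod[OF f] N]] _ t])
    (simp add: tensor_right_pure[OF N f] eq lin_zero[OF lin_pure_left[OF lin_cod[OF f] N]])

text \<open>Vanishing of \<open>Tor\<^sub>i\<^sub>+\<^sub>1(M, N)\<close>, computed from the resolution with ranks \<open>n\<close> and differentials \<open>d\<close>.\<close>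

definition tor_vanish ::
  "('a, 'r) ring_scheme \<Rightarrow> ('a, 'n, 'y) module_scheme \<Rightarrow> (nat \<Rightarrow> nat)
    \<Rightarrow> (nat \<Rightarrow> (nat \<Rightarrow> 'a) \<Rightarrow> (nat \<Rightarrow> 'a)) \<Rightarrow> nat \<Rightarrow> bool"
  where "tor_vanish R N n d i \<longleftrightarrow>
    (\<forall>t\<in>carrier (tensor R (pow_module R (n (Suc i))) N).
      tensor_right R N (pow_module R (n (Suc i))) (pow_module R (n i)) (d i) t
        = \<zero>\<^bsub>tensor R (pow_module R (n i)) N\<^esub> \<longrightarrow>
      t \<in> tensor_right R N (pow_module R (n (Suc (Suc i)))) (pow_module R (n (Suc i))) (d (Suc i))
        ` carrier (tensor R (pow_module R (n (Suc (Suc i)))) N))"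

text \<open>A cycle \<open>t\<close> goes under \<open>\<alpha>\<close> to a cycle, hence to a
  boundary, and back under \<open>\<beta>\<close> to a boundary. The homotopy gives
  \<open>\<beta> \<alpha> t = t + c s t\<close>, its other term vanishing on a cycle, so
  \<open>t\<close> is itself a boundary.\<close>

lemma tor_vanish_transfer:
  assumes N: "module R N" and F: "fres R M m c e" and F': "fres R M n d e'"
    and v: "tor_vanish R N n d i"
  shows "tor_vanish R N m c i"
  unfolding tor_vanish_def
proof (intro ballI impI)
  let ?C = "\<lambda>i. pow_module R (m i)" and ?D = "\<lambda>i. pow_module R (n i)"
  let ?cc = "\<lambda>i. tensor_right R N (?C (Suc i)) (?C i) (c i)"
  let ?dd = "\<lambda>i. tensor_right R N (?D (Suc i)) (?D i) (d i)"
  fix t assume t: "t \<in> carrier (tensor R (?C (Suc i)) N)" and ct: "?cc i t = \<zero>\<^bsub>tensor R (?C i) N\<^esub>"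
  obtain \<alpha> \<beta> s where \<alpha>: "\<And>i. lin R (?C i) (?D i) (\<alpha> i)"
    and \<beta>: "\<And>i. lin R (?D i) (?C i) (\<beta> i)"
    and s: "\<And>i. lin R (?C i) (?C (Suc i)) (s i)"
    and \<alpha>d: "\<And>i x. x \<in> carrier (?C (Suc i)) \<Longrightarrow> d i (\<alpha> (Suc i) x) = \<alpha> i (c i x)"
    and \<beta>d: "\<And>i x. x \<in> carrier (?D (Suc i)) \<Longrightarrow> c i (\<beta> (Suc i) x) = \<beta> i (d i x)"
    and h: "\<And>i x. x \<in> carrier (?C (Suc i)) \<Longrightarrow>
      \<beta> (Suc i) (\<alpha> (Suc i) x) = (x \<oplus>\<^bsub>?C (Suc i)\<^esub> s i (c i x)) \<oplus>\<^bsub>?C (Suc i)\<^esub> c (Suc i) (s (Suc i) x)"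
    using fres_compare[OF F F'] by blast
  note C = fres_diff[OF F] and D = fres_diff[OF F']
  note L = lin_tensor_right[OF N]
  have CM: "module R (?C j)" for j by (rule lin_dom[OF \<alpha>])
  let ?T = "tensor R (?C (Suc i)) N"
  interpret T: module R ?T by (rule tensor_is_module[OF CM N])
  interpret T2: module R "tensor R (?C (Suc (Suc i))) N" by (rule tensor_is_module[OF CM N])
  let ?\<alpha> = "\<lambda>j. tensor_right R N (?C j) (?D j) (\<alpha> j)"
  let ?\<beta> = "\<lambda>j. tensor_right R N (?D j) (?C j) (\<beta> j)"
  let ?s = "\<lambda>j. tensor_right R N (?C j) (?C (Suc j)) (s j)"
  note \<alpha>t = lin_closed[OF L[OF \<alpha>] t]
  have "?dd i (?\<alpha> (Suc i) t) = tensor_right R N (?C (Suc i)) (?D i) (\<lambda>x. \<alpha> i (c i x)) t"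
    by (rule tensor_right_comp[OF N \<alpha> D lin_comp[OF \<alpha> C] _ t]) (rule \<alpha>d)
  also have "\<dots> = ?\<alpha> i (?cc i t)"
    by (rule tensor_right_comp[OF N C \<alpha> lin_comp[OF \<alpha> C] _ t, symmetric]) (rule refl)
  also have "\<dots> = \<zero>\<^bsub>tensor R (?D i) N\<^esub>" by (simp add: ct lin_zero[OF L[OF \<alpha>]])
  finally obtain w where w: "w \<in> carrier (tensor R (?D (Suc (Suc i))) N)"
      "?\<alpha> (Suc i) t = ?dd (Suc i) w"
    using v \<alpha>t unfolding tor_vanish_def by blast
  note \<beta>w = lin_closed[OF L[OF \<beta>] w(1)] and st = lin_closed[OF L[OF s] t]
  note csT = lin_closed[OF L[OF C] st]
  have "?\<beta> (Suc i) (?\<alpha> (Suc i) t) = tensor_right R N (?D (Suc (Suc i))) (?C (Suc i)) (\<lambda>x. \<beta> (Suc i) (d (Suc i) x)) w"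
    unfolding w(2) by (rule tensor_right_comp[OF N D \<beta> lin_comp[OF \<beta> D] _ w(1)]) (rule refl)
  also have "\<dots> = ?cc (Suc i) (?\<beta> (Suc (Suc i)) w)"
    by (rule tensor_right_comp[OF N \<beta> C lin_comp[OF \<beta> D] _ w(1), symmetric]) (rule \<beta>d)
  finally have 1: "?\<beta> (Suc i) (?\<alpha> (Suc i) t) = ?cc (Suc i) (?\<beta> (Suc (Suc i)) w)" .
  \<comment> \<open>The homotopy identity tensored with \<open>N\<close>: both sides are linear in
    \<open>t\<close>, so pure tensors suffice.\<close>
  have "?\<beta> (Suc i) (?\<alpha> (Suc i) t) = (t \<oplus>\<^bsub>?T\<^esub> ?s i (?cc i t)) \<oplus>\<^bsub>?T\<^esub> ?cc (Suc i) (?s (Suc i) t)"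
  proof (rule tensor_eqI[OF CM N lin_comp[OF L[OF \<beta>] L[OF \<alpha>]]
        lin_plus[OF lin_plus[OF lin_id[OF T.module_axioms] lin_comp[OF L[OF s] L[OF C]]] lin_comp[OF L[OF C] L[OF s]]] _ t])
    fix x y assume x: "x \<in> carrier (?C (Suc i))" and y: "y \<in> carrier N"
    interpret C1: module R "?C (Suc i)" by (rule CM)
    note cl = lin_closed[OF \<alpha> x] lin_closed[OF C x] lin_closed[OF s x]
      lin_closed[OF s lin_closed[OF C x]] lin_closed[OF C lin_closed[OF s x]]
    note p = tensor_right_pure[OF N _ _ y]
    show "?\<beta> (Suc i) (?\<alpha> (Suc i) (pure_tensor R (?C (Suc i)) N x y))
      = (pure_tensor R (?C (Suc i)) N x y \<oplus>\<^bsub>?T\<^esub> ?s i (?cc i (pure_tensor R (?C (Suc i)) N x y)))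
        \<oplus>\<^bsub>?T\<^esub> ?cc (Suc i) (?s (Suc i) (pure_tensor R (?C (Suc i)) N x y))"
      using x cl by (simp add: p[OF \<alpha>] p[OF \<beta>] p[OF s] p[OF C] h[OF x]
          lin_add[OF lin_pure_left[OF CM N y]])
  qed
  then have "?cc (Suc i) (?\<beta> (Suc (Suc i)) w) = t \<oplus>\<^bsub>?T\<^esub> ?cc (Suc i) (?s (Suc i) t)"
    using t by (simp add: 1 ct lin_zero[OF L[OF s]])
  then have "t = ?cc (Suc i) (?\<beta> (Suc (Suc i)) w \<ominus>\<^bsub>tensor R (?C (Suc (Suc i))) N\<^esub> ?s (Suc i) t)"
    using t csT by (simp add: lin_diff[OF L[OF C] \<beta>w st] T.add_minus_cancel')
  then show "t \<in> ?cc (Suc i) ` carrier (tensor R (?C (Suc (Suc i))) N)"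
    using T2.minus_closed[OF \<beta>w st] by blast
qed

lemma zero_Tor_vanish:
  assumes N: "module R N" and M: "module R M" and F: "is_free_resolution R M (free_resolution R M)"
    and z: "zero_module (Tor R M N (Suc i))"
  shows "tor_vanish R N (res_rank (free_resolution R M)) (res_diff (free_resolution R M)) i"
  unfolding tor_vanish_def
proof (intro ballI impI)
  define n d where "n = res_rank (free_resolution R M)" and "d = res_diff (free_resolution R M)"
  let ?F = "\<lambda>i. pow_module R (n i)"
  let ?dd = "\<lambda>i. tensor_right R N (?F (Suc i)) (?F i) (d i)"
  note D = fres_diff[OF is_free_resolution_fres[OF M F], folded n_def d_def]
  have F_simp: "res_module R (free_resolution R M) j = ?F j" for j
    by (simp add: res_module_def n_def)
  have diff: "Tor_diff R (free_resolution R M) N j = ?dd j" for j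
    by (simp add: Tor_diff_def F_simp d_def)
  fix t assume t: "t \<in> carrier (tensor R (?F (Suc i)) N)" and dt: "?dd i t = \<zero>\<^bsub>tensor R (?F i) N\<^esub>"
  note L = lin_tensor_right[OF N D]
  interpret T: module R "tensor R (?F (Suc i)) N" by (rule lin_dom[OF L])
  interpret T2: module R "tensor R (?F (Suc (Suc i))) N" by (rule lin_dom[OF L])
  let ?A = "(tensor R (?F (Suc i)) N)\<lparr>carrier := a_kernel (tensor R (?F (Suc i)) N) (tensor R (?F i) N) (?dd i)\<rparr>"
  show "t \<in> ?dd (Suc i) ` carrier (tensor R (?F (Suc (Suc i))) N)"
  proof (rule zero_quot_module_mem)
    show "zero_module (quot_module ?A (?dd (Suc i) ` carrier (tensor R (?F (Suc (Suc i))) N)))"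
      using z by (simp add: Tor_def Tor_cycles_def Let_def F_simp diff)
    show "t \<in> carrier ?A" using t dt by (simp add: mem_a_kernel)
    show "\<zero>\<^bsub>tensor R (?F (Suc i)) N\<^esub> \<in> ?dd (Suc i) ` carrier (tensor R (?F (Suc (Suc i))) N)"
      using lin_zero[OF L] T2.zero_closed by (metis imageI)
    show "\<zero>\<^bsub>tensor R (?F (Suc i)) N\<^esub> \<oplus>\<^bsub>?A\<^esub> t = t" using t by simp
  qed
qed

text \<open>The \<open>k\<close>-th component under the identification of
  \<open>R\<^sup>n \<otimes> N\<close> with \<open>N\<^sup>n\<close>.\<close>

definition tensor_coord ::
  "('a, 'r) ring_scheme \<Rightarrow> ('a, 'n, 'y) module_scheme \<Rightarrow> nat \<Rightarrow> nat
    \<Rightarrow> ((nat \<Rightarrow> 'a) \<times> 'n \<Rightarrow> 'a) set \<Rightarrow> 'n"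
  where "tensor_coord R N n k = tensor_lift R (pow_module R n) N N (\<lambda>(c, y). c k \<odot>\<^bsub>N\<^esub> y)"

lemma
  assumes N: "module R N" and k: "k < n"
  shows lin_tensor_coord: "lin R (tensor R (pow_module R n) N) N (tensor_coord R N n k)"
    and tensor_coord_pure: "c \<in> carrier (pow_module R n) \<Longrightarrow> y \<in> carrier N
      \<Longrightarrow> tensor_coord R N n k (pure_tensor R (pow_module R n) N c y) = c k \<odot>\<^bsub>N\<^esub> y"
proof -
  interpret N: module R N by fact
  have P: "module R (pow_module R n)" by (rule free_module_is_module[OF N.is_cring])
  note c = pow_module_apply(4)[OF k]
  have sw: "r \<odot>\<^bsub>N\<^esub> (s \<odot>\<^bsub>N\<^esub> y) = s \<odot>\<^bsub>N\<^esub> (r \<odot>\<^bsub>N\<^esub> y)"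
    if "r \<in> carrier R" "s \<in> carrier R" "y \<in> carrier N" for r s y
    using that by (metis N.smult_assoc1 N.R.m_comm)
  have "tensor_coord R N n k \<in> mod_hom R (tensor R (pow_module R n) N) N"
    unfolding tensor_coord_def
    by (rule tensor_lift_hom[OF P N N])
      (simp_all add: c pow_module_apply[OF k] N.smult_l_distr N.smult_r_distr N.smult_assoc1 sw[OF c])
  then show "lin R (tensor R (pow_module R n) N) N (tensor_coord R N n k)"
    by (rule mod_hom_lin[OF tensor_is_module[OF P N] N])
  show "tensor_coord R N n k (pure_tensor R (pow_module R n) N c y) = c k \<odot>\<^bsub>N\<^esub> y"
    if "c \<in> carrier (pow_module R n)" "y \<in> carrier N"
    unfolding tensor_coord_def
    by (subst tensor_lift_pure[OF P N N])
      (simp_all add: c pow_module_apply[OF k] N.smult_l_distr N.smult_r_distr N.smult_assoc1 sw[OF c] that)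
qed

text \<open>Both sides are linear in \<open>t\<close>; on a pure tensor this is the expansion of the
  first factor in the standard basis. It makes the coordinates jointly injective.\<close>

lemma tensor_pow_expand:
  assumes N: "module R N" and t: "t \<in> carrier (tensor R (pow_module R n) N)"
  shows "t = (\<Oplus>\<^bsub>tensor R (pow_module R n) N\<^esub>k\<in>{..<n}.
    pure_tensor R (pow_module R n) N (free_gen R {..<n} k) (tensor_coord R N n k t))"
proof -
  interpret N: module R N by fact
  let ?P = "pow_module R n"
  have P: "module R ?P" by (rule free_module_is_module[OF N.is_cring])
  note T = tensor_is_module[OF P N] and g = free_gen_closed[OF N.is_cring, of "{..<n}"]
  interpret T: module R "tensor R ?P N" by (rule T)
  note pr = lin_pure_right[OF P N g] and co = lin_tensor_coord[OF N]
  show ?thesis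
  proof (rule tensor_eqI[OF P N lin_id[OF T] lin_sum[OF T T _ lin_comp[OF pr co]] _ t])
    fix c y assume c: "c \<in> carrier ?P" and y: "y \<in> carrier N"
    note pl = lin_pure_left[OF P N y] and ck = pow_module_apply(4)[OF _ c]
    have "pure_tensor R ?P N c y = (\<Oplus>\<^bsub>tensor R ?P N\<^esub>k\<in>{..<n}. c k \<odot>\<^bsub>tensor R ?P N\<^esub> pure_tensor R ?P N (free_gen R {..<n} k) y)"
      by (rule lin_pow_expand[OF pl c])
    also have "\<dots> = (\<Oplus>\<^bsub>tensor R ?P N\<^esub>k\<in>{..<n}.
        pure_tensor R ?P N (free_gen R {..<n} k) (tensor_coord R N n k (pure_tensor R ?P N c y)))"
      by (rule T.finsum_cong')
        (use y ck c g in \<open>auto simp: tensor_coord_pure[OF N] lin_smult[OF pr] intro: pure_tensor_closed[OF P N]\<close>)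
    finally show "pure_tensor R ?P N c y = (\<Oplus>\<^bsub>tensor R ?P N\<^esub>k\<in>{..<n}.
        pure_tensor R ?P N (free_gen R {..<n} k) (tensor_coord R N n k (pure_tensor R ?P N c y)))" .
  qed auto
qed

lemma tensor_pow_zeroI:
  assumes N: "module R N" and t: "t \<in> carrier (tensor R (pow_module R n) N)"
    and z: "\<And>k. k < n \<Longrightarrow> tensor_coord R N n k t = \<zero>\<^bsub>N\<^esub>"
  shows "t = \<zero>\<^bsub>tensor R (pow_module R n) N\<^esub>"
proof -
  interpret N: module R N by fact
  let ?P = "pow_module R n"
  have P: "module R ?P" by (rule free_module_is_module[OF N.is_cring])
  interpret T: module R "tensor R ?P N" by (rule tensor_is_module[OF P N])
  note pr = lin_pure_right[OF P N free_gen_closed[OF N.is_cring]]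
  have "t = (\<Oplus>\<^bsub>tensor R ?P N\<^esub>k\<in>{..<n}. \<zero>\<^bsub>tensor R ?P N\<^esub>)"
    by (subst tensor_pow_expand[OF N t], rule T.finsum_cong') (auto simp: z lin_zero[OF pr])
  then show ?thesis by simp
qed

lemma tensor_right_surj:
  assumes N: "module R N" and f: "lin R A B f" and surj: "f ` carrier A = carrier B"
  shows "tensor_right R N A B f ` carrier (tensor R A N) = carrier (tensor R B N)"
proof (rule submodule_tensor_eq[OF lin_cod[OF f] N lin_image_submodule[OF lin_tensor_right[OF N f]]])
  fix m n assume "m \<in> carrier B" and n: "n \<in> carrier N"
  then obtain x where x: "x \<in> carrier A" "m = f x" using surj by blast
  show "pure_tensor R B N m n \<in> tensor_right R N A B f ` carrier (tensor R A N)"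
    using tensor_right_pure[OF N f x(1) n] pure_tensor_closed[OF lin_dom[OF f] N x(1) n] x(2)
    by (metis imageI)
qed

section \<open>Two-periodic modules\<close>

text \<open>At \<open>F_1\<close> exactness holds because the image of \<open>\<iota>\<close> is the
  kernel of \<open>d0\<close>; at the later copies of \<open>F_0\<close> it holds because
  \<open>\<iota>\<close> is injective, so that \<open>\<iota>\<close> after \<open>e\<close> has the
  same kernel as \<open>e\<close>.\<close>

lemma two_periodic_resolution:
  fixes R :: "('a, 'r) ring_scheme" and M :: "('a, 'm, 'x) module_scheme"
  assumes loc: "local_ring R" and noeth: "noetherian_ring R" and M: "fin_gen_module R M"
    and per: "two_periodic R M"
  obtains n0 n1 :: nat and d0 e \<iota> where
    "lin R (pow_module R n1) (pow_module R n0) d0" "lin R M (pow_module R n1) \<iota>"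
    "\<And>m. m \<in> carrier M \<Longrightarrow> d0 (\<iota> m) = \<zero>\<^bsub>pow_module R n0\<^esub>"
    "\<And>x. x \<in> carrier (pow_module R n1) \<Longrightarrow> e (d0 x) = \<zero>\<^bsub>M\<^esub>"
    "fres R M (\<lambda>i. if even i then n0 else n1) (\<lambda>i. if even i then d0 else (\<lambda>x. \<iota> (e x))) e"
proof -
  have mod: "module R M" using M by (simp add: fin_gen_module_def)
  define F where "F = minimal_free_resolution R M"
  define n where "n = res_rank F"
  define d where "d = res_diff F"
  define e where "e = res_aug F"
  have "is_minimal_free_resolution R M F"
    unfolding F_def by (rule minimal_free_resolution_is_minimal[OF loc noeth M])
  then have "is_free_resolution R M F" by (simp add: is_minimal_free_resolution_def)
  then have res: "fres R M n d e"
    unfolding n_def d_def e_def by (rule is_free_resolution_fres[OF mod])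
  note C = fres_fcomplex[OF res] and e = fres_aug[OF res] and d = fres_diff[OF res]
  let ?P = "\<lambda>i. pow_module R (n i)"
  let ?U = "d 1 ` carrier (?P (Suc 1))"
  \<comment> \<open>By the index shift in \<open>syzygy\<close>, the second syzygy sits inside
    \<open>F_1\<close> as the image of \<open>F_2\<close>.\<close>
  have syz: "syzygy R 2 M = (?P 1)\<lparr>carrier := ?U\<rparr>"
    unfolding syzygy_def F_def[symmetric] Let_def res_module_def n_def d_def
    by (simp add: numeral_2_eq_2)
  have sub: "submodule ?U R (?P 1)" using lin_image_submodule[OF d[of 1]] by simp
  have P1: "module R (?P 1)" by (rule free_module_is_module[OF module.axioms(1)[OF mod]])
  obtain \<iota> where \<iota>: "\<iota> \<in> mod_hom R M ((?P 1)\<lparr>carrier := ?U\<rparr>)" "bij_betw \<iota> (carrier M) ?U"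
    using per by (auto simp: two_periodic_def mod_isomorphic_def mod_iso_def syz)
  have \<iota>U: "\<iota> ` carrier M = ?U" and inj: "inj_on \<iota> (carrier M)"
    using \<iota>(2) by (simp_all add: bij_betw_def)
  have \<iota>l: "lin R M (?P 1) \<iota>"
    by (rule lin_comp[OF lin_inclusion[OF P1 sub] mod_hom_lin[OF mod submodule_module[OF P1 sub] \<iota>(1)]])
  have d\<iota>: "d 0 (\<iota> m) = \<zero>\<^bsub>?P 0\<^esub>" if m: "m \<in> carrier M" for m
  proof -
    have "\<iota> m \<in> ?U" using m \<iota>U by blast
    then obtain c where "c \<in> carrier (?P (Suc 1))" "\<iota> m = d 1 c" by auto
    then show ?thesis using fcomplex_diff_diff[OF C, of c 0] by simp
  qed
  define n' where "n' i = (if even i then n 0 else n 1)" for i :: nat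
  define d' where "d' i = (if even i then d 0 else (\<lambda>x. \<iota> (e x)))" for i :: nat
  interpret M: module R M by (rule mod)
  have \<iota>e: "lin R (?P 0) (?P 1) (\<lambda>x. \<iota> (e x))" by (rule lin_comp[OF \<iota>l e])
  have e0: "e c = \<zero>\<^bsub>M\<^esub>" if "c \<in> carrier (?P 0)" "\<iota> (e c) = \<zero>\<^bsub>?P 1\<^esub>" for c
    using inj_onD[OF inj, of "e c" "\<zero>\<^bsub>M\<^esub>"] that lin_zero[OF \<iota>l] lin_closed[OF e] by simp
  have "fres R M n' d' e"
  proof (rule fresI)
    show "lin R (pow_module R (n' 0)) M e" using e by (simp add: n'_def)
    show "lin R (pow_module R (n' (Suc i))) (pow_module R (n' i)) (d' i)" for i
      using d[of 0] \<iota>e by (simp add: n'_def d'_def)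
    show "carrier M \<subseteq> e ` carrier (pow_module R (n' 0))" using fres_surj[OF res] by (simp add: n'_def)
    show "e (d' 0 c) = \<zero>\<^bsub>M\<^esub>" if "c \<in> carrier (pow_module R (n' (Suc 0)))" for c
      using fcomplex_aug_diff[OF C] that by (simp add: n'_def d'_def)
    show "d' i (d' (Suc i) c) = \<zero>\<^bsub>pow_module R (n' i)\<^esub>"
      if "c \<in> carrier (pow_module R (n' (Suc (Suc i))))" for i c
      using that fcomplex_aug_diff[OF C] d\<iota> lin_closed[OF e] lin_zero[OF \<iota>l]
      by (cases "even i") (simp_all add: n'_def d'_def)
    show "c \<in> d' 0 ` carrier (pow_module R (n' (Suc 0)))"
      if "c \<in> carrier (pow_module R (n' 0))" "e c = \<zero>\<^bsub>M\<^esub>" for c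
      using fres_exact0[OF res] that by (simp add: n'_def d'_def)
    show "c \<in> d' (Suc i) ` carrier (pow_module R (n' (Suc (Suc i))))"
      if c: "c \<in> carrier (pow_module R (n' (Suc i)))" and dc: "d' i c = \<zero>\<^bsub>pow_module R (n' i)\<^esub>" for i c
    proof (cases "even i")
      case True
      \<comment> \<open>For even \<open>i\<close> the kernel of \<open>d0\<close> is the image of
        \<open>F_2\<close> in the minimal resolution, hence the image of \<open>\<iota>\<close>, and
        surjectivity of \<open>e\<close> rewrites it as the image of \<open>\<iota>\<close> after
        \<open>e\<close>.\<close>
      have "c \<in> ?U" using fres_exact[OF res, of c 0] c dc True by (simp add: n'_def d'_def)
      then have "c \<in> (\<lambda>x. \<iota> (e x)) ` carrier (?P 0)"
        unfolding \<iota>U[symmetric] fres_surj[OF res, symmetric] by (simp add: image_image)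
      then show ?thesis using True by (simp add: n'_def d'_def)
    next
      case False
      then show ?thesis using fres_exact0[OF res, of c] e0[of c] c dc by (simp add: n'_def d'_def)
    qed
  qed
  then show thesis
    using that[of "n 1" "n 0" "d 0" \<iota> e] d[of 0] \<iota>l d\<iota> fcomplex_aug_diff[OF C]
    by (simp add: n'_def[abs_def] d'_def[abs_def])
qed

lemma lin_hom_eval:
  assumes M: "module R M" and N: "module R N" and x: "x \<in> carrier M"
  shows "lin R (hom_module R M N) N (\<lambda>\<phi>. \<phi> x)"
  by (rule linI[OF hom_module_is_module[OF M N] N]) (use x in \<open>auto simp: hom_module_def mod_hom_def\<close>)

lemma hom_module_eqI:
  assumes "\<phi> \<in> carrier (hom_module R M N)" "\<psi> \<in> carrier (hom_module R M N)"
    "\<And>x. x \<in> carrier M \<Longrightarrow> \<phi> x = \<psi> x"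
  shows "\<phi> = \<psi>"
  using assms by (intro PiE_ext[of \<phi> "carrier M" "\<lambda>_. carrier N" \<psi>]) (auto simp: hom_module_def mod_hom_def)

theorem theorem1:
  fixes R :: "('a, 'r) ring_scheme"
    and M :: "('a, 'm, 'x) module_scheme"
    and N :: "('a, 'n, 'y) module_scheme"
  assumes "local_ring R" and "noetherian_ring R"
    and "fin_gen_module R M" and "two_periodic R M" and "finite_Gdim R M"
    and "fin_gen_module R N" and "Tor_independent R M N"
  shows "natural_map R M N \<in> mod_iso R (tensor R M N) (hom_module R (dual R M) N)"
proof -
  have M: "module R M" and N: "module R N" using assms(3,6) by (simp_all add: fin_gen_module_def)
  interpret M: module R M by (rule M)
  interpret N: module R N by (rule N)
  have R: "cring R" by (rule M.is_cring)
  have S: "module R (self_module R)" by (rule self_module_is_module[OF R])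
  define D where "D = dual R M"
  have D: "module R D" unfolding D_def by (rule dual_is_module[OF M])
  have DH: "D = hom_module R M (self_module R)" by (simp add: D_def dual_def)
  interpret D: module R D by (rule D)
  define H where "H = hom_module R D N"
  have H: "module R H" unfolding H_def by (rule hom_module_is_module[OF D N])
  interpret H: module R H by (rule H)
  define T where "T = tensor R M N"
  have T: "module R T" unfolding T_def by (rule tensor_is_module[OF M N])
  interpret T: module R T by (rule T)
  obtain n0 n1 :: nat and d0 e \<iota> where d0: "lin R (pow_module R n1) (pow_module R n0) d0"
    and \<iota>: "lin R M (pow_module R n1) \<iota>"
    and d\<iota>: "\<And>m. m \<in> carrier M \<Longrightarrow> d0 (\<iota> m) = \<zero>\<^bsub>pow_module R n0\<^esub>"
    and ed: "\<And>x. x \<in> carrier (pow_module R n1) \<Longrightarrow> e (d0 x) = \<zero>\<^bsub>M\<^esub>"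
    and res: "fres R M (\<lambda>i. if even i then n0 else n1) (\<lambda>i. if even i then d0 else (\<lambda>x. \<iota> (e x))) e"
    by (rule two_periodic_resolution[OF assms(1-4)]) (rule that)
  let ?P0 = "pow_module R n0" and ?P1 = "pow_module R n1"
  have P0: "module R ?P0" and P1: "module R ?P1" by (rule lin_cod[OF d0], rule lin_dom[OF d0])
  have e: "lin R ?P0 M e" and esurj: "e ` carrier ?P0 = carrier M"
    using fres_aug[OF res] fres_surj[OF res] by simp_all
  have \<iota>e: "lin R ?P0 ?P1 (\<lambda>x. \<iota> (e x))" by (rule lin_comp[OF \<iota> e])
  define n where "n i = (if even i then n0 else n1)" for i :: nat
  define d where "d i = (if even i then d0 else (\<lambda>x. \<iota> (e x)))" for i :: nat
  have res': "fres R M n d e" using res by (simp add: n_def[abs_def] d_def[abs_def])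
  note L = lin_tensor_right[OF N]

  \<comment> \<open>Vanishing of Tor and Ext along the periodic resolution\<close>
  have tor: "tor_vanish R N n d i" for i
  proof -
    note F = free_resolution_is_free_resolution[OF assms(1-3)]
    have "zero_module (Tor R M N (Suc i))" using assms(7) by (simp add: Tor_independent_def)
    from zero_Tor_vanish[OF N M F this] show ?thesis
      by (rule tor_vanish_transfer[OF N res' is_free_resolution_fres[OF M F]])
  qed
  \<comment> \<open>Index 1 stands for Tor_2, computed at the copy of \<open>?P0\<close> in degree
    2; the boundaries arrive from degree 3, a copy of \<open>?P1\<close>.\<close>
  have tor2: "u \<in> tensor_right R N ?P1 ?P0 d0 ` carrier (tensor R ?P1 N)"
    if "u \<in> carrier (tensor R ?P0 N)"
      "tensor_right R N ?P0 ?P1 (\<lambda>x. \<iota> (e x)) u = \<zero>\<^bsub>tensor R ?P1 N\<^esub>" for u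
    using tor[of 1] that by (simp add: tor_vanish_def n_def d_def)
  have tor1: "u \<in> tensor_right R N ?P0 ?P1 (\<lambda>x. \<iota> (e x)) ` carrier (tensor R ?P0 N)"
    if "u \<in> carrier (tensor R ?P1 N)" "tensor_right R N ?P1 ?P0 d0 u = \<zero>\<^bsub>tensor R ?P0 N\<^esub>" for u
    using tor[of 0] that by (simp add: tor_vanish_def n_def d_def)

  have ext2: "\<exists>h. lin R ?P1 (self_module R) h \<and> (\<forall>x\<in>carrier ?P0. g x = h (\<iota> (e x)))"
    if "lin R ?P0 (self_module R) g" "\<And>x. x \<in> carrier ?P1 \<Longrightarrow> g (d0 x) = \<zero>\<^bsub>self_module R\<^esub>" for g
  proof -
    obtain n' d' e' k where F: "fres R M n' d' e'"
      and v: "\<And>i. k \<le> i \<Longrightarrow> ext_vanish R (self_module R) n' d' i"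
      by (rule finite_Gdim_ext_vanish[OF assms(1,2) M assms(5)]) (rule that)
    \<comment> \<open>\<open>Suc (2 * k)\<close> is at least \<open>k\<close> and odd, so on the
      periodic data the condition is literally the one for index 1, that is for Ext^2.\<close>
    have "ext_vanish R (self_module R) n d (Suc (2 * k))"
      by (rule ext_vanish_transfer[OF res' F v]) simp
    then show ?thesis using that by (simp add: ext_vanish_def n_def d_def)
  qed

  \<comment> \<open>The coordinates of \<open>\<iota>\<close> as generators of the dual\<close>
  define f where "f l = (\<lambda>m\<in>carrier M. \<iota> m l)" for l
  have f: "f l \<in> carrier D" if "l < n1" for l
    using lin_restrict_mod_hom[OF lin_comp[OF lin_coord[OF R that] \<iota>]]
    by (simp add: f_def DH hom_module_def)
  have fa: "f l m = \<iota> m l" if "m \<in> carrier M" for l m using that by (simp add: f_def)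
  note evD = lin_hom_eval[OF M S, folded DH] and evH = lin_hom_eval[OF D N, folded H_def]
  have fsum: "(\<Oplus>\<^bsub>D\<^esub>l\<in>{..<n1}. a l \<odot>\<^bsub>D\<^esub> f l) m = (\<Oplus>\<^bsub>R\<^esub>l\<in>{..<n1}. a l \<otimes>\<^bsub>R\<^esub> \<iota> m l)"
    if a: "\<And>l. l < n1 \<Longrightarrow> a l \<in> carrier R" and m: "m \<in> carrier M" for a m
  proof -
    have "(\<Oplus>\<^bsub>D\<^esub>l\<in>{..<n1}. a l \<odot>\<^bsub>D\<^esub> f l) m = (\<Oplus>\<^bsub>R\<^esub>l\<in>{..<n1}. (a l \<odot>\<^bsub>D\<^esub> f l) m)"
      using lin_finsum[OF evD[OF m], of "{..<n1}" "\<lambda>l. a l \<odot>\<^bsub>D\<^esub> f l"] a f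
      by (simp add: finsum_self_module)
    also have "\<dots> = (\<Oplus>\<^bsub>R\<^esub>l\<in>{..<n1}. a l \<otimes>\<^bsub>R\<^esub> \<iota> m l)"
      by (rule M.R.finsum_cong')
        (use a f lin_smult[OF evD[OF m]] pow_module_apply(4)[OF _ lin_closed[OF \<iota> m]]
          in \<open>auto simp: fa[OF m]\<close>)
    finally show ?thesis .
  qed
  have fspan: "\<exists>a. (\<forall>l<n1. a l \<in> carrier R) \<and> g = (\<Oplus>\<^bsub>D\<^esub>l\<in>{..<n1}. a l \<odot>\<^bsub>D\<^esub> f l)"
    if g: "g \<in> carrier D" for g
  proof -
    have gl: "lin R M (self_module R) g"
      using g by (intro mod_hom_lin[OF M S]) (simp add: DH hom_module_def)
    have "g (e (d0 x)) = \<zero>\<^bsub>self_module R\<^esub>" if "x \<in> carrier ?P1" for x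
      using ed[OF that] lin_zero[OF gl] by simp
    then have "\<exists>h. lin R ?P1 (self_module R) h \<and> (\<forall>x\<in>carrier ?P0. g (e x) = h (\<iota> (e x)))"
      by (rule ext2[OF lin_comp[OF gl e]])
    then obtain h where h: "lin R ?P1 (self_module R) h"
        "\<And>x. x \<in> carrier ?P0 \<Longrightarrow> g (e x) = h (\<iota> (e x))" by blast
    \<comment> \<open>Since \<open>e\<close> is surjective, \<open>g\<close> equals \<open>h\<close>
      after \<open>\<iota>\<close> on all of \<open>M\<close>; expanding \<open>\<iota> m\<close> in
      the standard basis makes the values of \<open>h\<close> on that basis the
      coefficients.\<close>
    define a where "a l = h (free_gen R {..<n1} l)" for l
    have a: "a l \<in> carrier R" for l
      using lin_closed[OF h(1) free_gen_closed[OF R]] by (simp add: a_def)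
    have "g = (\<Oplus>\<^bsub>D\<^esub>l\<in>{..<n1}. a l \<odot>\<^bsub>D\<^esub> f l)"
    proof (rule hom_module_eqI[of _ R M "self_module R", folded DH])
      show "g \<in> carrier D" by (rule g)
      show "(\<Oplus>\<^bsub>D\<^esub>l\<in>{..<n1}. a l \<odot>\<^bsub>D\<^esub> f l) \<in> carrier D"
        by (rule D.finsum_closed) (use a f in auto)
      fix m assume m: "m \<in> carrier M"
      then obtain x where x: "x \<in> carrier ?P0" "m = e x" using esurj by blast
      note \<iota>m = lin_closed[OF \<iota> m]
      note \<iota>l = pow_module_apply(4)[OF _ \<iota>m]
      have "g m = h (\<iota> m)" using h(2)[OF x(1)] x(2) by simp
      also have "\<dots> = (\<Oplus>\<^bsub>R\<^esub>l\<in>{..<n1}. \<iota> m l \<otimes>\<^bsub>R\<^esub> a l)"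
        using lin_pow_expand[OF h(1) \<iota>m] by (simp add: finsum_self_module a_def)
      also have "\<dots> = (\<Oplus>\<^bsub>R\<^esub>l\<in>{..<n1}. a l \<otimes>\<^bsub>R\<^esub> \<iota> m l)"
        by (rule M.R.finsum_cong') (use a \<iota>l in \<open>auto simp: M.R.m_comm\<close>)
      also have "\<dots> = (\<Oplus>\<^bsub>D\<^esub>l\<in>{..<n1}. a l \<odot>\<^bsub>D\<^esub> f l) m" using fsum[OF a m] by simp
      finally show "g m = (\<Oplus>\<^bsub>D\<^esub>l\<in>{..<n1}. a l \<odot>\<^bsub>D\<^esub> f l) m" .
    qed
    then show ?thesis using a by (intro exI[of _ a]) simp
  qed

  \<comment> \<open>The natural map in coordinates\<close>
  define \<nu> where "\<nu> = natural_map R M N"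
  have \<nu>H: "\<nu> \<in> mod_hom R T H"
    unfolding \<nu>_def T_def H_def D_def by (rule natural_map_hom[OF M N])
  have \<nu>: "lin R T H \<nu>" by (rule mod_hom_lin[OF T H \<nu>H])
  have \<nu>pure: "\<nu> (pure_tensor R M N m y) g = g m \<odot>\<^bsub>N\<^esub> y"
    if "m \<in> carrier M" "y \<in> carrier N" "g \<in> carrier D" for m y g
    using that by (simp add: \<nu>_def natural_map_pure[OF M N] D_def)
  let ?e = "tensor_right R N ?P0 M e"
  let ?ie = "tensor_right R N ?P0 ?P1 (\<lambda>x. \<iota> (e x))"
  let ?d = "tensor_right R N ?P1 ?P0 d0"
  have Te: "lin R (tensor R ?P0 N) T ?e" unfolding T_def by (rule L[OF e])
  have esurjT: "?e ` carrier (tensor R ?P0 N) = carrier T"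
    unfolding T_def by (rule tensor_right_surj[OF N e esurj])
  \<comment> \<open>On a pure tensor of \<open>c\<close> and \<open>y\<close> both sides are the
    \<open>l\<close>-th coordinate of \<open>\<iota> (e c)\<close> times \<open>y\<close>.\<close>
  have key: "tensor_coord R N n1 l (?ie u) = \<nu> (?e u) (f l)"
    if l: "l < n1" and u: "u \<in> carrier (tensor R ?P0 N)" for l u
  proof (rule tensor_eqI[OF P0 N lin_comp[OF lin_tensor_coord[OF N l] L[OF \<iota>e]]
        lin_comp[OF evH[OF f[OF l]] lin_comp[OF \<nu> Te]] _ u])
    fix c y assume c: "c \<in> carrier ?P0" and y: "y \<in> carrier N"
    note ec = lin_closed[OF e c]
    show "tensor_coord R N n1 l (?ie (pure_tensor R ?P0 N c y)) = \<nu> (?e (pure_tensor R ?P0 N c y)) (f l)"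
      unfolding tensor_right_pure[OF N \<iota>e c y] tensor_right_pure[OF N e c y]
        tensor_coord_pure[OF N l lin_closed[OF \<iota> ec] y] \<nu>pure[OF ec y f[OF l]] fa[OF ec] ..
  qed

  \<comment> \<open>Injectivity, from Tor_2\<close>
  have inj: "t = \<zero>\<^bsub>T\<^esub>" if t: "t \<in> carrier T" and \<nu>t: "\<nu> t = \<zero>\<^bsub>H\<^esub>" for t
  proof -
    obtain u where u: "u \<in> carrier (tensor R ?P0 N)" "t = ?e u" using esurjT t by blast
    have "?ie u = \<zero>\<^bsub>tensor R ?P1 N\<^esub>"
    proof (rule tensor_pow_zeroI[OF N lin_closed[OF L[OF \<iota>e] u(1)]])
      fix l assume l: "l < n1"
      show "tensor_coord R N n1 l (?ie u) = \<zero>\<^bsub>N\<^esub>"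
        using key[OF l u(1)] \<nu>t lin_zero[OF evH[OF f[OF l]]] by (simp add: u(2))
    qed
    then obtain w where w: "w \<in> carrier (tensor R ?P1 N)" "u = ?d w" using tor2[OF u(1)] by blast
    \<comment> \<open>The boundary \<open>u\<close> dies in \<open>M \<otimes> N\<close> because
      \<open>e\<close> after \<open>d0\<close> is zero.\<close>
    have "t = tensor_right R N ?P1 M (\<lambda>x. e (d0 x)) w"
      unfolding u(2) w(2) by (rule tensor_right_comp[OF N d0 e lin_comp[OF e d0] _ w(1)]) (rule refl)
    also have "\<dots> = \<zero>\<^bsub>T\<^esub>"
      unfolding T_def by (rule tensor_right_zero[OF N lin_comp[OF e d0] ed w(1)])
    finally show ?thesis .
  qed

  \<comment> \<open>Surjectivity, from Tor_1\<close>
  have surj: "\<phi> \<in> \<nu> ` carrier T" if \<phi>: "\<phi> \<in> carrier H" for \<phi>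
  proof -
    have \<phi>l: "lin R D N \<phi>"
      using \<phi> by (intro mod_hom_lin[OF D N]) (simp add: H_def hom_module_def)
    \<comment> \<open>The element of \<open>?P1 \<otimes> N\<close> whose coordinates are the values
      of \<open>\<phi>\<close> at the generators \<open>f l\<close>.\<close>
    define u where "u = (\<Oplus>\<^bsub>tensor R ?P1 N\<^esub>l\<in>{..<n1}. pure_tensor R ?P1 N (free_gen R {..<n1} l) (\<phi> (f l)))"
    interpret T1: module R "tensor R ?P1 N" by (rule tensor_is_module[OF P1 N])
    note g1 = free_gen_closed[OF R, of "{..<n1}"]
    have \<phi>f: "\<phi> (f l) \<in> carrier N" if "l < n1" for l by (rule lin_closed[OF \<phi>l f[OF that]])
    have pc: "pure_tensor R ?P1 N (free_gen R {..<n1} l) (\<phi> (f l)) \<in> carrier (tensor R ?P1 N)"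
      if "l \<in> {..<n1}" for l
      by (rule pure_tensor_closed[OF P1 N g1]) (use that \<phi>f in simp)
    have u: "u \<in> carrier (tensor R ?P1 N)"
      unfolding u_def by (rule T1.finsum_closed) (use pc in auto)
    have uc: "tensor_coord R N n1 l u = \<phi> (f l)" if l: "l < n1" for l
    proof -
      have "tensor_coord R N n1 l u = (\<Oplus>\<^bsub>N\<^esub>k\<in>{..<n1}. free_gen R {..<n1} k l \<odot>\<^bsub>N\<^esub> \<phi> (f k))"
        unfolding u_def
        by (subst lin_finsum[OF lin_tensor_coord[OF N l] _ pc], simp, simp, rule N.finsum_cong')
          (use \<phi>f pow_module_apply(4)[OF l g1] in \<open>auto simp: tensor_coord_pure[OF N l g1]\<close>)
      also have "\<dots> = (\<Oplus>\<^bsub>N\<^esub>k\<in>{..<n1}. if l = k then \<phi> (f k) else \<zero>\<^bsub>N\<^esub>)"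
        by (rule N.finsum_cong') (use \<phi>f l in \<open>auto simp: free_gen_def\<close>)
      also have "\<dots> = \<phi> (f l)" using N.finsum_singleton[of l "{..<n1}" "\<lambda>k. \<phi> (f k)"] l \<phi>f by simp
      finally show ?thesis .
    qed
    have "?d u = \<zero>\<^bsub>tensor R ?P0 N\<^esub>"
    proof (rule tensor_pow_zeroI[OF N lin_closed[OF L[OF d0] u]])
      fix k assume k: "k < n0"
      \<comment> \<open>The \<open>k\<close>-th row of the matrix of \<open>d0\<close>. The
        \<open>k\<close>-th coordinate of \<open>?d u\<close> is \<open>\<phi>\<close> applied to
        the combination of the \<open>f l\<close> with these coefficients, and that combination
        sends \<open>m\<close> to the \<open>k\<close>-th coordinate of
        \<open>d0 (\<iota> m)\<close>, which is zero.\<close>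
      define a where "a l = d0 (free_gen R {..<n1} l) k" for l
      have a: "a l \<in> carrier R" for l
        unfolding a_def by (rule pow_module_apply(4)[OF k lin_closed[OF d0 g1]])
      have "tensor_coord R N n0 k (?d u) = (\<Oplus>\<^bsub>N\<^esub>l\<in>{..<n1}. a l \<odot>\<^bsub>N\<^esub> \<phi> (f l))"
        unfolding u_def
        by (subst lin_finsum[OF lin_comp[OF lin_tensor_coord[OF N k] L[OF d0]] _ pc], simp, simp,
            rule N.finsum_cong')
          (use \<phi>f a in \<open>auto simp: a_def tensor_right_pure[OF N d0 g1]
            tensor_coord_pure[OF N k lin_closed[OF d0 g1]]\<close>)
      also have "\<dots> = (\<Oplus>\<^bsub>N\<^esub>l\<in>{..<n1}. \<phi> (a l \<odot>\<^bsub>D\<^esub> f l))"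
        by (rule N.finsum_cong') (use a f \<phi>f in \<open>auto simp: lin_smult[OF \<phi>l] intro!: lin_closed[OF \<phi>l]\<close>)
      also have "\<dots> = \<phi> (\<Oplus>\<^bsub>D\<^esub>l\<in>{..<n1}. a l \<odot>\<^bsub>D\<^esub> f l)"
        by (rule lin_finsum[OF \<phi>l, symmetric]) (use a f in auto)
      also have "(\<Oplus>\<^bsub>D\<^esub>l\<in>{..<n1}. a l \<odot>\<^bsub>D\<^esub> f l) = \<zero>\<^bsub>D\<^esub>"
      proof (rule hom_module_eqI[of _ R M "self_module R", folded DH])
        show "(\<Oplus>\<^bsub>D\<^esub>l\<in>{..<n1}. a l \<odot>\<^bsub>D\<^esub> f l) \<in> carrier D"
          by (rule D.finsum_closed) (use a f in auto)
        fix m assume m: "m \<in> carrier M"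
        note \<iota>m = lin_closed[OF \<iota> m]
        have "(\<Oplus>\<^bsub>D\<^esub>l\<in>{..<n1}. a l \<odot>\<^bsub>D\<^esub> f l) m = (\<Oplus>\<^bsub>R\<^esub>l\<in>{..<n1}. a l \<otimes>\<^bsub>R\<^esub> \<iota> m l)"
          by (rule fsum[OF a m])
        also have "\<dots> = (\<Oplus>\<^bsub>R\<^esub>l\<in>{..<n1}. \<iota> m l \<otimes>\<^bsub>R\<^esub> a l)"
          by (rule M.R.finsum_cong') (use a pow_module_apply(4)[OF _ \<iota>m] in \<open>auto simp: M.R.m_comm\<close>)
        also have "\<dots> = d0 (\<iota> m) k"
          using lin_pow_expand[OF lin_comp[OF lin_coord[OF R k] d0] \<iota>m]
          by (simp add: finsum_self_module a_def)
        also have "\<dots> = \<zero>\<^bsub>R\<^esub>" using d\<iota>[OF m] k by (simp add: pow_module_apply)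
        also have "\<dots> = \<zero>\<^bsub>D\<^esub> m" using lin_zero[OF evD[OF m]] by simp
        finally show "(\<Oplus>\<^bsub>D\<^esub>l\<in>{..<n1}. a l \<odot>\<^bsub>D\<^esub> f l) m = \<zero>\<^bsub>D\<^esub> m" .
      qed simp
      also have "\<phi> \<zero>\<^bsub>D\<^esub> = \<zero>\<^bsub>N\<^esub>" by (rule lin_zero[OF \<phi>l])
      finally show "tensor_coord R N n0 k (?d u) = \<zero>\<^bsub>N\<^esub>" .
    qed
    then obtain v where v: "v \<in> carrier (tensor R ?P0 N)" "u = ?ie v" using tor1[OF u] by blast
    define t where "t = ?e v"
    have t: "t \<in> carrier T" unfolding t_def by (rule lin_closed[OF Te v(1)])
    have \<nu>tl: "lin R D N (\<nu> t)"
      using lin_closed[OF \<nu> t] by (intro mod_hom_lin[OF D N]) (simp add: H_def hom_module_def)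
    have \<nu>f: "\<nu> t (f l) = \<phi> (f l)" if "l < n1" for l
      using key[OF that v(1)] uc[OF that] v(2) by (simp add: t_def)
    \<comment> \<open>Both maps are linear and agree at every \<open>f l\<close>, and by
      \<open>fspan\<close> these generate the dual.\<close>
    have "\<nu> t = \<phi>"
    proof (rule hom_module_eqI[OF lin_closed[OF \<nu> t, unfolded H_def] \<phi>[unfolded H_def]])
      fix g assume "g \<in> carrier D"
      then obtain a where a: "\<And>l. l < n1 \<Longrightarrow> a l \<in> carrier R"
        "g = (\<Oplus>\<^bsub>D\<^esub>l\<in>{..<n1}. a l \<odot>\<^bsub>D\<^esub> f l)" using fspan by blast
      have af: "a l \<odot>\<^bsub>D\<^esub> f l \<in> carrier D" if "l \<in> {..<n1}" for l using that a(1) f by auto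
      have "\<nu> t g = (\<Oplus>\<^bsub>N\<^esub>l\<in>{..<n1}. \<nu> t (a l \<odot>\<^bsub>D\<^esub> f l))"
        unfolding a(2) by (rule lin_finsum[OF \<nu>tl _ af]) simp_all
      also have "\<dots> = (\<Oplus>\<^bsub>N\<^esub>l\<in>{..<n1}. \<phi> (a l \<odot>\<^bsub>D\<^esub> f l))"
        by (rule N.finsum_cong')
          (use a(1) f \<phi>f in \<open>auto simp: lin_smult[OF \<nu>tl] lin_smult[OF \<phi>l] \<nu>f\<close>)
      also have "\<dots> = \<phi> g"
        unfolding a(2) by (rule lin_finsum[OF \<phi>l _ af, symmetric]) simp_all
      finally show "\<nu> t g = \<phi> g" .
    qed
    then show ?thesis using t by blast
  qed

  have "inj_on \<nu> (carrier T)"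
  proof (rule inj_onI)
    fix x y assume xy: "x \<in> carrier T" "y \<in> carrier T" "\<nu> x = \<nu> y"
    have "\<nu> (x \<ominus>\<^bsub>T\<^esub> y) = \<zero>\<^bsub>H\<^esub>"
      using lin_closed[OF \<nu> xy(2)] by (simp add: lin_diff[OF \<nu> xy(1,2)] xy(3) H.minus_eq_zero_iff)
    then have "x \<ominus>\<^bsub>T\<^esub> y = \<zero>\<^bsub>T\<^esub>" by (rule inj[OF T.minus_closed[OF xy(1,2)]])
    then show "x = y" using T.minus_eq_zero_iff[OF xy(1,2)] by simp
  qed
  moreover have "\<nu> ` carrier T = carrier H" using surj lin_closed[OF \<nu>] by blast
  ultimately have "\<nu> \<in> mod_iso R T H" using \<nu>H by (simp add: mod_iso_def bij_betw_def)
  then show ?thesis by (simp add: \<nu>_def T_def H_def D_def)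
qed

end
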